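(* Let $d\in\mathbb{N}$, let $p>2$ be an even integer or $p=\infty$, and let $p'$ be its dual exponent, $1/p+1/p'=1$. Let $f,g \in \mathcal{F}(L^{p'}(\mathbb{R}^d))$ satisfy $|\widehat{f}(\xi)| \le \widehat{g}(\xi)$ for a.e. $\xi\in\mathbb{R}^d$. In addition, assume that $\widehat{f}$ is continuous and that $\{\xi : |\widehat{f}(\xi)|>0\} \subset \mathbb{R}^d$ is a connected set. Then equality $$\|f\|_{L^p} = \|g\|_{L^p}$$ holds if and only if $$\widehat{f}(\xi) = e^{i(\alpha+\beta\cdot\xi)}\,\widehat{g}(\xi) \quad \text{for all } \xi \in \mathbb{R}^d,$$ with some constants $\alpha \in \mathbb{R}$ and $\beta \in \mathbb{R}^d$.
   Context: The Fourier transform is $\widehat{f}(\xi) = (\mathcal{F} f)(\xi) = \int_{\mathbb{R}^d} e^{-2\pi i x\cdot \xi} f(x)\,dx$ for Schwartz functions, extended to tempered distributions by duality. For $q \in [1,\infty]$, $\mathcal{F}(L^q(\mathbb{R}^d))$ is the space of tempered distributions $f$ with $f = \widehat{h}$ for some $h \in L^q(\mathbb{R}^d)$ (equivalently, $\widehat f \in L^q(\mathbb{R}^d)$). Functions in $L^{p'}$ are identified when they agree almost everywhere; the identity "for all $\xi$" is understood for suitable (continuous) representatives of $\widehat f$ and $\widehat g$. The empty set is counted as connected. *)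

theory Defs
  imports "HOL-Probability.Probability"
begin

text \<open>
  \<open>\<real>\<^sup>d\<close> is rendered as a type \<open>'a :: euclidean_space\<close>, with \<open>d = DIM('a)\<close>. Elements of
  \<open>L\<^sup>q\<close> are represented by Borel functions; every Lebesgue class contains one.
\<close>

definition lnorm :: "ennreal \<Rightarrow> ('a::euclidean_space \<Rightarrow> complex) \<Rightarrow> ennreal" where
  "lnorm q u =
     (if q = \<infinity> then esssup lborel (\<lambda>x. ennreal (norm (u x)))
      else let I = (\<integral>\<^sup>+x. ennreal (norm (u x) powr enn2real q) \<partial>lborel)
           in if I = \<infinity> then \<infinity> else ennreal (enn2real I powr (1 / enn2real q)))"

definition Lspace :: "ennreal \<Rightarrow> ('a::euclidean_space \<Rightarrow> complex) set" where
  "Lspace q = {u \<in> borel_measurable borel. lnorm q u < \<infinity>}"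

text \<open>
  The list \<open>[b\<^sub>1, \<dots>, b\<^sub>m]\<close> of basis vectors plays the role of a multi-index. When all
  iterated derivatives are differentiable, \<open>iter_partial\<close> is the usual iterated partial
  derivative \<open>\<partial>\<^bsub>b\<^sub>1\<^esub> \<dots> \<partial>\<^bsub>b\<^sub>m\<^esub> \<phi>\<close>.
\<close>

fun iter_partial ::
  "'a list \<Rightarrow> ('a::euclidean_space \<Rightarrow> complex) \<Rightarrow> 'a \<Rightarrow> complex" where
  "iter_partial [] \<phi> = \<phi>"
| "iter_partial (b # bs) \<phi> = (\<lambda>x. frechet_derivative (iter_partial bs \<phi>) (at x) b)"

definition smooth :: "('a::euclidean_space \<Rightarrow> complex) \<Rightarrow> bool" where
  "smooth \<phi> \<longleftrightarrow>
     (\<forall>bs. set bs \<subseteq> Basis \<longrightarrow> (\<forall>x. iter_partial bs \<phi> differentiable (at x)))"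

definition schwartz :: "('a::euclidean_space \<Rightarrow> complex) set" where
  "schwartz = {\<phi>. smooth \<phi> \<and>
     (\<forall>k bs. set bs \<subseteq> Basis \<longrightarrow> bounded (range (\<lambda>x. norm x ^ k *\<^sub>R iter_partial bs \<phi> x)))}"

definition schwartz_null ::
  "(nat \<Rightarrow> 'a::euclidean_space \<Rightarrow> complex) \<Rightarrow> bool" where
  "schwartz_null \<Phi> \<longleftrightarrow>
     (\<forall>k bs. set bs \<subseteq> Basis \<longrightarrow>
        uniform_limit UNIV (\<lambda>n x. norm x ^ k *\<^sub>R iter_partial bs (\<Phi> n) x) (\<lambda>_. 0) sequentially)"

text \<open>
  Distributions are functions on all of \<open>'a \<Rightarrow> complex\<close>, but only their values on \<open>schwartz\<close>
  matter: two of them are equal when \<open>td_eq\<close> holds. Since the Schwartz space is metrizable,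
  sequential continuity at \<open>0\<close> of a linear functional is continuity.
\<close>

type_synonym 'a functional = "('a \<Rightarrow> complex) \<Rightarrow> complex"

definition tempered :: "'a::euclidean_space functional \<Rightarrow> bool" where
  "tempered T \<longleftrightarrow>
     (\<forall>\<phi>\<in>schwartz. \<forall>\<psi>\<in>schwartz. \<forall>a b. T (\<lambda>x. a * \<phi> x + b * \<psi> x) = a * T \<phi> + b * T \<psi>) \<and>
     (\<forall>\<Phi>. (\<forall>n. \<Phi> n \<in> schwartz) \<and> schwartz_null \<Phi> \<longrightarrow> (\<lambda>n. T (\<Phi> n)) \<longlonglongrightarrow> 0)"

definition td_eq :: "'a::euclidean_space functional \<Rightarrow> 'a functional \<Rightarrow> bool" where
  "td_eq S T \<longleftrightarrow> (\<forall>\<phi>\<in>schwartz. S \<phi> = T \<phi>)"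

definition td_of_fun :: "('a::euclidean_space \<Rightarrow> complex) \<Rightarrow> 'a functional" where
  "td_of_fun u \<phi> = (\<integral>x. u x * \<phi> x \<partial>lborel)"

definition fourier :: "('a::euclidean_space \<Rightarrow> complex) \<Rightarrow> 'a \<Rightarrow> complex" where
  "fourier \<phi> \<xi> = (\<integral>x. cis (- 2 * pi * (x \<bullet> \<xi>)) * \<phi> x \<partial>lborel)"

definition td_fourier :: "'a::euclidean_space functional \<Rightarrow> 'a functional" where
  "td_fourier T \<phi> = T (fourier \<phi>)"

definition FL :: "ennreal \<Rightarrow> 'a::euclidean_space functional set" where
  "FL q = {T. tempered T \<and> (\<exists>h\<in>Lspace q. td_eq T (td_fourier (td_of_fun h)))}"

text \<open>
  The \<open>L\<^sup>p\<close> norm of a tempered distribution, \<open>\<infinity>\<close> if it is not given by an \<open>L\<^sup>p\<close> function.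
  The representing function is unique up to null sets, so the infimum is over at most one value.
\<close>

definition td_lnorm :: "ennreal \<Rightarrow> 'a::euclidean_space functional \<Rightarrow> ennreal" where
  "td_lnorm p T = (INF u\<in>{u \<in> Lspace p. td_eq T (td_of_fun u)}. lnorm p u)"

end

(*
  Write f as the Fourier transform of a(x) = fhat(-x), and g as that of B(x) = ghat(-x) >= |a(x)|.
  If p = 2k, then |f|^(2k) is the Fourier transform of a 2k-fold convolution D of copies of a and of
  its reflected conjugate, so the p-th power of the norm of f is D(0), a multilinear integral over the
  hyperplane where the frequencies sum to zero; for exponent p' it converges by Young's inequality,
  and truncation extends the identity from bounded integrable functions to L^(p').
  Equal norms of f and g force equality of the two integrands almost everywhere.  Hence |fhat| = ghat
  a.e., and the phase u of fhat satisfies u(x) u(y) = u(x') u(y') whenever x + y = x' + y' in the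
  connected open set where fhat does not vanish; such a u is a constant times a character.
  If p is infinite, f is continuous and vanishes at infinity by the Riemann-Lebesgue lemma, so |f|
  attains its supremum, which equals the integral of ghat; this is the equality case of the triangle
  inequality for integrals.
*)
theory Submission
  imports Defs
begin

subsection \<open>Lebesgue measure under affine maps\<close>

text \<open>The identity for the norm is Fourier inversion at the single point 0. With n = p - 1,
  the transform of \<open>D\<close> is nonnegative, and this replaces its integrability: Gaussian
  weights increase to 1, so monotone convergence yields \<open>D 0\<close> as soon as
  \<open>D\<close> is bounded and continuous at 0. Continuity is drawn from one bounded factor,
  which is why truncations come in. The condition p > 2 enters as n \<ge> 3. Then the hyperplane has
  room for two pairs y, z and y', z' with equal sums; for n = 1 the integrand is |a|^2 and carries
  no phase. Distributions are compared on Gaussians times exponentials only. A modulated Gaussian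
  and its transform both have this form, and integrating u against all modulated Gaussians computes
  the Fourier transform of \<open>u * gauss\<close>, which is integrable for every u in L^q with q
  \<ge> 1. So uniqueness of the Fourier transform on L^1 settles every question of uniqueness. The
  converse direction rests on the fact that multiplying h by a character translates its Fourier
  transform, and translation preserves norms.\<close>

lemma nn_integral_lborel_affine:
  fixes f :: "'a::euclidean_space \<Rightarrow> ennreal"
  assumes [measurable]: "f \<in> borel_measurable borel" and "c \<noteq> 0"
  shows "(\<integral>\<^sup>+x. f x \<partial>lborel) = ennreal (\<bar>c\<bar> ^ DIM('a)) * (\<integral>\<^sup>+x. f (t + c *\<^sub>R x) \<partial>lborel)"
  by (subst lborel_affine[OF \<open>c \<noteq> 0\<close>, of t])
    (simp add: nn_integral_density nn_integral_distr nn_integral_cmult)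

lemma integrable_lborel_affine:
  fixes f :: "'a::euclidean_space \<Rightarrow> 'b::{banach, second_countable_topology}"
  assumes f: "integrable lborel f" and "c \<noteq> 0"
  shows "integrable lborel (\<lambda>x. f (t + c *\<^sub>R x))"
proof -
  have pos: "\<not> \<bar>c\<bar> ^ DIM('a) \<le> 0" using \<open>c \<noteq> 0\<close> by (simp add: not_le)
  have [measurable]: "f \<in> borel_measurable borel" using f by auto
  have "(\<integral>\<^sup>+x. norm (f x) \<partial>lborel) < \<infinity>"
    using f by (simp add: integrable_iff_bounded)
  then have "ennreal (\<bar>c\<bar> ^ DIM('a)) * (\<integral>\<^sup>+x. norm (f (t + c *\<^sub>R x)) \<partial>lborel) < \<infinity>"
    by (subst (asm) nn_integral_lborel_affine[OF _ \<open>c \<noteq> 0\<close>, of _ t]) simp_all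
  then have "(\<integral>\<^sup>+x. norm (f (t + c *\<^sub>R x)) \<partial>lborel) < \<infinity>"
    using pos
    by (auto simp: ennreal_mult_less_top ennreal_eq_0_iff)
  then show ?thesis by (simp add: integrable_iff_bounded)
qed

lemma integral_lborel_affine:
  fixes f :: "'a::euclidean_space \<Rightarrow> 'b::{banach, second_countable_topology}"
  assumes [measurable]: "f \<in> borel_measurable borel" and "c \<noteq> 0"
  shows "(\<integral>x. f x \<partial>lborel) = (\<bar>c\<bar> ^ DIM('a)) *\<^sub>R (\<integral>x. f (t + c *\<^sub>R x) \<partial>lborel)"
  by (subst lborel_affine[OF \<open>c \<noteq> 0\<close>, of t])
    (simp add: integral_density integral_distr)

lemma AE_lborel_affine:
  fixes P :: "'a::euclidean_space \<Rightarrow> bool"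
  assumes P: "AE x in lborel. P x" and "c \<noteq> 0"
  shows "AE x in lborel. P (t + c *\<^sub>R x)"
proof -
  have pos: "\<not> \<bar>c\<bar> ^ DIM('a) \<le> 0" using \<open>c \<noteq> 0\<close> by (simp add: not_le)
  from P obtain N where N: "N \<in> null_sets lborel" "{x. \<not> P x} \<subseteq> N"
    by (auto simp: eventually_ae_filter)
  have [measurable]: "N \<in> sets borel" using N by auto
  have "ennreal (\<bar>c\<bar> ^ DIM('a)) * (\<integral>\<^sup>+x. indicator N (t + c *\<^sub>R x) \<partial>lborel) = 0"
    using N by (subst nn_integral_lborel_affine[OF _ \<open>c \<noteq> 0\<close>, symmetric]) auto
  then have "(\<integral>\<^sup>+x. indicator N (t + c *\<^sub>R x) \<partial>lborel) = 0"
    using pos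
    by (auto simp: ennreal_eq_0_iff)
  then have "AE x in lborel. indicator N (t + c *\<^sub>R x) = (0::ennreal)"
    by (subst (asm) nn_integral_0_iff_AE) auto
  then show ?thesis
    by eventually_elim (use N in \<open>auto simp: indicator_def split: if_splits\<close>)
qed

lemma nn_integral_shift_reflect:
  fixes f :: "'a::euclidean_space \<Rightarrow> ennreal"
  assumes "f \<in> borel_measurable borel"
  shows "(\<integral>\<^sup>+x. f (t + x) \<partial>lborel) = (\<integral>\<^sup>+x. f x \<partial>lborel)"
    "(\<integral>\<^sup>+x. f (t - x) \<partial>lborel) = (\<integral>\<^sup>+x. f x \<partial>lborel)"
  using nn_integral_lborel_affine[OF assms, of 1 t] nn_integral_lborel_affine[OF assms, of "-1" t] by simp_all

lemma integral_shift_reflect: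
  fixes f :: "'a::euclidean_space \<Rightarrow> 'b::{banach, second_countable_topology}"
  assumes "f \<in> borel_measurable borel"
  shows "(\<integral>x. f (t + x) \<partial>lborel) = (\<integral>x. f x \<partial>lborel)"
    "(\<integral>x. f (t - x) \<partial>lborel) = (\<integral>x. f x \<partial>lborel)"
  using integral_lborel_affine[OF assms, of 1 t] integral_lborel_affine[OF assms, of "-1" t] by simp_all

lemma integrable_shift_reflect:
  fixes f :: "'a::euclidean_space \<Rightarrow> 'b::{banach, second_countable_topology}"
  assumes "integrable lborel f"
  shows "integrable lborel (\<lambda>x. f (t + x))" "integrable lborel (\<lambda>x. f (t - x))"
  using integrable_lborel_affine[OF assms, of 1 t] integrable_lborel_affine[OF assms, of "-1" t] by simp_all

lemma AE_shift_reflect: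
  fixes P :: "'a::euclidean_space \<Rightarrow> bool"
  assumes "AE x in lborel. P x"
  shows "AE x in lborel. P (t + x)" "AE x in lborel. P (t - x)"
  using AE_lborel_affine[OF assms, of 1 t] AE_lborel_affine[OF assms, of "-1" t] by simp_all

subsection \<open>Continuity of translation in the mean\<close>

text \<open>\<open>measurable_on\<close> asks for a limit of continuous functions off a negligible
  set, and on the whole space it is equivalent to Lebesgue measurability. This takes the place of
  Lusin's theorem in the approximation that follows.\<close>

lemma borel_AE_limit_continuous:
  fixes f :: "'a::euclidean_space \<Rightarrow> real"
  assumes "f \<in> borel_measurable borel"
  obtains g where "\<And>n::nat. continuous_on UNIV (g n)" "AE x in lborel. (\<lambda>n. g n x) \<longlonglongrightarrow> f x"
proof -
  have "f \<in> borel_measurable (lebesgue_on UNIV)"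
    using assms by (simp add: lebesgue_on_UNIV_eq measurable_completion)
  then have "f measurable_on UNIV"
    by (simp add: measurable_on_iff_borel_measurable)
  then obtain N g where N: "negligible N" and g: "\<And>n::nat. continuous_on UNIV (g n)"
    and lim: "\<And>x. x \<notin> N \<Longrightarrow> (\<lambda>n. g n x) \<longlonglongrightarrow> f x"
    unfolding measurable_on_def by auto
  have "AE x in lebesgue. x \<notin> N"
    using N by (intro AE_not_in) (simp add: negligible_iff_null_sets)
  then have "AE x in lebesgue. (\<lambda>n. g n x) \<longlonglongrightarrow> f x"
    by eventually_elim (rule lim)
  then have "AE x in lborel. (\<lambda>n. g n x) \<longlonglongrightarrow> f x"
    by (simp add: AE_completion_iff)
  with g that show thesis by blast
qed

text \<open>A pointwise limit of continuous functions comes without domination; clamping the values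
  and cutting off in space supplies it. First \<open>f\<close> is replaced by its clamped cutoff,
  then \<open>f\<close> inside the clamp by a continuous \<open>g n\<close>; each change is small by
  dominated convergence.\<close>

lemma integrable_continuous_approx:
  fixes f :: "'a::euclidean_space \<Rightarrow> real"
  assumes f: "integrable lborel f" and "e > 0"
  obtains w where "continuous_on UNIV w" "integrable lborel w" "bounded (support_on UNIV w)"
     "(\<integral>x. \<bar>f x - w x\<bar> \<partial>lborel) < e"
proof -
  have [measurable]: "f \<in> borel_measurable borel" using f by auto
  obtain g where g: "\<And>n::nat. continuous_on UNIV (g n)" and lim: "AE x in lborel. (\<lambda>n. g n x) \<longlonglongrightarrow> f x"
    using borel_AE_limit_continuous[of f] by auto
  have [measurable]: "g n \<in> borel_measurable borel" for n
    using g by (rule borel_measurable_continuous_onI)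
  \<comment> \<open>\<open>chi R\<close> is 1 where \<open>norm x \<le> R - 1\<close> and 0 where
    \<open>norm x \<ge> R\<close>. Hence \<open>chi R x * clamp R t\<close> is continuous in x and
    t, bounded by R, and supported in a ball.\<close>
  define clamp where "clamp R t = max (- R) (min R t)" for R t :: real
  define chi where "chi R x = max 0 (min 1 (R - norm x))" for R and x :: 'a
  have clamp[simp]: "\<bar>clamp R t\<bar> \<le> R" if "0 \<le> R" for R t
    using that by (auto simp: clamp_def)
  have chi01[simp]: "0 \<le> chi R x" "chi R x \<le> 1" for R x by (auto simp: chi_def)
  have [continuous_intros]: "continuous_on S (chi R)" for R S
    unfolding chi_def by (intro continuous_intros)
  have [measurable]: "chi R \<in> borel_measurable borel" for R
    by (intro borel_measurable_continuous_onI continuous_intros)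
  have clampc: "continuous_on S (clamp R)" for R S
    unfolding clamp_def by (intro continuous_intros)
  have [measurable]: "clamp R \<in> borel_measurable borel" for R
    by (intro borel_measurable_continuous_onI clampc)
  have chib: "chi R x \<le> indicator (cball 0 R) x" for R x
    by (auto simp: chi_def indicator_def)
  have int0: "integrable lborel (indicat_real (cball (0::'a) R))" for R
    by (intro integrable_real_indicator emeasure_bounded_finite) auto
  then have int: "integrable lborel (\<lambda>x::'a. R * indicator (cball 0 R) x)" for R
    by (intro integrable_mult_right)
  have "(\<lambda>n. \<integral>x. \<bar>f x - chi (real n) x * clamp (real n) (f x)\<bar> \<partial>lborel) \<longlonglongrightarrow> (\<integral>x. 0 \<partial>(lborel::'a measure))"
  proof (rule integral_dominated_convergence[where w="\<lambda>x. 2 * \<bar>f x\<bar>"])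
    show "AE x in lborel. (\<lambda>n. \<bar>f x - chi (real n) x * clamp (real n) (f x)\<bar>) \<longlonglongrightarrow> 0"
    proof (rule AE_I2)
      fix x
      have "eventually (\<lambda>n. real n > norm x + 1 + \<bar>f x\<bar>) sequentially"
        using filterlim_real_sequentially by (simp add: filterlim_at_top_dense)
      then have "eventually (\<lambda>n. \<bar>f x - chi (real n) x * clamp (real n) (f x)\<bar> = 0) sequentially"
        proof eventually_elim
        case (elim n)
        then have "chi (real n) x = 1" "clamp (real n) (f x) = f x"
          using norm_ge_zero[of x] unfolding chi_def clamp_def by linarith+
        then show ?case by simp
      qed
      then show "(\<lambda>n. \<bar>f x - chi (real n) x * clamp (real n) (f x)\<bar>) \<longlonglongrightarrow> 0"
        by (rule tendsto_eventually)
    qed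
    show "AE x in lborel. norm \<bar>f x - chi (real n) x * clamp (real n) (f x)\<bar> \<le> 2 * \<bar>f x\<bar>" for n
    proof (rule AE_I2)
      fix x
      have "\<bar>chi (real n) x * clamp (real n) (f x)\<bar> \<le> 1 * \<bar>f x\<bar>"
        unfolding abs_mult by (intro mult_mono) (auto simp: clamp_def)
      then show "norm \<bar>f x - chi (real n) x * clamp (real n) (f x)\<bar> \<le> 2 * \<bar>f x\<bar>" by simp
    qed
  qed (use f in auto)
  then have "eventually (\<lambda>n. (\<integral>x. \<bar>f x - chi (real n) x * clamp (real n) (f x)\<bar> \<partial>lborel) < e/2) sequentially"
    using \<open>e > 0\<close> by (intro order_tendstoD) auto
  then obtain R :: nat where R: "(\<integral>x. \<bar>f x - chi R x * clamp R (f x)\<bar> \<partial>lborel) < e/2"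
    by (auto simp: eventually_sequentially)
  have cc: "integrable lborel (\<lambda>x. chi R x * clamp R (h x))" if [measurable]: "h \<in> borel_measurable borel" for h
    by (rule Bochner_Integration.integrable_bound[OF int[of R]])
       (auto simp: abs_mult mult.commute[of "real R"] intro!: mult_mono chib)
  have "(\<lambda>n. \<integral>x. \<bar>chi R x * clamp R (f x) - chi R x * clamp R (g n x)\<bar> \<partial>lborel) \<longlonglongrightarrow> (\<integral>x. 0 \<partial>(lborel::'a measure))"
  proof (rule integral_dominated_convergence[where w="\<lambda>x. 2 * (real R * indicator (cball 0 R) x)"])
    show "AE x in lborel. (\<lambda>n. \<bar>chi R x * clamp R (f x) - chi R x * clamp R (g n x)\<bar>) \<longlonglongrightarrow> 0"
      using lim
    proof eventually_elim
      case (elim x)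
      have "(\<lambda>n. clamp R (g n x)) \<longlonglongrightarrow> clamp R (f x)"
        unfolding clamp_def by (intro tendsto_intros elim)
      then have "(\<lambda>n. \<bar>chi R x * clamp R (f x) - chi R x * clamp R (g n x)\<bar>) \<longlonglongrightarrow>
           \<bar>chi R x * clamp R (f x) - chi R x * clamp R (f x)\<bar>"
        by (intro tendsto_intros)
      then show ?case by simp
    qed
    show "AE x in lborel. norm \<bar>chi R x * clamp R (f x) - chi R x * clamp R (g n x)\<bar> \<le> 2 * (real R * indicator (cball 0 R) x)" for n
    proof (rule AE_I2)
      fix x
      have *: "\<bar>chi R x * clamp R t\<bar> \<le> real R * indicator (cball 0 R) x" for t
        by (auto simp: abs_mult mult.commute[of "real R"] intro!: mult_mono chib)
      show "norm \<bar>chi R x * clamp R (f x) - chi R x * clamp R (g n x)\<bar> \<le> 2 * (real R * indicator (cball 0 R) x)"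
        using *[of "f x"] *[of "g n x"] by simp
    qed
  qed (use int0 in auto)
  then have "eventually (\<lambda>n. (\<integral>x. \<bar>chi R x * clamp R (f x) - chi R x * clamp R (g n x)\<bar> \<partial>lborel) < e/2) sequentially"
    using \<open>e > 0\<close> by (intro order_tendstoD) auto
  then obtain n where n: "(\<integral>x. \<bar>chi R x * clamp R (f x) - chi R x * clamp R (g n x)\<bar> \<partial>lborel) < e/2"
    by (auto simp: eventually_sequentially)
  let ?w = "\<lambda>x. chi R x * clamp R (g n x)"
  show thesis
  proof
    show "continuous_on UNIV ?w"
      by (intro continuous_intros continuous_on_compose2[OF clampc g]) auto
    show "integrable lborel ?w" by (rule cc) auto
    show "bounded (support_on UNIV ?w)"
      by (rule bounded_subset[OF bounded_cball[of 0 "real R"]])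
         (auto simp: support_on_def chi_def max_def min_def split: if_splits)
    have "(\<integral>x. \<bar>f x - ?w x\<bar> \<partial>lborel) \<le> (\<integral>x. \<bar>f x - chi R x * clamp R (f x)\<bar> + \<bar>chi R x * clamp R (f x) - ?w x\<bar> \<partial>lborel)"
      by (intro integral_mono Bochner_Integration.integrable_add integrable_abs Bochner_Integration.integrable_diff cc f) auto
    also have "\<dots> = (\<integral>x. \<bar>f x - chi R x * clamp R (f x)\<bar> \<partial>lborel) + (\<integral>x. \<bar>chi R x * clamp R (f x) - ?w x\<bar> \<partial>lborel)"
      by (intro Bochner_Integration.integral_add integrable_abs Bochner_Integration.integrable_diff cc f) auto
    finally show "(\<integral>x. \<bar>f x - ?w x\<bar> \<partial>lborel) < e" using R n by linarith
  qed
qed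

text \<open>For a continuous function with bounded support this is uniform continuity. The
  approximation error enters twice, once translated, and translation preserves it: hence three parts
  of size e/3.\<close>

lemma mean_translation_continuous_real:
  fixes f :: "'a::euclidean_space \<Rightarrow> real"
  assumes f: "integrable lborel f"
  shows "((\<lambda>y. \<integral>x. \<bar>f (x + y) - f x\<bar> \<partial>lborel) \<longlongrightarrow> 0) (at 0)"
proof (rule tendstoI)
  fix e :: real assume e: "e > 0"
  have [measurable]: "f \<in> borel_measurable borel" using f by auto
  obtain w where w: "continuous_on UNIV w" "integrable lborel w" "bounded (support_on UNIV w)"
     "(\<integral>x. \<bar>f x - w x\<bar> \<partial>lborel) < e/3"
    using integrable_continuous_approx[OF f, of "e/3"] e by auto
  have [measurable]: "w \<in> borel_measurable borel" using w by auto
  obtain R where R: "R > 0" "\<And>x. w x \<noteq> 0 \<Longrightarrow> norm x \<le> R"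
    using w(3) unfolding bounded_pos by (auto simp: support_on_def)
  have tr: "integrable lborel (\<lambda>x. h (x + y))" if "integrable lborel h" for h :: "'a \<Rightarrow> real" and y
    using integrable_shift_reflect(1)[OF that, of y] by (simp add: add.commute)
  \<comment> \<open>The summand 1 keeps \<open>V\<close> positive and makes the later bound by e/3
    strict.\<close>
  define V where "V = measure lborel (cball (0::'a) (R+1)) + 1"
  have V: "V > 0" by (simp add: V_def add_nonneg_pos)
  have "uniformly_continuous_on (cball 0 (R+2)) w"
    by (rule compact_uniformly_continuous) (auto intro: continuous_on_subset[OF w(1)])
  then obtain d where d: "d > 0" "\<And>x x'. x \<in> cball 0 (R+2) \<Longrightarrow> x' \<in> cball 0 (R+2) \<Longrightarrow> dist x' x < d \<Longrightarrow> dist (w x') (w x) < e/(3*V)"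
    unfolding uniformly_continuous_on_def using e V by (metis divide_pos_pos mult_pos_pos zero_less_numeral)
  have main: "(\<integral>x. \<bar>f (x + y) - f x\<bar> \<partial>lborel) < e" if y: "norm y < min d 1" for y
  proof -
    have ptw: "\<bar>w (x + y) - w x\<bar> \<le> e/(3*V) * indicator (cball 0 (R+1)) x" for x
    proof (cases "norm x \<le> R + 1")
      case True
      have "norm (x + y) \<le> R + 2" using norm_triangle_ineq[of x y] y True by linarith
      then have "dist (w (x + y)) (w x) < e/(3*V)" using True y by (intro d(2)) (auto simp: dist_norm mem_cball_0 simp del: mem_cball)
      then show ?thesis using True by (simp add: dist_real_def)
    next
      case False
      have "norm x \<le> norm (x + y) + norm y" using norm_triangle_ineq4[of "x+y" y] by simp
      then have "norm (x + y) > R" using y False by linarith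
      then have "w (x + y) = 0" "w x = 0" using R(2)[of "x+y"] R(2)[of x] False by force+
      then show ?thesis using e V by simp
    qed
    have wi: "integrable lborel (\<lambda>x. w (x + y))" "integrable lborel (\<lambda>x. f (x + y))" by (intro tr w f)+
    have "(\<integral>x. \<bar>w (x + y) - w x\<bar> \<partial>lborel) \<le> (\<integral>x. e/(3*V) * indicator (cball 0 (R+1)) x \<partial>(lborel::'a measure))"
      by (intro integral_mono integrable_abs Bochner_Integration.integrable_diff w wi ptw integrable_mult_right
            integrable_real_indicator emeasure_bounded_finite) auto
    also have "\<dots> = e/(3*V) * measure lborel (cball (0::'a) (R+1))" by simp
    also have "\<dots> < e/3" using e V by (simp add: V_def field_simps)
    finally have 1: "(\<integral>x. \<bar>w (x + y) - w x\<bar> \<partial>lborel) < e/3" .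
    have 2: "(\<integral>x. \<bar>f (x + y) - w (x + y)\<bar> \<partial>lborel) = (\<integral>x. \<bar>f x - w x\<bar> \<partial>lborel)"
      using integral_shift_reflect(1)[of "\<lambda>x. \<bar>f x - w x\<bar>" y] by (simp add: add.commute)
    have "(\<integral>x. \<bar>f (x + y) - f x\<bar> \<partial>lborel) \<le>
       (\<integral>x. \<bar>f (x + y) - w (x + y)\<bar> + \<bar>w (x + y) - w x\<bar> + \<bar>f x - w x\<bar> \<partial>lborel)"
      by (intro integral_mono Bochner_Integration.integrable_add integrable_abs Bochner_Integration.integrable_diff w wi f) auto
    also have "\<dots> = (\<integral>x. \<bar>f (x + y) - w (x + y)\<bar> \<partial>lborel) + (\<integral>x. \<bar>w (x + y) - w x\<bar> \<partial>lborel) + (\<integral>x. \<bar>f x - w x\<bar> \<partial>lborel)"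
      by (subst Bochner_Integration.integral_add; (intro Bochner_Integration.integrable_add integrable_abs Bochner_Integration.integrable_diff w wi f)?)+ simp
    finally show ?thesis using 1 2 w(4) by linarith
  qed
  show "\<forall>\<^sub>F y in at 0. dist (\<integral>x. \<bar>f (x + y) - f x\<bar> \<partial>lborel) 0 < e"
    unfolding eventually_at
    by (rule exI[of _ "min d 1"]) (use d main in \<open>auto simp: dist_norm\<close>)
qed

lemma mean_translation_continuous:
  fixes f :: "'a::euclidean_space \<Rightarrow> complex"
  assumes f: "integrable lborel f"
  shows "((\<lambda>y. \<integral>x. norm (f (x + y) - f x) \<partial>lborel) \<longlongrightarrow> 0) (at 0)"
proof -
  have [measurable]: "f \<in> borel_measurable borel" using f by auto
  have tr: "integrable lborel (\<lambda>x. f (x + y))" for y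
    using integrable_shift_reflect(1)[OF f, of y] by (simp add: add.commute)
  note i = integrable_Re[OF f] integrable_Im[OF f]
  let ?w = "\<lambda>y. (\<integral>x. \<bar>Re (f (x + y)) - Re (f x)\<bar> \<partial>lborel) + (\<integral>x. \<bar>Im (f (x + y)) - Im (f x)\<bar> \<partial>lborel)"
  have "(?w \<longlongrightarrow> 0 + 0) (at 0)"
    by (intro tendsto_add mean_translation_continuous_real i)
  then have lim: "(?w \<longlongrightarrow> 0) (at 0)" by simp
  have le: "(\<integral>x. norm (f (x + y) - f x) \<partial>lborel) \<le> ?w y" for y
  proof -
    have "(\<integral>x. norm (f (x + y) - f x) \<partial>lborel) \<le> (\<integral>x. \<bar>Re (f (x + y)) - Re (f x)\<bar> + \<bar>Im (f (x + y)) - Im (f x)\<bar> \<partial>lborel)"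
      using tr f by (intro integral_mono)
        (auto intro!: Bochner_Integration.integrable_add integrable_abs Bochner_Integration.integrable_diff integrable_Re integrable_Im
          intro: order_trans[OF cmod_le])
    also have "\<dots> = ?w y"
      using tr f by (intro Bochner_Integration.integral_add integrable_abs Bochner_Integration.integrable_diff integrable_Re integrable_Im)
    finally show ?thesis .
  qed
  show ?thesis
    by (rule tendsto_sandwich[OF _ _ tendsto_const lim]) (auto intro!: always_eventually le)
qed

subsection \<open>Gaussians\<close>

text \<open>The factor \<open>pi\<close> in the exponent makes this function its own Fourier
  transform, with integral 1.\<close>

definition gauss :: "'a::euclidean_space \<Rightarrow> real" where
  "gauss x = exp (- pi * (norm x)\<^sup>2)"

lemma gauss_pos [simp]: "0 < gauss x" "0 \<le> gauss x" "\<bar>gauss x\<bar> = gauss x"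
  by (simp_all add: gauss_def)

lemma gauss_le_1: "gauss x \<le> 1"
  by (simp add: gauss_def)

lemma gauss_measurable [measurable]: "gauss \<in> borel_measurable borel"
  unfolding gauss_def[abs_def] by measurable

lemma gauss_uminus [simp]: "gauss (- x) = gauss x"
  by (simp add: gauss_def)

lemma has_integral_gauss_cis_real:
  "has_bochner_integral lborel (\<lambda>t::real. complex_of_real (exp (- pi * t\<^sup>2)) * cis (- 2 * pi * (t * s))) (of_real (exp (- pi * s\<^sup>2)))"
proof -
  \<comment> \<open>The substitution \<open>x = c * t\<close> turns \<open>exp (- x^2 / 2)\<close>
    into \<open>exp (- pi * t^2)\<close>, so that the characteristic function of the standard normal
    law does the computation.\<close>
  define c where "c = sqrt (2 * pi)"
  have c: "c > 0" "c * c = 2 * pi" by (simp_all add: c_def)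
  define f where "f x = std_normal_density x *\<^sub>R iexp ((- c * s) * x)" for x
  have [measurable]: "f \<in> borel_measurable borel" unfolding f_def by measurable
  have fi: "integrable lborel f"
    unfolding f_def
    by (rule Bochner_Integration.integrable_bound[OF integrable_std_normal_moment[of 0]])
       (auto simp: norm_mult)
  have fint: "(\<integral>x. f x \<partial>lborel) = of_real (exp (- pi * s\<^sup>2))"
  proof -
    have "(\<integral>x. f x \<partial>lborel) = char std_normal_distribution (- c * s)"
      unfolding f_def char_def by (subst integral_density) (auto simp: normal_density_nonneg)
    also have "\<dots> = of_real (exp (- ((- c * s)\<^sup>2) / 2))"
      by (simp add: char_std_normal_distribution)
    also have "(- c * s)\<^sup>2 = 2 * pi * s\<^sup>2"
      using c by (simp add: power2_eq_square algebra_simps)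
    finally show ?thesis by simp
  qed
  have *: "f (0 + c *\<^sub>R t) = (1 / c) *\<^sub>R (complex_of_real (exp (- pi * t\<^sup>2)) * cis (- 2 * pi * (t * s)))" for t
  proof -
    have "(c * t)\<^sup>2 = 2 * pi * t\<^sup>2" using c by (simp add: power2_eq_square algebra_simps)
    moreover have **: "(- c * s) * (c * t) = - 2 * pi * (t * s)"
      using c by (simp add: algebra_simps)
    moreover have "f (0 + c *\<^sub>R t) = std_normal_density (c * t) *\<^sub>R cis ((- c * s) * (c * t))"
      unfolding f_def cis_conv_exp by simp
    ultimately show ?thesis
      unfolding ** by (simp add: std_normal_density_def c_def[symmetric] scaleR_conv_of_real)
  qed
  have 1: "integrable lborel (\<lambda>t. c *\<^sub>R f (0 + c *\<^sub>R t))"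
    using integrable_lborel_affine[OF fi, of c 0] c by (intro integrable_scaleR_right) auto
  have 2: "(\<integral>t. c *\<^sub>R f (0 + c *\<^sub>R t) \<partial>lborel) = of_real (exp (- pi * s\<^sup>2))"
    using integral_lborel_affine[of f c 0] c fint by simp
  have 3: "c *\<^sub>R f (0 + c *\<^sub>R t) = complex_of_real (exp (- pi * t\<^sup>2)) * cis (- 2 * pi * (t * s))" for t
    unfolding * using c by simp
  show ?thesis
    using 1 2 unfolding 3 by (simp add: has_bochner_integral_iff)
qed

text \<open>By definition \<open>lborel\<close> is the image of a product of one-dimensional
  Lebesgue measures under the coordinate parametrisation, so Fubini applies one coordinate at a
  time.\<close>

lemma has_integral_lborel_prod:
  fixes f :: "'a::euclidean_space \<Rightarrow> real \<Rightarrow> complex"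
  assumes f: "\<And>b. b \<in> Basis \<Longrightarrow> has_bochner_integral lborel (f b) (I b)"
  shows "has_bochner_integral lborel (\<lambda>x. \<Prod>b\<in>Basis. f b (x \<bullet> b)) (\<Prod>b\<in>Basis. I b)"
proof -
  interpret P: product_sigma_finite "\<lambda>b::'a. lborel :: real measure" by standard
  have [measurable]: "b \<in> Basis \<Longrightarrow> f b \<in> borel_measurable borel" for b
    using has_bochner_integral_implies_finite_norm f by (metis borel_measurable_has_bochner_integral measurable_lborel2)
  have fi: "\<And>b. b \<in> Basis \<Longrightarrow> integrable lborel (f b)" "\<And>b. b \<in> Basis \<Longrightarrow> integral\<^sup>L lborel (f b) = I b"
    using f by (auto simp: has_bochner_integral_iff)
  have *: "(\<Sum>c\<in>Basis. x c *\<^sub>R c) \<bullet> b = x b" if "b \<in> Basis" for x and b :: 'a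
    using that by (simp add: inner_sum_left inner_Basis if_distrib cong: if_cong)
  have "has_bochner_integral (\<Pi>\<^sub>M b\<in>Basis. lborel) (\<lambda>x. \<Prod>b\<in>Basis. f b (x b)) (\<Prod>b\<in>Basis. I b)"
    using P.product_integrable_prod[OF finite_Basis fi(1)] P.product_integral_prod[OF finite_Basis fi(1)]
    by (simp add: has_bochner_integral_iff fi(2))
  then have "has_bochner_integral (\<Pi>\<^sub>M b\<in>Basis. lborel) (\<lambda>x. \<Prod>b\<in>Basis. f b ((\<Sum>c\<in>Basis. x c *\<^sub>R c) \<bullet> b)) (\<Prod>b\<in>Basis. I b)"
    by (simp add: * cong: prod.cong)
  then show ?thesis
    unfolding lborel_def[where 'a='a] lborel_eq_real[symmetric]
    by (subst has_bochner_integral_iff) (simp add: integrable_distr_eq integral_distr has_bochner_integral_iff)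
qed

lemma norm_power2_eq_sum_Basis: "(norm (x::'a::euclidean_space))\<^sup>2 = (\<Sum>b\<in>Basis. (x \<bullet> b)\<^sup>2)"
  by (subst power2_norm_eq_inner, subst euclidean_inner) (simp add: power2_eq_square)

lemma cis_sum: "finite A \<Longrightarrow> cis (\<Sum>a\<in>A. f a) = (\<Prod>a\<in>A. cis (f a))"
  by (induction A rule: finite_induct) (simp_all add: cis_mult[symmetric])

lemma has_integral_gauss_cis:
  "has_bochner_integral lborel (\<lambda>x::'a::euclidean_space. complex_of_real (gauss x) * cis (- 2 * pi * (x \<bullet> \<xi>))) (of_real (gauss \<xi>))"
proof -
  have prodG: "complex_of_real (gauss x) = (\<Prod>b\<in>Basis. complex_of_real (exp (- pi * (x \<bullet> b)\<^sup>2)))" for x :: 'a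
    by (simp add: gauss_def norm_power2_eq_sum_Basis exp_sum sum_distrib_left flip: sum_negf of_real_prod)
  have prodC: "cis (- 2 * pi * (x \<bullet> \<xi>)) = (\<Prod>b\<in>Basis. cis (- 2 * pi * ((x \<bullet> b) * (\<xi> \<bullet> b))))" for x :: 'a
    by (simp add: euclidean_inner[of x \<xi>] sum_distrib_left flip: cis_sum)
  show ?thesis
    unfolding prodG prodC prod.distrib[symmetric]
    by (rule has_integral_lborel_prod[where f="\<lambda>b t. complex_of_real (exp (- pi * t\<^sup>2)) * cis (- 2 * pi * (t * (\<xi> \<bullet> b)))"])
       (rule has_integral_gauss_cis_real)
qed

lemma integrable_gauss: "integrable lborel (gauss :: 'a::euclidean_space \<Rightarrow> real)"
proof -
  have "integrable lborel (\<lambda>x::'a. complex_of_real (gauss x))"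
    using has_integral_gauss_cis[where \<xi>="0::'a"] by (auto simp: has_bochner_integral_iff)
  then show ?thesis by (simp add: complex_of_real_integrable_eq)
qed

lemma integral_gauss: "(\<integral>x. gauss (x::'a::euclidean_space) \<partial>lborel) = 1"
proof -
  have "(\<integral>x. complex_of_real (gauss (x::'a)) \<partial>lborel) = 1"
    using has_integral_gauss_cis[where \<xi>="0::'a"] by (auto simp: has_bochner_integral_iff gauss_def)
  then show ?thesis by (simp add: integral_complex_of_real)
qed

subsection \<open>Fourier transform of integrable functions\<close>

lemma integrable_cis_mult:
  assumes f: "integrable M f" and [measurable]: "g \<in> borel_measurable M"
  shows "integrable M (\<lambda>x. cis (g x) * f x)"
  by (rule Bochner_Integration.integrable_bound[OF integrable_norm[OF f]])
     (use f in \<open>auto simp: norm_mult cis_conv_exp\<close>)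

lemma cis_measurable [measurable (raw)]:
  "g \<in> borel_measurable M \<Longrightarrow> (\<lambda>x. cis (g x)) \<in> borel_measurable M"
  by (simp add: cis_conv_exp)

lemma fourier_measurable [measurable]:
  assumes [measurable]: "V \<in> borel_measurable borel"
  shows "fourier V \<in> borel_measurable borel"
  unfolding fourier_def[abs_def] by measurable

lemma norm_fourier_le:
  "norm (fourier V \<xi>) \<le> (\<integral>x. norm (V x) \<partial>lborel)"
proof -
  have "norm (fourier V \<xi>) \<le> (\<integral>x. norm (cis (- 2 * pi * (x \<bullet> \<xi>)) * V x) \<partial>lborel)"
    unfolding fourier_def by (rule integral_norm_bound)
  then show ?thesis by (simp add: norm_mult)
qed

lemma integrable_pair_mult:
  fixes f g :: "'a::euclidean_space \<Rightarrow> complex"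
  assumes f: "integrable lborel f" and g: "integrable lborel g"
  shows "integrable (lborel \<Otimes>\<^sub>M lborel) (\<lambda>(x, y). f x * g y)"
proof -
  have [measurable]: "f \<in> borel_measurable borel" "g \<in> borel_measurable borel" using f g by auto
  show ?thesis
    by (rule lborel_pair.Fubini_integrable) (use f g in \<open>auto simp: norm_mult\<close>)
qed

lemma integrable_pair_mult_bounded:
  fixes f g :: "'a::euclidean_space \<Rightarrow> complex"
  assumes f: "integrable lborel f" and g: "integrable lborel g"
    and [measurable]: "k \<in> borel_measurable (borel \<Otimes>\<^sub>M borel)" and k: "\<And>x y. norm (k (x, y)) = 1"
  shows "integrable (lborel \<Otimes>\<^sub>M lborel) (\<lambda>(x, y). f x * g y * k (x, y))"
proof -
  have [measurable]: "f \<in> borel_measurable borel" "g \<in> borel_measurable borel" using f g by auto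
  show ?thesis
    by (rule Bochner_Integration.integrable_bound[OF integrable_pair_mult[OF f g]])
       (auto simp: norm_mult k)
qed

lemma fourier_multiplication_formula:
  fixes h \<phi> :: "'a::euclidean_space \<Rightarrow> complex"
  assumes h: "integrable lborel h" and \<phi>: "integrable lborel \<phi>"
  shows "(\<integral>x. fourier h x * \<phi> x \<partial>lborel) = (\<integral>x. h x * fourier \<phi> x \<partial>lborel)"
proof -
  have "(\<integral>x. fourier h x * \<phi> x \<partial>lborel) = (\<integral>x. \<integral>y. h y * \<phi> x * cis (- 2 * pi * (y \<bullet> x)) \<partial>lborel \<partial>lborel)"
    unfolding fourier_def by (simp add: mult_ac flip: integral_mult_left_zero)
  also have "\<dots> = (\<integral>y. \<integral>x. h y * \<phi> x * cis (- 2 * pi * (y \<bullet> x)) \<partial>lborel \<partial>lborel)"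
    using integrable_pair_mult_bounded[OF h \<phi>, of "\<lambda>(y, x). cis (- 2 * pi * (y \<bullet> x))"]
    by (intro lborel_pair.Fubini_integral) simp
  also have "\<dots> = (\<integral>y. h y * fourier \<phi> y \<partial>lborel)"
    unfolding fourier_def by (simp add: mult_ac inner_commute flip: integral_mult_right_zero)
  finally show ?thesis .
qed

text \<open>Weighting the inversion integral by a wide Gaussian amounts to averaging
  \<open>V\<close> around \<open>x\<close> at scale \<open>e\<close>. In the multiplication formula
  the test function is a modulated Gaussian, whose transform is a Gaussian concentrated at
  \<open>x\<close>; the substitution \<open>y = x + e z\<close> normalises it.\<close>

lemma gauss_average:
  fixes V :: "'a::euclidean_space \<Rightarrow> complex"
  assumes V: "integrable lborel V" and e: "e > 0"
  shows "(\<integral>\<xi>. fourier V \<xi> * of_real (gauss (e *\<^sub>R \<xi>)) * cis (2 * pi * (x \<bullet> \<xi>)) \<partial>lborel)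
     = (\<integral>z. V (x + e *\<^sub>R z) * of_real (gauss z) \<partial>lborel)"
proof -
  have [measurable]: "V \<in> borel_measurable borel" using V by auto
  have gi: "integrable lborel (\<lambda>x::'a. complex_of_real (gauss x))"
    by (simp add: complex_of_real_integrable_eq integrable_gauss)
  define \<phi> where "\<phi> \<xi> = of_real (gauss (e *\<^sub>R \<xi>)) * cis (2 * pi * (x \<bullet> \<xi>))" for \<xi> :: 'a
  have [measurable]: "\<phi> \<in> borel_measurable borel" unfolding \<phi>_def by measurable
  have \<phi>i: "integrable lborel \<phi>"
    using integrable_cis_mult[OF integrable_lborel_affine[OF gi, of e 0], of "\<lambda>\<xi>. 2 * pi * (x \<bullet> \<xi>)"] e
    by (simp add: \<phi>_def[abs_def] mult.commute)
  have F\<phi>: "e ^ DIM('a) *\<^sub>R fourier \<phi> y = of_real (gauss ((1/e) *\<^sub>R (y - x)))" for y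
  proof -
    have "fourier \<phi> y = \<bar>1/e\<bar> ^ DIM('a) *\<^sub>R (\<integral>t. cis (- 2 * pi * ((0 + (1/e) *\<^sub>R t) \<bullet> y)) * \<phi> (0 + (1/e) *\<^sub>R t) \<partial>lborel)"
      unfolding fourier_def using e by (intro integral_lborel_affine) auto
    also have "(\<lambda>t. cis (- 2 * pi * ((0 + (1/e) *\<^sub>R t) \<bullet> y)) * \<phi> (0 + (1/e) *\<^sub>R t)) =
      (\<lambda>t. of_real (gauss t) * cis (- 2 * pi * (t \<bullet> ((1/e) *\<^sub>R (y - x)))))"
      using e by (auto simp: \<phi>_def fun_eq_iff cis_mult algebra_simps inner_diff_right inner_commute)
    also have "(\<integral>t. \<dots> t \<partial>lborel) = of_real (gauss ((1/e) *\<^sub>R (y - x)))"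
      using has_integral_gauss_cis[of "(1/e) *\<^sub>R (y - x)"] by (simp add: has_bochner_integral_iff)
    finally show ?thesis using e by (simp add: power_divide)
  qed
  have "(\<integral>\<xi>. fourier V \<xi> * of_real (gauss (e *\<^sub>R \<xi>)) * cis (2 * pi * (x \<bullet> \<xi>)) \<partial>lborel) = (\<integral>\<xi>. fourier V \<xi> * \<phi> \<xi> \<partial>lborel)"
    by (simp add: \<phi>_def mult.assoc)
  also have "\<dots> = (\<integral>y. V y * fourier \<phi> y \<partial>lborel)"
    by (rule fourier_multiplication_formula[OF V \<phi>i])
  also have "\<dots> = \<bar>e\<bar> ^ DIM('a) *\<^sub>R (\<integral>z. V (x + e *\<^sub>R z) * fourier \<phi> (x + e *\<^sub>R z) \<partial>lborel)"
    using e by (intro integral_lborel_affine) auto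
  also have "\<dots> = (\<integral>z. V (x + e *\<^sub>R z) * (e ^ DIM('a) *\<^sub>R fourier \<phi> (x + e *\<^sub>R z)) \<partial>lborel)"
    using e by (simp flip: integral_scaleR_right)
  also have "\<dots> = (\<integral>z. V (x + e *\<^sub>R z) * of_real (gauss z) \<partial>lborel)"
    unfolding F\<phi> using e by simp
  finally show ?thesis .
qed

subsection \<open>Fourier inversion by Gaussian averaging\<close>

text \<open>The weights \<open>gauss (\<epsilon> n *\<^sub>R \<xi>)\<close> increase to 1, so
  monotone convergence handles the frequency side although \<open>F\<close> is not assumed
  integrable. On the other side stand Gaussian averages \<open>J n\<close> of \<open>D\<close>
  around 0: they never exceed \<open>B\<close>, and they converge to \<open>D 0\<close> when
  \<open>D\<close> is continuous there.\<close>

lemma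
  fixes D :: "'a::euclidean_space \<Rightarrow> complex" and F :: "'a \<Rightarrow> real"
  assumes D: "integrable lborel D"
    and F: "\<And>\<xi>. fourier D \<xi> = of_real (F \<xi>)" and F0: "\<And>\<xi>. 0 \<le> F \<xi>"
    and B: "\<And>x. norm (D x) \<le> B"
  shows nn_integral_nonneg_fourier_le: "(\<integral>\<^sup>+\<xi>. F \<xi> \<partial>lborel) \<le> ennreal B"
    and nn_integral_nonneg_fourier_eq: "isCont D 0 \<Longrightarrow> (\<integral>\<^sup>+\<xi>. F \<xi> \<partial>lborel) = ennreal (Re (D 0))"
proof -
  have [measurable]: "D \<in> borel_measurable borel" using D by auto
  have Feq: "F = (\<lambda>\<xi>. Re (fourier D \<xi>))" using F by auto
  have [measurable]: "F \<in> borel_measurable borel" unfolding Feq by measurable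
  define \<epsilon> where "\<epsilon> n = 1 / real (Suc n)" for n
  have \<epsilon>: "\<epsilon> n > 0" for n by (simp add: \<epsilon>_def)
  have \<epsilon>lim: "\<epsilon> \<longlonglongrightarrow> 0" unfolding \<epsilon>_def by (rule lim_1_over_n[THEN filterlim_sequentially_Suc[THEN iffD2]])
  have gi: "integrable lborel (\<lambda>\<xi>::'a. gauss (\<epsilon> n *\<^sub>R \<xi>))" for n
    using integrable_lborel_affine[OF integrable_gauss, of "\<epsilon> n" 0] \<epsilon>[of n] by simp
  have Fb: "F \<xi> \<le> (\<integral>x. norm (D x) \<partial>lborel)" for \<xi>
    using norm_fourier_le[of D \<xi>] F0[of \<xi>] by (simp add: F)
  have Fi: "integrable lborel (\<lambda>\<xi>. F \<xi> * gauss (\<epsilon> n *\<^sub>R \<xi>))" for n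
    by (rule Bochner_Integration.integrable_bound[OF integrable_mult_right[OF gi, of "\<integral>x. norm (D x) \<partial>lborel" n]])
       (auto intro!: mult_mono Fb simp: abs_mult F0)
  define J where "J n = (\<integral>z. D (\<epsilon> n *\<^sub>R z) * of_real (gauss z) \<partial>lborel)" for n
  have J: "of_real (\<integral>\<xi>. F \<xi> * gauss (\<epsilon> n *\<^sub>R \<xi>) \<partial>lborel) = J n" for n
    using gauss_average[OF D \<epsilon>[of n], of 0] unfolding J_def F
    by (simp flip: integral_complex_of_real)
  have gauss_incr: "gauss (\<epsilon> m *\<^sub>R \<xi>) \<le> gauss (\<epsilon> n *\<^sub>R \<xi>)" if "m \<le> n" for m n and \<xi> :: 'a
    using that unfolding gauss_def
    by (auto simp: \<epsilon>_def power_mult_distrib field_simps intro!: mult_left_mono power_mono)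
  have gauss_lim: "(\<lambda>n. gauss (\<epsilon> n *\<^sub>R \<xi>)) \<longlonglongrightarrow> 1" for \<xi> :: 'a
  proof -
    have "(\<lambda>n. gauss (\<epsilon> n *\<^sub>R \<xi>)) \<longlonglongrightarrow> exp (- pi * (norm (0 *\<^sub>R \<xi>))\<^sup>2)"
      unfolding gauss_def by (intro tendsto_intros \<epsilon>lim)
    then show ?thesis by simp
  qed
  have lim: "(\<lambda>n. \<integral>\<^sup>+\<xi>. ennreal (F \<xi> * gauss (\<epsilon> n *\<^sub>R \<xi>)) \<partial>lborel) \<longlonglongrightarrow> (\<integral>\<^sup>+\<xi>. F \<xi> \<partial>lborel)"
  proof (rule nn_integral_LIMSEQ)
    show "incseq (\<lambda>n \<xi>. ennreal (F \<xi> * gauss (\<epsilon> n *\<^sub>R \<xi>)))"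
      by (auto simp: incseq_def le_fun_def intro!: ennreal_leI mult_left_mono gauss_incr F0)
    show "(\<lambda>n. ennreal (F \<xi> * gauss (\<epsilon> n *\<^sub>R \<xi>))) \<longlonglongrightarrow> ennreal (F \<xi>)" for \<xi>
      using tendsto_mult[OF tendsto_const gauss_lim, of "F \<xi>" \<xi>] by (intro tendsto_ennrealI) simp
  qed auto
  have eq: "(\<integral>\<^sup>+\<xi>. ennreal (F \<xi> * gauss (\<epsilon> n *\<^sub>R \<xi>)) \<partial>lborel) = ennreal (Re (J n))" for n
    by (subst nn_integral_eq_integral[OF Fi]) (auto simp: F0 simp flip: J)
  have gic: "integrable lborel (\<lambda>z::'a. B * gauss z)"
    by (intro integrable_mult_right integrable_gauss)
  have JB: "norm (J n) \<le> B" for n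
  proof -
    have "norm (J n) \<le> (\<integral>z. norm (D (\<epsilon> n *\<^sub>R z) * of_real (gauss z)) \<partial>lborel)"
      unfolding J_def by (rule integral_norm_bound)
    also have "\<dots> \<le> (\<integral>z. B * gauss (z::'a) \<partial>lborel)"
    proof (rule integral_mono)
      show "integrable lborel (\<lambda>z. norm (D (\<epsilon> n *\<^sub>R z) * of_real (gauss z)))"
        by (rule Bochner_Integration.integrable_bound[OF gic])
           (auto simp: norm_mult abs_mult intro!: AE_I2 mult_right_mono order_trans[OF B abs_ge_self])
    qed (auto simp: norm_mult integrable_gauss intro!: mult_right_mono B)
    also have "\<dots> = B" by (simp add: integral_gauss)
    finally show ?thesis .
  qed
  show "(\<integral>\<^sup>+\<xi>. F \<xi> \<partial>lborel) \<le> ennreal B"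
    using lim unfolding eq
    by (rule LIMSEQ_le_const2)
       (auto intro!: exI[of _ 0] ennreal_leI order_trans[OF complex_Re_le_cmod JB])
  assume cont: "isCont D 0"
  have "J \<longlonglongrightarrow> (\<integral>z. D 0 * of_real (gauss (z::'a)) \<partial>lborel)"
    unfolding J_def
  proof (rule integral_dominated_convergence[where w="\<lambda>z. B * gauss z"])
    show "AE z in lborel. (\<lambda>n. D (\<epsilon> n *\<^sub>R z) * complex_of_real (gauss z)) \<longlonglongrightarrow> D 0 * complex_of_real (gauss z)"
    proof (rule AE_I2)
      fix z :: 'a
      have "(\<lambda>n. \<epsilon> n *\<^sub>R z) \<longlonglongrightarrow> 0 *\<^sub>R z" by (intro tendsto_intros \<epsilon>lim)
      then have "(\<lambda>n. D (\<epsilon> n *\<^sub>R z)) \<longlonglongrightarrow> D 0"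
        using isCont_tendsto_compose[OF cont] by simp
      then show "(\<lambda>n. D (\<epsilon> n *\<^sub>R z) * complex_of_real (gauss z)) \<longlonglongrightarrow> D 0 * complex_of_real (gauss z)"
        by (intro tendsto_intros)
    qed
  qed (auto simp: norm_mult integrable_gauss intro!: AE_I2 mult_right_mono B)
  also have "(\<integral>z. D 0 * complex_of_real (gauss (z::'a)) \<partial>lborel) = D 0"
    by (simp add: integral_complex_of_real integral_gauss)
  finally have "(\<lambda>n. ennreal (Re (J n))) \<longlonglongrightarrow> ennreal (Re (D 0))"
    by (intro tendsto_intros)
  with lim show "(\<integral>\<^sup>+\<xi>. F \<xi> \<partial>lborel) = ennreal (Re (D 0))"
    unfolding eq by (rule LIMSEQ_unique)
qed

text \<open>All Gaussian averages of \<open>V\<close> vanish, so \<open>- V x\<close> is the average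
  of \<open>V (x + \<epsilon> z) - V x\<close> over z. Integrating the norm over x and exchanging
  the integrals bounds the L^1 norm of \<open>V\<close> by an average of the L^1 modulus of
  continuity \<open>\<omega>\<close> at scale \<open>\<epsilon>\<close>, which tends to 0.\<close>

lemma fourier_eq_0_imp_AE_0:
  fixes V :: "'a::euclidean_space \<Rightarrow> complex"
  assumes V: "integrable lborel V" and zero: "\<And>\<xi>. fourier V \<xi> = 0"
  shows "AE x in lborel. V x = 0"
proof -
  have [measurable]: "V \<in> borel_measurable borel" using V by auto
  define \<omega> where "\<omega> y = (\<integral>x. norm (V (x + y) - V x) \<partial>lborel)" for y
  have tr: "integrable lborel (\<lambda>x. V (x + y))" for y
    using integrable_shift_reflect(1)[OF V, of y] by (simp add: add.commute)
  have cont: "isCont \<omega> 0"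
    using mean_translation_continuous[OF V] by (simp add: isCont_def \<omega>_def[abs_def])
  have \<omega>b: "\<omega> y \<le> 2 * (\<integral>x. norm (V x) \<partial>lborel)" for y
  proof -
    have "\<omega> y \<le> (\<integral>x. norm (V (x + y)) + norm (V x) \<partial>lborel)"
      unfolding \<omega>_def using tr V
      by (intro integral_mono integrable_norm Bochner_Integration.integrable_add Bochner_Integration.integrable_diff)
         (auto intro: norm_triangle_ineq4)
    also have "\<dots> = (\<integral>x. norm (V (x + y)) \<partial>lborel) + (\<integral>x. norm (V x) \<partial>lborel)"
      using tr V by (intro Bochner_Integration.integral_add integrable_norm)
    also have "(\<integral>x. norm (V (x + y)) \<partial>lborel) = (\<integral>x. norm (V x) \<partial>lborel)"
      using integral_shift_reflect(1)[of "\<lambda>x. norm (V x)" y] by (simp add: add.commute)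
    finally show ?thesis by simp
  qed
  have \<omega>0: "0 \<le> \<omega> y" for y by (simp add: \<omega>_def)
  have [measurable]: "\<omega> \<in> borel_measurable borel" unfolding \<omega>_def[abs_def] by measurable
  define \<epsilon> where "\<epsilon> n = 1 / real (Suc n)" for n
  have \<epsilon>: "\<epsilon> n > 0" for n by (simp add: \<epsilon>_def)
  have \<epsilon>lim: "\<epsilon> \<longlonglongrightarrow> 0" unfolding \<epsilon>_def by (rule lim_1_over_n[THEN filterlim_sequentially_Suc[THEN iffD2]])
  have avg: "(\<integral>z. V (x + \<epsilon> n *\<^sub>R z) * of_real (gauss z) \<partial>lborel) = 0" for x n
    using gauss_average[OF V \<epsilon>[of n], of x] by (simp add: zero)
  define b where "b = 2 * (\<integral>x. norm (V x) \<partial>lborel)"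
  have gic: "integrable lborel (\<lambda>z::'a. b * gauss z)"
    by (intro integrable_mult_right integrable_gauss)
  have \<omega>gi: "integrable lborel (\<lambda>z. \<omega> (\<epsilon> n *\<^sub>R z) * gauss z)" for n
    by (rule Bochner_Integration.integrable_bound[OF gic])
       (auto intro!: AE_I2 mult_mono \<omega>b simp: abs_mult b_def \<omega>0)
  have gi: "integrable lborel (\<lambda>z::'a. complex_of_real (gauss z))"
    by (simp add: complex_of_real_integrable_eq integrable_gauss)
  have main: "(\<integral>\<^sup>+x. norm (V x) \<partial>lborel) \<le> ennreal (\<integral>z. \<omega> (\<epsilon> n *\<^sub>R z) * gauss z \<partial>lborel)" for n
  proof -
    have "(\<integral>\<^sup>+x. norm (V x) \<partial>lborel) \<le> (\<integral>\<^sup>+x. \<integral>\<^sup>+z. ennreal (norm (V (x + \<epsilon> n *\<^sub>R z) - V x) * gauss z) \<partial>lborel \<partial>lborel)"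
    proof (rule nn_integral_mono)
      fix x
      show "ennreal (norm (V x)) \<le> (\<integral>\<^sup>+z. ennreal (norm (V (x + \<epsilon> n *\<^sub>R z) - V x) * gauss z) \<partial>lborel)"
      proof (cases "integrable lborel (\<lambda>z. V (x + \<epsilon> n *\<^sub>R z) * of_real (gauss z))")
        case True
        have i: "integrable lborel (\<lambda>z. (V (x + \<epsilon> n *\<^sub>R z) - V x) * of_real (gauss z))"
          using Bochner_Integration.integrable_diff[OF True integrable_mult_right[OF gi, of "V x"]] by (simp add: left_diff_distrib)
        have "(\<integral>z. (V (x + \<epsilon> n *\<^sub>R z) - V x) * of_real (gauss z) \<partial>lborel) = - V x"
          using Bochner_Integration.integral_diff[OF True integrable_mult_right[OF gi, of "V x"]]
          by (simp add: left_diff_distrib avg integral_complex_of_real integral_gauss)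
        then have "norm (V x) = norm (\<integral>z. (V (x + \<epsilon> n *\<^sub>R z) - V x) * of_real (gauss z) \<partial>lborel)" by simp
        also have "ennreal \<dots> \<le> (\<integral>\<^sup>+z. norm ((V (x + \<epsilon> n *\<^sub>R z) - V x) * of_real (gauss z)) \<partial>lborel)"
          by (rule integral_norm_bound_ennreal[OF i])
        finally show ?thesis by (simp add: norm_mult)
      next
        case False
        have "\<not> integrable lborel (\<lambda>z. (V (x + \<epsilon> n *\<^sub>R z) - V x) * of_real (gauss z))"
        proof
          assume "integrable lborel (\<lambda>z. (V (x + \<epsilon> n *\<^sub>R z) - V x) * of_real (gauss z))"
          from Bochner_Integration.integrable_add[OF this integrable_mult_right[OF gi, of "V x"]] False
          show False by (simp add: algebra_simps)
        qed
        then have "(\<integral>\<^sup>+z. ennreal (norm (V (x + \<epsilon> n *\<^sub>R z) - V x) * gauss z) \<partial>lborel) = \<infinity>"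
          by (simp add: integrable_iff_bounded norm_mult) (simp only: less_top[symmetric] not_not)
        then show ?thesis by simp
      qed
    qed
    also have "\<dots> = (\<integral>\<^sup>+z. \<integral>\<^sup>+x. ennreal (norm (V (x + \<epsilon> n *\<^sub>R z) - V x) * gauss z) \<partial>lborel \<partial>lborel)"
      by (rule lborel_pair.Fubini') simp
    also have "\<dots> = (\<integral>\<^sup>+z. ennreal (\<omega> (\<epsilon> n *\<^sub>R z) * gauss z) \<partial>lborel)"
    proof (rule nn_integral_cong)
      fix z
      have "(\<integral>\<^sup>+x. ennreal (norm (V (x + \<epsilon> n *\<^sub>R z) - V x) * gauss z) \<partial>lborel)
        = (\<integral>\<^sup>+x. ennreal (norm (V (x + \<epsilon> n *\<^sub>R z) - V x)) \<partial>lborel) * ennreal (gauss z)"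
        by (subst nn_integral_multc[symmetric]) (auto simp: ennreal_mult)
      also have "(\<integral>\<^sup>+x. ennreal (norm (V (x + \<epsilon> n *\<^sub>R z) - V x)) \<partial>lborel) = ennreal (\<omega> (\<epsilon> n *\<^sub>R z))"
        unfolding \<omega>_def by (rule nn_integral_eq_integral) (auto intro!: Bochner_Integration.integrable_diff tr V)
      finally show "(\<integral>\<^sup>+x. ennreal (norm (V (x + \<epsilon> n *\<^sub>R z) - V x) * gauss z) \<partial>lborel) = ennreal (\<omega> (\<epsilon> n *\<^sub>R z) * gauss z)"
        by (simp add: ennreal_mult \<omega>0)
    qed
    also have "\<dots> = ennreal (\<integral>z. \<omega> (\<epsilon> n *\<^sub>R z) * gauss z \<partial>lborel)"
      by (rule nn_integral_eq_integral[OF \<omega>gi]) (simp add: \<omega>0)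
    finally show ?thesis .
  qed
  have "(\<lambda>n. \<integral>z. \<omega> (\<epsilon> n *\<^sub>R z) * gauss z \<partial>lborel) \<longlonglongrightarrow> (\<integral>z. 0 \<partial>(lborel::'a measure))"
  proof (rule integral_dominated_convergence[OF _ _ gic])
    show "AE z in lborel. (\<lambda>n. \<omega> (\<epsilon> n *\<^sub>R z) * gauss z) \<longlonglongrightarrow> 0"
    proof (rule AE_I2)
      fix z :: 'a
      have "(\<lambda>n. \<epsilon> n *\<^sub>R z) \<longlonglongrightarrow> 0 *\<^sub>R z" by (intro tendsto_intros \<epsilon>lim)
      then have "(\<lambda>n. \<omega> (\<epsilon> n *\<^sub>R z)) \<longlonglongrightarrow> \<omega> 0"
        using isCont_tendsto_compose[OF cont] by simp
      then have "(\<lambda>n. \<omega> (\<epsilon> n *\<^sub>R z) * gauss z) \<longlonglongrightarrow> \<omega> 0 * gauss z"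
        by (intro tendsto_intros)
      then show "(\<lambda>n. \<omega> (\<epsilon> n *\<^sub>R z) * gauss z) \<longlonglongrightarrow> 0" by (simp add: \<omega>_def)
    qed
  qed (auto intro!: AE_I2 mult_mono \<omega>b simp: abs_mult b_def \<omega>0)
  then have "(\<lambda>n. ennreal (\<integral>z. \<omega> (\<epsilon> n *\<^sub>R z) * gauss z \<partial>lborel)) \<longlonglongrightarrow> ennreal 0"
    by (intro tendsto_ennrealI) simp
  then have "(\<integral>\<^sup>+x. norm (V x) \<partial>lborel) \<le> ennreal 0"
    by (rule LIMSEQ_le_const) (use main in auto)
  then have "(\<integral>\<^sup>+x. norm (V x) \<partial>lborel) = 0" by simp
  then show ?thesis by (subst (asm) nn_integral_0_iff_AE) auto
qed

subsection \<open>Schwartz functions\<close>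

text \<open>Complex polynomial functions, generated by constants and linear forms. They are needed
  because each iterated derivative of a Gaussian wave is such a polynomial times the same
  wave.\<close>

inductive_set cpoly :: "('a::euclidean_space \<Rightarrow> complex) set" where
  const: "(\<lambda>x. c) \<in> cpoly"
| coord: "(\<lambda>x. complex_of_real (x \<bullet> v)) \<in> cpoly"
| add: "P \<in> cpoly \<Longrightarrow> Q \<in> cpoly \<Longrightarrow> (\<lambda>x. P x + Q x) \<in> cpoly"
| mult: "P \<in> cpoly \<Longrightarrow> Q \<in> cpoly \<Longrightarrow> (\<lambda>x. P x * Q x) \<in> cpoly"

lemma cpoly_has_derivative:
  assumes "P \<in> cpoly"
  shows "\<exists>P'. (\<forall>x. (P has_derivative P' x) (at x)) \<and> (\<forall>v. (\<lambda>x. P' x v) \<in> cpoly)"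
  using assms
proof induction
  case (const c)
  show ?case
    by (rule exI[of _ "\<lambda>_ _. 0"]) (auto intro: cpoly.const)
next
  case (coord w)
  show ?case
    by (rule exI[of _ "\<lambda>_ v. complex_of_real (v \<bullet> w)"])
       (auto intro!: cpoly.const derivative_eq_intros)
next
  case (add P Q)
  then obtain P' Q' where "\<And>x. (P has_derivative P' x) (at x)" "\<And>v. (\<lambda>x. P' x v) \<in> cpoly"
    "\<And>x. (Q has_derivative Q' x) (at x)" "\<And>v. (\<lambda>x. Q' x v) \<in> cpoly" by auto
  then show ?case
    by (intro exI[of _ "\<lambda>x v. P' x v + Q' x v"]) (auto intro: cpoly.add has_derivative_add)
next
  case (mult P Q)
  then obtain P' Q' where "\<And>x. (P has_derivative P' x) (at x)" "\<And>v. (\<lambda>x. P' x v) \<in> cpoly"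
    "\<And>x. (Q has_derivative Q' x) (at x)" "\<And>v. (\<lambda>x. Q' x v) \<in> cpoly" by auto
  with mult.hyps show ?case
    by (intro exI[of _ "\<lambda>x v. P x * Q' x v + P' x v * Q x"]) (auto intro!: cpoly.add cpoly.mult has_derivative_mult)
qed

lemma cpoly_bound:
  assumes "P \<in> cpoly"
  shows "\<exists>C N. 0 \<le> C \<and> (\<forall>x. norm (P x) \<le> C * (1 + norm x) ^ N)"
  using assms
proof induction
  case (const c)
  show ?case by (rule exI[of _ "norm c"], rule exI[of _ 0]) auto
next
  case (coord v)
  have "\<bar>x \<bullet> v\<bar> \<le> norm v * (1 + norm x) ^ 1" for x :: 'a
    using Cauchy_Schwarz_ineq2[of x v] norm_ge_zero[of v] by (simp add: algebra_simps add_increasing)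
  then show ?case by (intro exI[of _ "norm v"] exI[of _ 1]) auto
next
  case (add P Q)
  then obtain C N D M where C: "0 \<le> C" "\<And>x. norm (P x) \<le> C * (1 + norm x) ^ N"
    and D: "0 \<le> D" "\<And>x. norm (Q x) \<le> D * (1 + norm x) ^ M" by metis
  have "norm (P x + Q x) \<le> (C + D) * (1 + norm x) ^ (N + M)" for x
  proof -
    have "C * (1 + norm x) ^ N \<le> C * (1 + norm x) ^ (N + M)" "D * (1 + norm x) ^ M \<le> D * (1 + norm x) ^ (N + M)"
      using C D by (auto intro!: mult_left_mono power_increasing)
    then show ?thesis
      using norm_triangle_ineq[of "P x" "Q x"] C(2)[of x] D(2)[of x] by (simp add: algebra_simps)
  qed
  then show ?case using C D by (intro exI[of _ "C + D"] exI[of _ "N + M"]) auto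
next
  case (mult P Q)
  then obtain C N D M where C: "0 \<le> C" "\<And>x. norm (P x) \<le> C * (1 + norm x) ^ N"
    and D: "0 \<le> D" "\<And>x. norm (Q x) \<le> D * (1 + norm x) ^ M" by metis
  have "norm (P x * Q x) \<le> (C * D) * (1 + norm x) ^ (N + M)" for x
    using mult_mono[OF C(2)[of x] D(2)[of x]] C D by (simp add: norm_mult power_add mult_ac)
  then show ?case using C D by (intro exI[of _ "C * D"] exI[of _ "N + M"]) auto
qed

text \<open>Two linear terms occur because the family has to contain both the modulated Gaussians
  (\<open>b = 0\<close>) and, up to constants, their Fourier transforms: these are shifted
  Gaussians, and expanding the square leaves a real exponential (\<open>a = 0\<close>).\<close>

definition gwave :: "'a::euclidean_space \<Rightarrow> 'a \<Rightarrow> 'a \<Rightarrow> complex" where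
  "gwave a b x = of_real (exp (- pi * (norm x)\<^sup>2 + b \<bullet> x)) * cis (a \<bullet> x)"

lemma gwave_alt: "gwave a b x = exp (- of_real pi * of_real (x \<bullet> x) + of_real (b \<bullet> x) + \<i> * of_real (a \<bullet> x))"
  unfolding gwave_def cis_conv_exp power2_norm_eq_inner exp_of_real[symmetric] exp_add[symmetric] by simp

lemma gwave_has_derivative:
  "(gwave a b has_derivative (\<lambda>v. (of_real (- 2 * pi) * of_real (x \<bullet> v) + (of_real (b \<bullet> v) + \<i> * of_real (a \<bullet> v))) * gwave a b x)) (at x)"
proof -
  have 1: "((\<lambda>x. - complex_of_real pi * of_real (x \<bullet> x) + of_real (b \<bullet> x) + \<i> * of_real (a \<bullet> x)) has_derivative
    (\<lambda>v. of_real (- 2 * pi) * of_real (x \<bullet> v) + (of_real (b \<bullet> v) + \<i> * of_real (a \<bullet> v)))) (at x)"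
    by (auto intro!: derivative_eq_intros simp: fun_eq_iff inner_commute algebra_simps)
  have "(exp has_derivative (*) (gwave a b x)) (at (- complex_of_real pi * of_real (x \<bullet> x) + of_real (b \<bullet> x) + \<i> * of_real (a \<bullet> x)))"
    using DERIV_exp[of "- complex_of_real pi * of_real (x \<bullet> x) + of_real (b \<bullet> x) + \<i> * of_real (a \<bullet> x)"]
    by (simp add: has_field_derivative_def gwave_alt)
  from has_derivative_compose[OF 1 this] show ?thesis
    by (simp add: gwave_alt[abs_def] mult.commute)
qed

lemma iter_partial_cpoly_gwave:
  assumes "P \<in> cpoly"
  shows "\<exists>Q\<in>cpoly. iter_partial bs (\<lambda>x. P x * gwave a b x) = (\<lambda>x. Q x * gwave a b x)"
proof (induction bs)
  case Nil
  then show ?case using assms by auto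
next
  case (Cons v bs)
  then obtain Q where Q: "Q \<in> cpoly" "iter_partial bs (\<lambda>x. P x * gwave a b x) = (\<lambda>x. Q x * gwave a b x)" by auto
  obtain Q' where Q': "\<And>x. (Q has_derivative Q' x) (at x)" "\<And>v. (\<lambda>x. Q' x v) \<in> cpoly"
    using cpoly_has_derivative[OF Q(1)] by auto
  define R where "R x = Q x * (of_real (- 2 * pi) * of_real (x \<bullet> v) + (of_real (b \<bullet> v) + \<i> * of_real (a \<bullet> v))) + Q' x v" for x
  have "R \<in> cpoly" unfolding R_def[abs_def]
    by (intro cpoly.intros Q Q')
  moreover have "frechet_derivative (\<lambda>x. Q x * gwave a b x) (at x) v = R x * gwave a b x" for x
    by (subst frechet_derivative_at[OF has_derivative_mult[OF Q'(1) gwave_has_derivative], symmetric])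
       (simp add: R_def algebra_simps)
  ultimately show ?case using Q by auto
qed

lemma power_le_exp: "t ^ n \<le> real n ^ n * exp (t::real)" if "0 \<le> t"
proof (cases "n = 0")
  case False
  have "(t / real n) ^ n \<le> exp (t / real n) ^ n"
    using that exp_ge_add_one_self[of "t / real n"] by (intro power_mono) (linarith, simp)
  also have "\<dots> = exp t" using False by (simp add: exp_of_nat_mult[symmetric])
  finally show ?thesis using False by (simp add: field_simps)
qed (use that in auto)

lemma norm_power_gwave_bounded:
  assumes "P \<in> cpoly"
  shows "bounded (range (\<lambda>x. norm x ^ k *\<^sub>R (P x * gwave a b x)))"
proof -
  obtain C N where C: "0 \<le> C" "\<And>x. norm (P x) \<le> C * (1 + norm x) ^ N"
    using cpoly_bound[OF assms] by auto
  define M where "M = k + N"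
  \<comment> \<open>\<open>power_le_exp\<close> replaces the polynomial factor by
    \<open>M ^ M * exp (1 + norm x)\<close>. What is left is the maximum
    \<open>(1 + norm b)^2 / (4 * pi)\<close> of \<open>(1 + norm b) * s - pi * s^2\<close>, found by
    completing the square.\<close>
  define B where "B = C * (real M ^ M * exp (1 + (1 + norm b)\<^sup>2 / (4 * pi)))"
  have "norm (norm x ^ k *\<^sub>R (P x * gwave a b x)) \<le> B" for x
  proof -
    have "norm (norm x ^ k *\<^sub>R (P x * gwave a b x)) = norm x ^ k * (norm (P x) * exp (- pi * (norm x)\<^sup>2 + b \<bullet> x))"
      by (simp add: norm_mult gwave_def)
    also have "\<dots> \<le> (1 + norm x) ^ k * ((C * (1 + norm x) ^ N) * exp (- pi * (norm x)\<^sup>2 + norm b * norm x))"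
      using C norm_cauchy_schwarz[of b x] by (intro mult_mono power_mono) auto
    also have "\<dots> = C * ((1 + norm x) ^ M * exp (- pi * (norm x)\<^sup>2 + norm b * norm x))"
      by (simp add: M_def power_add mult_ac)
    also have "\<dots> \<le> C * ((real M ^ M * exp (1 + norm x)) * exp (- pi * (norm x)\<^sup>2 + norm b * norm x))"
      using C by (intro mult_left_mono mult_right_mono power_le_exp) auto
    also have "\<dots> = C * (real M ^ M * exp (1 + norm x + (- pi * (norm x)\<^sup>2 + norm b * norm x)))"
      by (simp only: exp_add mult.assoc)
    also have "\<dots> \<le> B"
    proof -
      have "0 \<le> (2 * pi * norm x - (1 + norm b))\<^sup>2" by simp
      then have "4 * pi * ((1 + norm b) * norm x - pi * (norm x)\<^sup>2) \<le> (1 + norm b)\<^sup>2"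
        by (simp add: power2_eq_square algebra_simps)
      then have "(1 + norm b) * norm x - pi * (norm x)\<^sup>2 \<le> (1 + norm b)\<^sup>2 / (4 * pi)"
        by (simp add: pos_le_divide_eq mult_ac)
      then have "1 + norm x + (- pi * (norm x)\<^sup>2 + norm b * norm x) \<le> 1 + (1 + norm b)\<^sup>2 / (4 * pi)"
        by (simp add: algebra_simps)
      then show ?thesis unfolding B_def using C by (intro mult_left_mono) auto
    qed
    finally show ?thesis .
  qed
  then show ?thesis unfolding bounded_iff by auto
qed

lemma gwave_scaled_schwartz: "(\<lambda>x. c * gwave a b x) \<in> schwartz"
proof -
  have *: "\<exists>Q\<in>cpoly. iter_partial bs (\<lambda>x. c * gwave a b x) = (\<lambda>x. Q x * gwave a b x)" for bs
    using iter_partial_cpoly_gwave[OF cpoly.const[of c], of bs a b] by simp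
  show ?thesis
    unfolding schwartz_def smooth_def
  proof (intro CollectI conjI allI impI)
    fix bs :: "'a list" and x
    obtain Q where Q: "Q \<in> cpoly" "iter_partial bs (\<lambda>x. c * gwave a b x) = (\<lambda>x. Q x * gwave a b x)" using * by auto
    obtain Q' where Q': "\<And>x. (Q has_derivative Q' x) (at x)"
      using cpoly_has_derivative[OF Q(1)] by auto
    show "iter_partial bs (\<lambda>x. c * gwave a b x) differentiable at x"
      unfolding Q(2) using has_derivative_mult[OF Q' gwave_has_derivative] by (rule differentiableI)
  next
    fix k and bs :: "'a list"
    show "bounded (range (\<lambda>x. norm x ^ k *\<^sub>R iter_partial bs (\<lambda>x. c * gwave a b x) x))"
      using *[of bs] norm_power_gwave_bounded by metis
  qed
qed

section \<open>Continuity, decay and integrability of Schwartz functions\<close>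

lemma schwartz_continuous:
  assumes "\<phi> \<in> schwartz" shows "continuous_on UNIV \<phi>"
proof -
  have "iter_partial [] \<phi> differentiable at x" for x
    using assms unfolding schwartz_def smooth_def by (metis (mono_tags, lifting) empty_set empty_subsetI mem_Collect_eq)
  then show ?thesis
    by (auto intro!: continuous_at_imp_continuous_on differentiable_imp_continuous_within)
qed

lemma schwartz_decay:
  assumes "\<phi> \<in> schwartz"
  obtains C where "\<And>x. norm x ^ k * norm (\<phi> x) \<le> C"
proof -
  have "bounded (range (\<lambda>x. norm x ^ k *\<^sub>R iter_partial [] \<phi> x))"
    using assms by (auto simp only: schwartz_def mem_Collect_eq list.set(1) empty_subsetI)
  then show thesis using that unfolding bounded_iff by auto
qed

lemma integrable_inverse_prod:
  "integrable lborel (\<lambda>x::'a::euclidean_space. \<Prod>b\<in>Basis. inverse (1 + (x \<bullet> b)\<^sup>2))"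
proof -
  have "integrable lborel (\<lambda>t::real. inverse (1 + t\<^sup>2))"
    using integrable_inverse_1_plus_square by (simp add: set_integrable_def)
  then have "has_bochner_integral lborel (\<lambda>t::real. complex_of_real (inverse (1 + t\<^sup>2))) (\<integral>t. complex_of_real (inverse (1 + t\<^sup>2)) \<partial>lborel)"
    by (simp only: has_bochner_integral_iff complex_of_real_integrable_eq simp_thms)
  then have "has_bochner_integral lborel (\<lambda>x::'a. \<Prod>b\<in>Basis. complex_of_real (inverse (1 + (x \<bullet> b)\<^sup>2)))
     (\<Prod>b\<in>(Basis::'a set). \<integral>t. complex_of_real (inverse (1 + t\<^sup>2)) \<partial>lborel)"
    by (intro has_integral_lborel_prod)
  then have "integrable lborel (\<lambda>x::'a. complex_of_real (\<Prod>b\<in>Basis. inverse (1 + (x \<bullet> b)\<^sup>2)))"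
    by (simp add: has_bochner_integral_iff)
  then show ?thesis by (simp only: complex_of_real_integrable_eq)
qed

lemma schwartz_bounded:
  assumes "\<phi> \<in> schwartz"
  obtains C where "\<And>x. norm (\<phi> x) \<le> C"
  using schwartz_decay[OF assms, of 0] by auto

text \<open>The comparison function \<open>1 / (1 + (x \<bullet> b)^2)\<close>, multiplied over the
  basis, is integrable one coordinate at a time. Its reciprocal is at most
  \<open>(1 + |x|^2)^d \<le> 2^d * (1 + |x|^(2 d))\<close>, so the decay bounds of orders 0 and 2d
  suffice.\<close>

lemma schwartz_integrable:
  assumes \<phi>: "\<phi> \<in> schwartz"
  shows "integrable lborel \<phi>"
proof -
  let ?d = "DIM('a)"
  obtain C0 where C0: "\<And>x. norm x ^ 0 * norm (\<phi> x) \<le> C0" using schwartz_decay[OF \<phi>] by blast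
  obtain C1 where C1: "\<And>x. norm x ^ (2 * ?d) * norm (\<phi> x) \<le> C1" using schwartz_decay[OF \<phi>] by blast
  have [measurable]: "\<phi> \<in> borel_measurable borel"
    using schwartz_continuous[OF \<phi>] by (rule borel_measurable_continuous_onI)
  have C0': "0 \<le> C0" using order_trans[OF norm_ge_zero C0[of 0, simplified]] .
  let ?K = "2 ^ ?d * (C0 + C1)"
  have le: "norm (\<phi> x) \<le> ?K * (\<Prod>b\<in>Basis. inverse (1 + (x \<bullet> b)\<^sup>2))" for x
  proof -
    have "(\<Prod>b\<in>(Basis::'a set). 1 + (x \<bullet> b)\<^sup>2) \<le> (\<Prod>b\<in>(Basis::'a set). 1 + (norm x)\<^sup>2)"
      by (intro prod_mono) (auto intro!: power_mono[OF Basis_le_norm, of _ x 2, simplified])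
    also have "\<dots> = (1 + (norm x)\<^sup>2) ^ ?d" by simp
    also have "\<dots> \<le> 2 ^ ?d * (1 + norm x ^ (2 * ?d))"
    proof (cases "norm x \<le> 1")
      case True
      have "(1 + (norm x)\<^sup>2) ^ ?d \<le> 2 ^ ?d"
        using power_mono[OF True, of 2] by (intro power_mono) auto
      also have "\<dots> \<le> 2 ^ ?d * (1 + norm x ^ (2 * ?d))" by simp
      finally show ?thesis .
    next
      case False
      have "(1 + (norm x)\<^sup>2) ^ ?d \<le> (2 * (norm x)\<^sup>2) ^ ?d"
        using one_le_power[of "norm x" 2] False by (intro power_mono) auto
      also have "\<dots> \<le> 2 ^ ?d * (1 + norm x ^ (2 * ?d))" by (simp add: power_mult_distrib power_mult)
      finally show ?thesis .
    qed
    finally have "(\<Prod>b\<in>Basis. 1 + (x \<bullet> b)\<^sup>2) * norm (\<phi> x) \<le> (2 ^ ?d * (1 + norm x ^ (2 * ?d))) * norm (\<phi> x)"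
      by (rule mult_right_mono) simp
    also have "\<dots> = 2 ^ ?d * (norm x ^ 0 * norm (\<phi> x) + norm x ^ (2 * ?d) * norm (\<phi> x))" by (simp add: algebra_simps)
    also have "\<dots> \<le> ?K" by (intro mult_left_mono add_mono C0 C1) auto
    finally have *: "(\<Prod>b\<in>Basis. 1 + (x \<bullet> b)\<^sup>2) * norm (\<phi> x) \<le> ?K" .
    have "(\<Prod>b\<in>Basis. 1 + (x \<bullet> b)\<^sup>2) > 0" by (intro prod_pos) (auto intro: add_pos_nonneg)
    then have "norm (\<phi> x) \<le> ?K / (\<Prod>b\<in>Basis. 1 + (x \<bullet> b)\<^sup>2)"
      using * by (subst pos_le_divide_eq) (simp_all add: mult.commute)
    then show ?thesis
      using prod_inversef[of "\<lambda>b. 1 + (x \<bullet> b)\<^sup>2" Basis] by (simp only: comp_def divide_inverse)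
  qed
  show ?thesis
    by (rule Bochner_Integration.integrable_bound[OF integrable_mult_right[OF integrable_inverse_prod, of ?K]])
       (auto intro!: AE_I2 order_trans[OF le])
qed

section \<open>Fourier transforms of modulated Gaussians\<close>

lemma fourier_gwave_modulated:
  "fourier (gwave ((2 * pi) *\<^sub>R a) 0) = (\<lambda>\<xi>. of_real (gauss (\<xi> - a)))"
proof
  fix \<xi> :: 'a
  have "fourier (gwave ((2 * pi) *\<^sub>R a) 0) \<xi> = (\<integral>x. of_real (gauss x) * cis (- 2 * pi * (x \<bullet> (\<xi> - a))) \<partial>lborel)"
    unfolding fourier_def gwave_def gauss_def
    by (rule Bochner_Integration.integral_cong) (auto simp: cis_mult inner_diff_right inner_commute algebra_simps)
  also have "\<dots> = of_real (gauss (\<xi> - a))"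
    using has_integral_gauss_cis by (rule has_bochner_integral_integral_eq)
  finally show "fourier (gwave ((2 * pi) *\<^sub>R a) 0) \<xi> = of_real (gauss (\<xi> - a))" .
qed

text \<open>Expanding the square shows that the transform of a modulated Gaussian is again a
  multiple of a wave, hence a Schwartz function on which distributions may be evaluated.\<close>

lemma gauss_shift_eq_gwave:
  "complex_of_real (gauss (\<xi> - a)) = of_real (exp (- pi * (norm a)\<^sup>2)) * gwave 0 ((2 * pi) *\<^sub>R a) \<xi>"
proof -
  have "gauss (\<xi> - a) = exp (- pi * (norm a)\<^sup>2) * exp (- pi * (norm \<xi>)\<^sup>2 + ((2 * pi) *\<^sub>R a) \<bullet> \<xi>)"
    unfolding gauss_def power2_norm_eq_inner exp_add[symmetric]
    by (simp add: inner_diff_left inner_diff_right inner_commute algebra_simps)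
  then show ?thesis by (simp add: gwave_def)
qed

text \<open>Fourier inversion for this family only, by direct computation: shifting the integration
  variable by \<open>a\<close> produces the phase, and the centred Gaussian is its own
  transform.\<close>

lemma fourier_fourier_gwave_modulated:
  "fourier (fourier (gwave ((2 * pi) *\<^sub>R a) 0)) x = gwave ((2 * pi) *\<^sub>R a) 0 (- x)"
proof -
  have "fourier (fourier (gwave ((2 * pi) *\<^sub>R a) 0)) x = (\<integral>\<xi>. cis (- 2 * pi * ((a + \<xi>) \<bullet> x)) * of_real (gauss ((a + \<xi>) - a)) \<partial>lborel)"
    unfolding fourier_gwave_modulated unfolding fourier_def
    using integral_shift_reflect(1)[of "\<lambda>\<xi>. cis (- 2 * pi * (\<xi> \<bullet> x)) * complex_of_real (gauss (\<xi> - a))" a]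
    by simp
  also have "\<dots> = (\<integral>\<xi>. cis (- 2 * pi * (a \<bullet> x)) * (of_real (gauss \<xi>) * cis (- 2 * pi * (\<xi> \<bullet> x))) \<partial>lborel)"
    by (rule Bochner_Integration.integral_cong) (auto simp: cis_mult inner_add_left algebra_simps)
  also have "\<dots> = cis (- 2 * pi * (a \<bullet> x)) * of_real (gauss x)"
    by (subst integral_mult_right_zero, subst has_bochner_integral_integral_eq[OF has_integral_gauss_cis]) simp
  also have "\<dots> = gwave ((2 * pi) *\<^sub>R a) 0 (- x)"
    by (simp add: gwave_def gauss_def mult.commute)
  finally show ?thesis .
qed

subsection \<open>Multilinear convolution forms\<close>

interpretation lborel_prod: product_sigma_finite "\<lambda>i::nat. lborel :: 'a::euclidean_space measure"
  by standard

abbreviation lborel_pow :: "nat set \<Rightarrow> (nat \<Rightarrow> 'a::euclidean_space) measure" where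
  "lborel_pow I \<equiv> Pi\<^sub>M I (\<lambda>_. lborel)"

lemma lborel_pow_sigma_finite: "finite I \<Longrightarrow> sigma_finite_measure (lborel_pow I :: (nat \<Rightarrow> 'a::euclidean_space) measure)"
  by (rule lborel_prod.sigma_finite)

text \<open>With the other coordinates fixed, the sum differs from \<open>x j\<close> by a
  translation. As the product omits the index \<open>j\<close>, the integral over \<open>x j\<close>
  can be spent entirely on \<open>v\<close>.\<close>

lemma nn_integral_isolate:
  fixes w :: "nat \<Rightarrow> 'a::euclidean_space \<Rightarrow> ennreal" and v :: "'a \<Rightarrow> ennreal"
  assumes I: "finite I" "j \<in> I"
    and [measurable]: "\<And>i. i \<in> I \<Longrightarrow> w i \<in> borel_measurable borel" "v \<in> borel_measurable borel"
  shows "(\<integral>\<^sup>+x. (\<Prod>i\<in>I - {j}. w i (x i)) * v (\<Sum>i\<in>I. x i) \<partial>lborel_pow I) =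
     (\<Prod>i\<in>I - {j}. \<integral>\<^sup>+x. w i x \<partial>lborel) * (\<integral>\<^sup>+x. v x \<partial>lborel)"
proof -
  let ?J = "I - {j}"
  have IJ: "I = insert j ?J" "finite ?J" "j \<notin> ?J" using I by auto
  have [measurable]: "i \<in> ?J \<Longrightarrow> w i \<in> borel_measurable borel" for i by auto
  have "(\<integral>\<^sup>+x. (\<Prod>i\<in>?J. w i (x i)) * v (\<Sum>i\<in>I. x i) \<partial>lborel_pow I) =
     (\<integral>\<^sup>+x. \<integral>\<^sup>+y. (\<Prod>i\<in>?J. w i ((x(j := y)) i)) * v (\<Sum>i\<in>insert j ?J. (x(j := y)) i) \<partial>lborel \<partial>lborel_pow ?J)"
  proof -
    have "(\<lambda>x. (\<Prod>i\<in>?J. w i (x i)) * v (\<Sum>i\<in>insert j ?J. x i)) \<in> borel_measurable (lborel_pow (insert j ?J))"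
      by measurable
    from lborel_prod.product_nn_integral_insert[OF IJ(2,3) this] show ?thesis
      unfolding IJ(1)[symmetric] .
  qed
  also have "\<dots> = (\<integral>\<^sup>+x. \<integral>\<^sup>+y. (\<Prod>i\<in>?J. w i (x i)) * v ((\<Sum>i\<in>?J. x i) + y) \<partial>lborel \<partial>lborel_pow ?J)"
  proof -
    have "(\<Prod>i\<in>?J. w i ((x(j := y)) i)) = (\<Prod>i\<in>?J. w i (x i))" for x :: "nat \<Rightarrow> 'a" and y
      by (intro prod.cong) auto
    moreover have "(\<Sum>i\<in>insert j ?J. (x(j := y)) i) = (\<Sum>i\<in>?J. x i) + y" for x :: "nat \<Rightarrow> 'a" and y
      using IJ(2,3) by (subst sum.insert) (auto simp: add.commute intro!: sum.cong)
    ultimately show ?thesis by (simp only:)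
  qed
  also have "\<dots> = (\<integral>\<^sup>+x. (\<Prod>i\<in>?J. w i (x i)) * (\<integral>\<^sup>+y. v y \<partial>lborel) \<partial>lborel_pow ?J)"
    by (simp add: nn_integral_cmult nn_integral_shift_reflect(1))
  also have "\<dots> = (\<integral>\<^sup>+x. (\<Prod>i\<in>?J. w i (x i)) \<partial>lborel_pow ?J) * (\<integral>\<^sup>+y. v y \<partial>lborel)"
    by (rule nn_integral_multc) measurable
  also have "(\<integral>\<^sup>+x. (\<Prod>i\<in>?J. w i (x i)) \<partial>lborel_pow ?J) = (\<Prod>i\<in>?J. \<integral>\<^sup>+x. w i x \<partial>lborel)"
    using IJ(2) by (intro lborel_prod.product_nn_integral_prod) auto
  finally show ?thesis .
qed

text \<open>The integrand of the convolution of the n + 1 functions \<open>h 0, ..., h n\<close> at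
  \<open>y\<close>: the variables \<open>x 0, ..., x (n - 1)\<close> are free and the last argument
  is fixed by the requirement that all arguments sum to \<open>y\<close>. The values may be real or
  complex, since both the phases and the real majorant are treated.\<close>

definition conv_integrand :: "nat \<Rightarrow> (nat \<Rightarrow> 'a::euclidean_space \<Rightarrow> 'b::comm_semiring_1) \<Rightarrow> 'a \<Rightarrow> (nat \<Rightarrow> 'a) \<Rightarrow> 'b" where
  "conv_integrand n h y x = (\<Prod>i<n. h i (x i)) * h n (y - (\<Sum>i<n. x i))"

lemma conv_integrand_measurable [measurable]:
  fixes h :: "nat \<Rightarrow> 'a::euclidean_space \<Rightarrow> complex"
  assumes [measurable]: "\<And>i. h i \<in> borel_measurable borel"
  shows "case_prod (conv_integrand n h) \<in> borel_measurable (borel \<Otimes>\<^sub>M lborel_pow {..<n})"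
    "conv_integrand n h y \<in> borel_measurable (lborel_pow {..<n})"
  unfolding conv_integrand_def[abs_def] by measurable

text \<open>The left side is the geometric mean of the n + 1 products that omit one factor: each
  \<open>W i\<close> occurs in exactly n of them, which gives the exponent n / (n + 1).\<close>

lemma powr_AM_GM:
  fixes W :: "nat \<Rightarrow> real"
  assumes "\<And>i. 0 \<le> W i" "n > 0"
  shows "(\<Prod>i\<le>n. W i powr (real n / real (Suc n))) \<le> (\<Sum>j\<le>n. \<Prod>i\<in>{..n} - {j}. W i) / real (Suc n)"
proof -
  let ?V = "\<lambda>j. \<Prod>i\<in>{..n} - {j}. W i"
  have V0: "0 \<le> ?V j" for j using assms by (intro prod_nonneg) auto
  have "(\<Prod>j\<le>n. ?V j powr (1 / real (Suc n))) = (\<Prod>j\<le>n. \<Prod>i\<in>{..n} - {j}. W i powr (1 / real (Suc n)))"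
    using assms by (intro prod.cong refl) (simp add: prod_powr_distrib)
  also have "\<dots> = (\<Prod>j\<le>n. \<Prod>i\<in>{i\<in>{..n}. i \<noteq> j}. W i powr (1 / real (Suc n)))"
    by (intro prod.cong) auto
  also have "\<dots> = (\<Prod>i\<le>n. \<Prod>j\<in>{j\<in>{..n}. i \<noteq> j}. W i powr (1 / real (Suc n)))"
    by (rule prod.swap_restrict) auto
  also have "\<dots> = (\<Prod>i\<le>n. W i powr (real n / real (Suc n)))"
  proof (intro prod.cong refl)
    fix i assume i: "i \<in> {..n}"
    have "{j\<in>{..n}. i \<noteq> j} = {..n} - {i}" by auto
    then have "card {j\<in>{..n}. i \<noteq> j} = n" using i by (simp add: card_Diff_singleton)
    then have "(\<Prod>j\<in>{j\<in>{..n}. i \<noteq> j}. W i powr (1 / real (Suc n))) = (W i powr (1 / real (Suc n))) ^ n"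
      by (simp only: prod_constant)
    also have "\<dots> = W i powr (real n / real (Suc n))"
      using \<open>n > 0\<close> powr_power[of "W i" "1 / real (Suc n)" n] by (cases "W i = 0") simp_all
    finally show "(\<Prod>j\<in>{j\<in>{..n}. i \<noteq> j}. W i powr (1 / real (Suc n))) = W i powr (real n / real (Suc n))" .
  qed
  finally have eq: "(\<Prod>i\<le>n. W i powr (real n / real (Suc n))) = (\<Prod>j\<le>n. ?V j) powr (1 / real (Suc n))"
    using V0 by (simp add: prod_powr_distrib)
  also have "\<dots> \<le> (\<Sum>j\<le>n. ?V j) / real (card {..n})"
    using arith_geom_mean[of "{..n}" ?V] V0 by (simp add: sum_divide_distrib)
  finally show ?thesis by simp
qed

text \<open>
  The factors \<open>|h\<^sub>0|, \<dots>, |h\<^sub>n|\<close> are powers \<open>W\<^sub>i powr (n / (n + 1))\<close>, so by the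
  arithmetic-geometric mean inequality their product is at most the mean of the products
  omitting one \<open>W\<^sub>j\<close>, each of which integrates to a product.
\<close>
lemma nn_integral_conv_integrand_le:
  fixes h :: "nat \<Rightarrow> 'a::euclidean_space \<Rightarrow> complex"
  assumes [measurable]: "\<And>i. h i \<in> borel_measurable borel" and n: "n > 0"
    and S: "\<And>i. i \<le> n \<Longrightarrow> (\<integral>\<^sup>+x. ennreal (norm (h i x) powr (real (Suc n) / real n)) \<partial>lborel) = S"
  shows "(\<integral>\<^sup>+x. ennreal (norm (conv_integrand n h y x)) \<partial>lborel_pow {..<n}) \<le> S ^ n"
proof -
  define q where "q = real (Suc n) / real n"
  define W where "W i x = norm (h i x) powr q" for i x
  have [measurable]: "W i \<in> borel_measurable borel" for i unfolding W_def by measurable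
  have W0: "0 \<le> W i x" for i x by (simp add: W_def)
  have IW: "(\<integral>\<^sup>+x. ennreal (W i x) \<partial>lborel) = S" if "i \<le> n" for i
    using S[OF that] by (simp add: W_def q_def)
  have hW: "norm (h i x) = W i x powr (real n / real (Suc n))" for i x
    using n by (simp add: W_def powr_powr q_def)
  define X where "X x i = (if i < n then x i else y - (\<Sum>i<n. x i))" for x :: "nat \<Rightarrow> 'a" and i
  have le: "norm (conv_integrand n h y x) \<le> (\<Sum>j\<le>n. \<Prod>i\<in>{..n} - {j}. W i (X x i)) / real (Suc n)" for x
  proof -
    have "norm (conv_integrand n h y x) = (\<Prod>i\<le>n. norm (h i (X x i)))"
      by (simp add: conv_integrand_def norm_mult X_def prod_norm lessThan_Suc_atMost[symmetric])
    also have "\<dots> \<le> (\<Sum>j\<le>n. \<Prod>i\<in>{..n} - {j}. W i (X x i)) / real (Suc n)"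
      unfolding hW by (rule powr_AM_GM) (use n W0 in auto)
    finally show ?thesis .
  qed
  have part: "(\<integral>\<^sup>+x. ennreal (\<Prod>i\<in>{..n} - {j}. W i (X x i)) \<partial>lborel_pow {..<n}) = S ^ n" if j: "j \<le> n" for j
  \<comment> \<open>For \<open>j = n\<close> the omitted factor is the one at the dependent
    argument, and the free variables separate at once. For \<open>j < n\<close> the variable
    \<open>x j\<close> occurs only inside the dependent argument and is integrated out
    there.\<close>
  proof (cases "j = n")
    case True
    have "(\<integral>\<^sup>+x. ennreal (\<Prod>i\<in>{..n} - {j}. W i (X x i)) \<partial>lborel_pow {..<n}) = (\<integral>\<^sup>+x. (\<Prod>i<n. ennreal (W i (x i))) \<partial>lborel_pow {..<n})"
    proof (rule nn_integral_cong)
      fix x :: "nat \<Rightarrow> 'a"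
      have "{..n} - {j} = {..<n}" using True by auto
      then show "ennreal (\<Prod>i\<in>{..n} - {j}. W i (X x i)) = (\<Prod>i<n. ennreal (W i (x i)))"
        by (simp add: prod_ennreal W0 X_def)
    qed
    also have "\<dots> = (\<Prod>i<n. \<integral>\<^sup>+x. ennreal (W i x) \<partial>lborel)"
      by (rule lborel_prod.product_nn_integral_prod) auto
    also have "\<dots> = S ^ n" by (simp add: IW)
    finally show ?thesis .
  next
    case False
    then have jn: "j < n" using j by auto
    have "(\<integral>\<^sup>+x. ennreal (\<Prod>i\<in>{..n} - {j}. W i (X x i)) \<partial>lborel_pow {..<n}) =
       (\<integral>\<^sup>+x. (\<Prod>i\<in>{..<n} - {j}. ennreal (W i (x i))) * ennreal (W n (y - (\<Sum>i<n. x i))) \<partial>lborel_pow {..<n})"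
    proof (rule nn_integral_cong)
      fix x :: "nat \<Rightarrow> 'a"
      have "{..n} - {j} = insert n ({..<n} - {j})" using jn by auto
      then show "ennreal (\<Prod>i\<in>{..n} - {j}. W i (X x i)) = (\<Prod>i\<in>{..<n} - {j}. ennreal (W i (x i))) * ennreal (W n (y - (\<Sum>i<n. x i)))"
        by (simp add: prod_ennreal W0 X_def ennreal_mult' mult.commute prod_nonneg)
    qed
    also have "\<dots> = (\<Prod>i\<in>{..<n} - {j}. \<integral>\<^sup>+x. ennreal (W i x) \<partial>lborel) * (\<integral>\<^sup>+x. ennreal (W n (y - x)) \<partial>lborel)"
      using jn by (intro nn_integral_isolate) auto
    also have "(\<integral>\<^sup>+x. ennreal (W n (y - x)) \<partial>lborel) = S"
      using nn_integral_shift_reflect(2)[of "\<lambda>x. ennreal (W n x)" y] IW[of n] by simp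
    also have "(\<Prod>i\<in>{..<n} - {j}. \<integral>\<^sup>+x. ennreal (W i x) \<partial>lborel) = S ^ (n - 1)"
      using jn by (simp add: IW)
    finally show ?thesis using n by (cases n) (simp_all add: mult.commute)
  qed
  have [measurable]: "(\<lambda>x. X x i) \<in> measurable (lborel_pow {..<n}) borel" for i
    unfolding X_def by (cases "i < n") auto
  have "(\<integral>\<^sup>+x. ennreal (norm (conv_integrand n h y x)) \<partial>lborel_pow {..<n}) \<le>
      (\<integral>\<^sup>+x. (\<Sum>j\<le>n. ennreal (\<Prod>i\<in>{..n} - {j}. W i (X x i))) * ennreal (1 / real (Suc n)) \<partial>lborel_pow {..<n})"
  proof (rule nn_integral_mono)
    fix x
    show "ennreal (norm (conv_integrand n h y x)) \<le> (\<Sum>j\<le>n. ennreal (\<Prod>i\<in>{..n} - {j}. W i (X x i))) * ennreal (1 / real (Suc n))"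
      using ennreal_leI[OF le[of x]]
      by (simp add: sum_ennreal prod_nonneg W0 sum_nonneg ennreal_mult'[symmetric] del: of_nat_Suc)
  qed
  also have "\<dots> = (\<Sum>j\<le>n. S ^ n) * ennreal (1 / real (Suc n))"
    by (simp add: nn_integral_multc nn_integral_sum part del: of_nat_Suc)
  also have "\<dots> = S ^ n * (ennreal (real (Suc n)) * ennreal (1 / real (Suc n)))"
    by (simp add: mult_ac ennreal_of_nat_eq_real_of_nat del: of_nat_Suc)
  also have "ennreal (real (Suc n)) * ennreal (1 / real (Suc n)) = 1"
    by (simp add: ennreal_mult'[symmetric] del: of_nat_Suc)
  finally show ?thesis by simp
qed

definition conv_form :: "nat \<Rightarrow> (nat \<Rightarrow> 'a::euclidean_space \<Rightarrow> complex) \<Rightarrow> 'a \<Rightarrow> complex" where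
  "conv_form n h y = (\<integral>x. conv_integrand n h y x \<partial>lborel_pow {..<n})"

text \<open>Integrating over \<open>y\<close> first detaches the last factor by translation; the
  double integral of the norm becomes the product of the n + 1 norms in L^1.\<close>

lemma integrable_conv_integrand_pair:
  fixes h :: "nat \<Rightarrow> 'a::euclidean_space \<Rightarrow> complex"
  assumes h: "\<And>i. integrable lborel (h i)"
  shows "integrable (lborel \<Otimes>\<^sub>M lborel_pow {..<n}) (case_prod (conv_integrand n h))"
proof -
  interpret P: sigma_finite_measure "lborel_pow {..<n} :: (nat \<Rightarrow> 'a) measure"
    by (rule lborel_pow_sigma_finite) simp
  interpret pair_sigma_finite "lborel :: 'a measure" "lborel_pow {..<n} :: (nat \<Rightarrow> 'a) measure" ..
  have [measurable]: "h i \<in> borel_measurable borel" for i using h[of i] by auto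
  have [measurable]: "(\<lambda>p. case p of (y, x) \<Rightarrow> conv_integrand n h y x) \<in> borel_measurable (lborel \<Otimes>\<^sub>M lborel_pow {..<n})"
    using conv_integrand_measurable(1)[of h n] by simp
  have "(\<integral>\<^sup>+p. ennreal (norm (case p of (y, x) \<Rightarrow> conv_integrand n h y x)) \<partial>(lborel \<Otimes>\<^sub>M lborel_pow {..<n})) =
     (\<integral>\<^sup>+x. \<integral>\<^sup>+y. ennreal (norm (conv_integrand n h y x)) \<partial>lborel \<partial>lborel_pow {..<n})"
    by (subst nn_integral_snd[symmetric]) simp_all
  also have "\<dots> = (\<integral>\<^sup>+x. (\<Prod>i<n. ennreal (norm (h i (x i)))) * (\<integral>\<^sup>+y. ennreal (norm (h n y)) \<partial>lborel) \<partial>lborel_pow {..<n})"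
  proof (rule nn_integral_cong)
    fix x :: "nat \<Rightarrow> 'a"
    have "(\<integral>\<^sup>+y. ennreal (norm (conv_integrand n h y x)) \<partial>lborel) =
        (\<integral>\<^sup>+y. (\<Prod>i<n. ennreal (norm (h i (x i)))) * ennreal (norm (h n (- (\<Sum>i<n. x i) + y))) \<partial>lborel)"
      by (simp add: conv_integrand_def norm_mult prod_norm[symmetric] ennreal_mult' prod_ennreal prod_nonneg)
    also have "\<dots> = (\<Prod>i<n. ennreal (norm (h i (x i)))) * (\<integral>\<^sup>+y. ennreal (norm (h n y)) \<partial>lborel)"
      using nn_integral_shift_reflect(1)[of "\<lambda>y. ennreal (norm (h n y))" "- (\<Sum>i<n. x i)"]
      by (subst nn_integral_cmult) simp_all
    finally show "(\<integral>\<^sup>+y. ennreal (norm (conv_integrand n h y x)) \<partial>lborel) =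
      (\<Prod>i<n. ennreal (norm (h i (x i)))) * (\<integral>\<^sup>+y. ennreal (norm (h n y)) \<partial>lborel)" .
  qed
  also have "\<dots> = (\<Prod>i<n. \<integral>\<^sup>+x. ennreal (norm (h i x)) \<partial>lborel) * (\<integral>\<^sup>+y. ennreal (norm (h n y)) \<partial>lborel)"
    by (subst nn_integral_multc) (auto intro!: arg_cong2[where f="(*)"] lborel_prod.product_nn_integral_prod)
  also have "\<dots> = ennreal ((\<Prod>i<n. \<integral>x. norm (h i x) \<partial>lborel) * (\<integral>y. norm (h n y) \<partial>lborel))"
    using h by (simp add: nn_integral_eq_integral prod_ennreal ennreal_mult prod_nonneg)
  also have "\<dots> < \<infinity>" by simp
  finally show ?thesis by (simp add: integrable_iff_bounded)
qed

lemma integrable_conv_form: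
  fixes h :: "nat \<Rightarrow> 'a::euclidean_space \<Rightarrow> complex"
  assumes h: "\<And>i. integrable lborel (h i)"
  shows "integrable lborel (conv_form n h)"
proof -
  interpret P: sigma_finite_measure "lborel_pow {..<n} :: (nat \<Rightarrow> 'a) measure"
    by (rule lborel_pow_sigma_finite) simp
  interpret pair_sigma_finite "lborel :: 'a measure" "lborel_pow {..<n} :: (nat \<Rightarrow> 'a) measure" ..
  show ?thesis
    using integrable_fst[OF integrable_conv_integrand_pair[OF h]] by (simp add: conv_form_def[abs_def])
qed

text \<open>After the integrals are exchanged, shifting \<open>y\<close> by the sum of the
  \<open>x i\<close> splits the character into one factor for each variable.\<close>

lemma fourier_conv_form:
  fixes h :: "nat \<Rightarrow> 'a::euclidean_space \<Rightarrow> complex"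
  assumes h: "\<And>i. integrable lborel (h i)"
  shows "fourier (conv_form n h) \<xi> = (\<Prod>i\<le>n. fourier (h i) \<xi>)"
proof -
  interpret P: sigma_finite_measure "lborel_pow {..<n} :: (nat \<Rightarrow> 'a) measure"
    by (rule lborel_pow_sigma_finite) simp
  interpret pair_sigma_finite "lborel :: 'a measure" "lborel_pow {..<n} :: (nat \<Rightarrow> 'a) measure" ..
  have [measurable]: "h i \<in> borel_measurable borel" for i using h[of i] by auto
  let ?e = "\<lambda>y::'a. cis (- 2 * pi * (y \<bullet> \<xi>))"
  have int: "integrable (lborel \<Otimes>\<^sub>M lborel_pow {..<n}) (\<lambda>(y, x). ?e y * conv_integrand n h y x)"
    using integrable_cis_mult[OF integrable_conv_integrand_pair[OF h, of n], of "\<lambda>(y, x). - 2 * pi * (y \<bullet> \<xi>)"]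
    by (simp add: case_prod_beta')
  have "fourier (conv_form n h) \<xi> = (\<integral>y. \<integral>x. ?e y * conv_integrand n h y x \<partial>lborel_pow {..<n} \<partial>lborel)"
    by (simp add: fourier_def conv_form_def)
  also have "\<dots> = (\<integral>x. \<integral>y. ?e y * conv_integrand n h y x \<partial>lborel \<partial>lborel_pow {..<n})"
    using Fubini_integral[OF int] by simp
  also have "\<dots> = (\<integral>x. (\<Prod>i<n. ?e (x i) * h i (x i)) * fourier (h n) \<xi> \<partial>lborel_pow {..<n})"
  proof (rule Bochner_Integration.integral_cong[OF refl])
    fix x :: "nat \<Rightarrow> 'a"
    let ?s = "\<Sum>i<n. x i"
    have es: "?e ?s = (\<Prod>i<n. ?e (x i))"
      by (simp add: inner_sum_left sum_distrib_left flip: cis_sum)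
    have "(\<integral>y. ?e y * conv_integrand n h y x \<partial>lborel) = (\<integral>y. ?e (?s + y) * conv_integrand n h (?s + y) x \<partial>lborel)"
      by (rule integral_shift_reflect(1)[symmetric]) (simp add: conv_integrand_def)
    also have "\<dots> = (\<integral>y. (?e ?s * (\<Prod>i<n. h i (x i))) * (?e y * h n y) \<partial>lborel)"
    proof (rule Bochner_Integration.integral_cong[OF refl])
      fix y
      have "?e (?s + y) = ?e ?s * ?e y" by (simp add: cis_mult inner_add_left algebra_simps)
      then show "?e (?s + y) * conv_integrand n h (?s + y) x = (?e ?s * (\<Prod>i<n. h i (x i))) * (?e y * h n y)"
        by (simp add: conv_integrand_def)
    qed
    also have "\<dots> = (?e ?s * (\<Prod>i<n. h i (x i))) * fourier (h n) \<xi>"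
      unfolding fourier_def by (rule integral_mult_right_zero)
    also have "\<dots> = (\<Prod>i<n. ?e (x i) * h i (x i)) * fourier (h n) \<xi>"
      by (simp only: es prod.distrib)
    finally show "(\<integral>y. ?e y * conv_integrand n h y x \<partial>lborel) = (\<Prod>i<n. ?e (x i) * h i (x i)) * fourier (h n) \<xi>" .
  qed
  also have "\<dots> = (\<integral>x. (\<Prod>i<n. ?e (x i) * h i (x i)) \<partial>lborel_pow {..<n}) * fourier (h n) \<xi>"
    by (rule integral_mult_left_zero)
  also have "(\<integral>x. (\<Prod>i<n. ?e (x i) * h i (x i)) \<partial>lborel_pow {..<n}) = (\<Prod>i<n. fourier (h i) \<xi>)"
    unfolding fourier_def
    by (rule lborel_prod.product_integral_prod) (auto intro!: integrable_cis_mult h)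
  finally show ?thesis by (simp add: lessThan_Suc_atMost[symmetric])
qed

lemma norm_conv_form_le:
  fixes h :: "nat \<Rightarrow> 'a::euclidean_space \<Rightarrow> complex"
  assumes [measurable]: "\<And>i. h i \<in> borel_measurable borel"
    and le: "(\<integral>\<^sup>+x. ennreal (norm (conv_integrand n h y x)) \<partial>lborel_pow {..<n}) \<le> ennreal B" and B: "0 \<le> B"
  shows "norm (conv_form n h y) \<le> B"
proof -
  have "integrable (lborel_pow {..<n}) (conv_integrand n h y)"
    using le by (auto simp: integrable_iff_bounded intro: le_less_trans)
  then have "ennreal (norm (conv_form n h y)) \<le> (\<integral>\<^sup>+x. ennreal (norm (conv_integrand n h y x)) \<partial>lborel_pow {..<n})"
    unfolding conv_form_def by (rule integral_norm_bound_ennreal)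
  also note le
  finally show ?thesis using B by simp
qed

text \<open>Bounding \<open>h 0\<close> by \<open>C\<close> frees the integration over
  \<open>x 0\<close>, which can then be spent on the sum of the variables. Thus the last factor
  contributes through its L^1 norm only (\<open>est\<close>); \<open>n > 0\<close> ensures that it
  is not \<open>h 0\<close> itself. Applied to \<open>h n\<close> this gives boundedness, and
  applied to a difference of translates of \<open>h n\<close> it gives continuity by continuity of
  translation in the mean.\<close>

lemma
  fixes h :: "nat \<Rightarrow> 'a::euclidean_space \<Rightarrow> complex"
  assumes h: "\<And>i. integrable lborel (h i)" and n: "n > 0" and C: "\<And>x. norm (h 0 x) \<le> C"
  shows bounded_conv_form: "\<exists>B. \<forall>y. norm (conv_form n h y) \<le> B"
    and isCont_conv_form: "isCont (conv_form n h) 0"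
proof -
  have [measurable]: "h i \<in> borel_measurable borel" for i using h[of i] by auto
  have C0: "0 \<le> C" using order_trans[OF norm_ge_zero C] .
  define K where "K = C * (\<Prod>i\<in>{..<n} - {0}. \<integral>x. norm (h i x) \<partial>lborel)"
  have K0: "0 \<le> K" unfolding K_def using C0 by (intro mult_nonneg_nonneg prod_nonneg) auto
  have est: "(\<integral>\<^sup>+x. ennreal (norm ((\<Prod>i<n. h i (x i)) * v (\<Sum>i<n. x i))) \<partial>lborel_pow {..<n}) \<le> ennreal (K * (\<integral>x. norm (v x) \<partial>lborel))"
    if v: "integrable lborel v" for v :: "'a \<Rightarrow> complex"
  proof -
    have [measurable]: "v \<in> borel_measurable borel" using v by auto
    have "(\<integral>\<^sup>+x. ennreal (norm ((\<Prod>i<n. h i (x i)) * v (\<Sum>i<n. x i))) \<partial>lborel_pow {..<n}) \<le>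
        (\<integral>\<^sup>+x. ennreal C * ((\<Prod>i\<in>{..<n} - {0}. ennreal (norm (h i (x i)))) * ennreal (norm (v (\<Sum>i<n. x i)))) \<partial>lborel_pow {..<n})"
    proof (rule nn_integral_mono)
      fix x :: "nat \<Rightarrow> 'a"
      have "norm ((\<Prod>i<n. h i (x i)) * v (\<Sum>i<n. x i)) = norm (h 0 (x 0)) * (\<Prod>i\<in>{..<n} - {0}. norm (h i (x i))) * norm (v (\<Sum>i<n. x i))"
        using n by (simp add: norm_mult prod_norm[symmetric] prod.remove[of "{..<n}" 0])
      also have "\<dots> \<le> C * (\<Prod>i\<in>{..<n} - {0}. norm (h i (x i))) * norm (v (\<Sum>i<n. x i))"
        by (intro mult_right_mono C prod_nonneg) auto
      finally show "ennreal (norm ((\<Prod>i<n. h i (x i)) * v (\<Sum>i<n. x i))) \<le>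
          ennreal C * ((\<Prod>i\<in>{..<n} - {0}. ennreal (norm (h i (x i)))) * ennreal (norm (v (\<Sum>i<n. x i))))"
        using C0 by (simp add: prod_ennreal ennreal_mult[symmetric] prod_nonneg mult_ac ennreal_leI)
    qed
    also have "\<dots> = ennreal C * (\<integral>\<^sup>+x. ((\<Prod>i\<in>{..<n} - {0}. ennreal (norm (h i (x i)))) * ennreal (norm (v (\<Sum>i<n. x i)))) \<partial>lborel_pow {..<n})"
      by (rule nn_integral_cmult) simp
    also have "\<dots> = ennreal C * ((\<Prod>i\<in>{..<n} - {0}. \<integral>\<^sup>+x. ennreal (norm (h i x)) \<partial>lborel) * (\<integral>\<^sup>+x. ennreal (norm (v x)) \<partial>lborel))"
      using n by (subst nn_integral_isolate[of "{..<n}" 0 "\<lambda>i x. ennreal (norm (h i x))" "\<lambda>x. ennreal (norm (v x))"]) auto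
    also have "\<dots> = ennreal (K * (\<integral>x. norm (v x) \<partial>lborel))"
      using C0 h v by (simp add: K_def nn_integral_eq_integral prod_ennreal ennreal_mult[symmetric] prod_nonneg mult.assoc)
    finally show ?thesis .
  qed
  have est1: "(\<integral>\<^sup>+x. ennreal (norm (conv_integrand n h y x)) \<partial>lborel_pow {..<n}) \<le> ennreal (K * (\<integral>x. norm (h n x) \<partial>lborel))" for y
    using est[OF integrable_shift_reflect(2)[OF h, of n y]] integral_shift_reflect(2)[of "\<lambda>x. norm (h n x)" y]
    by (simp add: conv_integrand_def)
  show "\<exists>B. \<forall>y. norm (conv_form n h y) \<le> B"
    using norm_conv_form_le[OF _ est1] K0 by (auto intro!: exI)
  have ii: "integrable (lborel_pow {..<n}) (conv_integrand n h y)" for y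
    using est1[of y] by (auto simp: integrable_iff_bounded intro: le_less_trans)
  have diff: "norm (conv_form n h y - conv_form n h 0) \<le> K * (\<integral>x. norm (h n (x + y) - h n x) \<partial>lborel)" for y
  proof -
    define v where "v s = h n (y - s) - h n (0 - s)" for s
    have v: "integrable lborel v" unfolding v_def[abs_def]
      by (intro Bochner_Integration.integrable_diff integrable_shift_reflect(2) h)
    have eq: "conv_integrand n h y x - conv_integrand n h 0 x = (\<Prod>i<n. h i (x i)) * v (\<Sum>i<n. x i)" for x
      by (simp add: conv_integrand_def v_def algebra_simps)
    have A: "conv_form n h y - conv_form n h 0 = (\<integral>x. (\<Prod>i<n. h i (x i)) * v (\<Sum>i<n. x i) \<partial>lborel_pow {..<n})"
      unfolding conv_form_def eq[symmetric] by (rule Bochner_Integration.integral_diff[symmetric]) (rule ii)+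
    have B: "integrable (lborel_pow {..<n}) (\<lambda>x. (\<Prod>i<n. h i (x i)) * v (\<Sum>i<n. x i))"
      unfolding eq[symmetric] by (intro Bochner_Integration.integrable_diff ii)
    have "ennreal (norm (conv_form n h y - conv_form n h 0)) \<le> (\<integral>\<^sup>+x. ennreal (norm ((\<Prod>i<n. h i (x i)) * v (\<Sum>i<n. x i))) \<partial>lborel_pow {..<n})"
      unfolding A by (rule integral_norm_bound_ennreal[OF B])
    also have "\<dots> \<le> ennreal (K * (\<integral>x. norm (v x) \<partial>lborel))" by (rule est[OF v])
    finally have "norm (conv_form n h y - conv_form n h 0) \<le> K * (\<integral>x. norm (v x) \<partial>lborel)"
      using K0 by (subst (asm) ennreal_le_iff) (auto intro!: mult_nonneg_nonneg)
    also have "(\<integral>x. norm (v x) \<partial>lborel) = (\<integral>x. norm (h n (x + y) - h n x) \<partial>lborel)"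
      using integral_shift_reflect(2)[of "\<lambda>x. norm (v x)" 0] v by (simp add: v_def add.commute)
    finally show ?thesis .
  qed
  have "((\<lambda>y. K * (\<integral>x. norm (h n (x + y) - h n x) \<partial>lborel)) \<longlongrightarrow> K * 0) (at 0)"
    by (intro tendsto_mult tendsto_const mean_translation_continuous h)
  then have lim: "((\<lambda>y. K * (\<integral>x. norm (h n (x + y) - h n x) \<partial>lborel)) \<longlongrightarrow> 0) (at 0)"
    by simp
  have "((\<lambda>y. conv_form n h y - conv_form n h 0) \<longlongrightarrow> 0) (at 0)"
    by (rule Lim_null_comparison[OF always_eventually[OF allI[OF diff]] lim])
  then show "isCont (conv_form n h) 0"
    unfolding isCont_def by (rule LIM_zero_cancel)
qed

subsection \<open>The Hausdorff--Young inequality for even exponents\<close>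

text \<open>The transform of the reflected conjugate is the conjugate of the transform. So for odd n
  the n + 1 factors with indices 0 to n pair off, and their transforms multiply to
  \<open>norm (fourier h \<xi>) ^ Suc n\<close>.\<close>

definition alt_reflect :: "('a::euclidean_space \<Rightarrow> complex) \<Rightarrow> nat \<Rightarrow> 'a \<Rightarrow> complex" where
  "alt_reflect h i x = (if even i then h x else cnj (h (- x)))"

lemma cnj_measurable [measurable]: "cnj \<in> borel_measurable borel"
  by (intro borel_measurable_continuous_onI continuous_intros)

lemma alt_reflect_measurable [measurable]:
  assumes [measurable]: "h \<in> borel_measurable borel"
  shows "alt_reflect h i \<in> borel_measurable borel"
  unfolding alt_reflect_def[abs_def] by (cases "even i") simp_all

lemma integrable_alt_reflect:
  assumes "integrable lborel h"
  shows "integrable lborel (alt_reflect h i)"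
  using assms integrable_shift_reflect(2)[OF assms, of 0]
  by (cases "even i") (simp_all add: alt_reflect_def[abs_def])

lemma nn_integral_alt_reflect:
  assumes [measurable]: "h \<in> borel_measurable borel"
  shows "(\<integral>\<^sup>+x. ennreal (norm (alt_reflect h i x) powr q) \<partial>lborel) = (\<integral>\<^sup>+x. ennreal (norm (h x) powr q) \<partial>lborel)"
  using nn_integral_shift_reflect(2)[of "\<lambda>x. ennreal (norm (h x) powr q)" 0]
  by (cases "even i") (simp_all add: alt_reflect_def)

lemma fourier_alt_reflect:
  assumes [measurable]: "h \<in> borel_measurable borel"
  shows "fourier (alt_reflect h i) \<xi> = (if even i then fourier h \<xi> else cnj (fourier h \<xi>))"
proof (cases "even i")
  case False
  have "fourier (alt_reflect h i) \<xi> = (\<integral>x. cnj (cis (- 2 * pi * ((0 - x) \<bullet> \<xi>)) * h (0 - x)) \<partial>lborel)"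
    using False by (simp add: fourier_def alt_reflect_def cis_cnj)
  also have "\<dots> = cnj (\<integral>x. cis (- 2 * pi * ((0 - x) \<bullet> \<xi>)) * h (0 - x) \<partial>lborel)"
    by (rule Bochner_Integration.integral_cnj)
  also have "(\<integral>x. cis (- 2 * pi * ((0 - x) \<bullet> \<xi>)) * h (0 - x) \<partial>lborel) = fourier h \<xi>"
    unfolding fourier_def by (rule integral_shift_reflect(2)) simp
  finally show ?thesis using False by simp
qed (simp add: alt_reflect_def[abs_def])

lemma prod_alternating_cnj:
  assumes "odd n"
  shows "(\<Prod>i\<le>n. if even i then z else cnj z) = of_real (norm z ^ Suc n)"
proof -
  obtain m where "n = 2 * m + 1" using assms by (elim oddE)
  moreover have "(\<Prod>i\<le>2 * m + 1. if even i then z else cnj z) = of_real (norm z ^ (2 * m + 2))"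
  proof (induction m)
    case 0
    show ?case by (simp add: complex_norm_square[symmetric] power2_eq_square)
  next
    case (Suc m)
    have "(\<Prod>i\<le>2 * Suc m + 1. if even i then z else cnj z) = (\<Prod>i\<le>2 * m + 1. if even i then z else cnj z) * (z * cnj z)"
      by (simp add: mult.assoc)
    also have "\<dots> = of_real (norm z ^ (2 * Suc m + 2))"
      unfolding Suc by (simp add: complex_norm_square[symmetric] power_add power2_eq_square)
    finally show ?case .
  qed
  ultimately show ?thesis by simp
qed

text \<open>The convolution \<open>?D\<close> has the nonnegative transform
  \<open>norm (fourier h \<xi>) ^ Suc n\<close>, so inversion at 0 applies. The bound on
  \<open>?D\<close> from the convolution estimate yields the inequality with exponent q = (n + 1) /
  n and constant 1; when \<open>h\<close> is bounded, \<open>?D\<close> is continuous at 0 and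
  equality results.\<close>

lemma
  fixes h :: "'a::euclidean_space \<Rightarrow> complex"
  assumes h: "integrable lborel h" and n: "odd n"
  shows nn_integral_norm_fourier_power_le:
    "(\<integral>\<^sup>+\<xi>. ennreal (norm (fourier h \<xi>) ^ Suc n) \<partial>lborel)
       \<le> (\<integral>\<^sup>+x. ennreal (norm (h x) powr (real (Suc n) / real n)) \<partial>lborel) ^ n"
    and nn_integral_norm_fourier_power_eq:
    "(\<And>x. norm (h x) \<le> C) \<Longrightarrow> (\<integral>\<^sup>+\<xi>. ennreal (norm (fourier h \<xi>) ^ Suc n) \<partial>lborel)
       = ennreal (Re (conv_form n (alt_reflect h) 0))"
proof -
  have [measurable]: "h \<in> borel_measurable borel" using h by auto
  have n0: "n > 0" using n by (auto intro: Nat.gr0I)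
  let ?S = "\<integral>\<^sup>+x. ennreal (norm (h x) powr (real (Suc n) / real n)) \<partial>lborel"
  let ?D = "conv_form n (alt_reflect h)"
  have Di: "integrable lborel ?D" by (intro integrable_conv_form integrable_alt_reflect h)
  have FD: "fourier ?D \<xi> = of_real (norm (fourier h \<xi>) ^ Suc n)" for \<xi>
    unfolding fourier_conv_form[OF integrable_alt_reflect[OF h]] prod_alternating_cnj[OF n, symmetric]
    by (intro prod.cong refl fourier_alt_reflect) simp
  show "(\<integral>\<^sup>+\<xi>. ennreal (norm (fourier h \<xi>) ^ Suc n) \<partial>lborel) \<le> ?S ^ n"
  proof (cases "?S = \<infinity>")
    case True
    then show ?thesis using n0 by (simp add: top_power_ennreal)
  next
    case False
    then obtain s where s: "?S = ennreal s" "0 \<le> s" by (cases ?S) auto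
    have "norm (?D y) \<le> s ^ n" for y
    proof (rule norm_conv_form_le)
      show "(\<integral>\<^sup>+ x. ennreal (cmod (conv_integrand n (alt_reflect h) y x)) \<partial>lborel_pow {..<n}) \<le> ennreal (s ^ n)"
        using nn_integral_conv_integrand_le[OF _ n0, of "alt_reflect h" "ennreal s" y] s
        by (simp add: nn_integral_alt_reflect ennreal_power)
    qed (use s in auto)
    from nn_integral_nonneg_fourier_le[OF Di FD _ this] show ?thesis
      using s by (simp add: ennreal_power)
  qed
  assume C: "\<And>x. norm (h x) \<le> C"
  have "\<exists>B. \<forall>y. norm (?D y) \<le> B"
    by (rule bounded_conv_form[where C=C, OF integrable_alt_reflect[OF h] n0]) (auto simp: alt_reflect_def C)
  then obtain B where B: "\<And>y. norm (?D y) \<le> B" by auto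
  have "isCont ?D 0"
    by (rule isCont_conv_form[where C=C, OF integrable_alt_reflect[OF h] n0]) (auto simp: alt_reflect_def C)
  from nn_integral_nonneg_fourier_eq[OF Di FD _ B this]
  show "(\<integral>\<^sup>+\<xi>. ennreal (norm (fourier h \<xi>) ^ Suc n) \<partial>lborel) = ennreal (Re (?D 0))"
    by simp
qed

text \<open>Completeness of L^p together with a common majorant. The factor \<open>2 ^ j\<close>
  inside \<open>z j\<close> costs \<open>2 ^ (j * p)\<close>, which the assumed rate absorbs with
  \<open>(1/2) ^ j\<close> to spare, so the sum \<open>ZZ\<close> of the \<open>z j\<close> is
  integrable. Where it is finite, with \<open>t\<close> the p-th root of \<open>ZZ x\<close>, the
  increments are at most \<open>t * (1/2) ^ j\<close>; so the sequence converges and stays below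
  \<open>2 * t\<close>.\<close>

lemma fast_Cauchy_limit:
  fixes f :: "nat \<Rightarrow> 'a \<Rightarrow> complex"
  assumes [measurable]: "\<And>j. f j \<in> borel_measurable M" and f0: "\<And>x. f 0 x = 0" and p: "p > 0" and K: "0 \<le> K"
    and fast: "\<And>j. (\<integral>\<^sup>+x. ennreal (norm (f (Suc j) x - f j x) ^ p) \<partial>M) \<le> ennreal (K * (1/2) ^ (j * (p + 1)))"
  obtains u Z where "u \<in> borel_measurable M" "integrable M Z" "\<And>x. 0 \<le> Z x"
    "AE x in M. (\<lambda>j. f j x) \<longlonglongrightarrow> u x" "AE x in M. \<forall>j. norm (f j x) ^ p \<le> Z x"
proof -
  define z where "z j x = (2 ^ j * norm (f (Suc j) x - f j x)) ^ p" for j x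
  have z0: "0 \<le> z j x" for j x by (simp add: z_def)
  have [measurable]: "z j \<in> borel_measurable M" for j unfolding z_def by measurable
  define ZZ where "ZZ x = (\<Sum>j. ennreal (z j x))" for x
  have [measurable]: "ZZ \<in> borel_measurable M" unfolding ZZ_def by measurable
  have zi: "(\<integral>\<^sup>+x. ennreal (z j x) \<partial>M) \<le> ennreal (K * (1/2) ^ j)" for j
  proof -
    have "(\<integral>\<^sup>+x. ennreal (z j x) \<partial>M) = (\<integral>\<^sup>+x. ennreal (2 ^ (j * p)) * ennreal (norm (f (Suc j) x - f j x) ^ p) \<partial>M)"
      by (simp add: z_def power_mult_distrib ennreal_mult power_mult)
    also have "\<dots> = ennreal (2 ^ (j * p)) * (\<integral>\<^sup>+x. ennreal (norm (f (Suc j) x - f j x) ^ p) \<partial>M)"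
      by (rule nn_integral_cmult) simp
    also have "\<dots> \<le> ennreal (2 ^ (j * p)) * ennreal (K * (1/2) ^ (j * (p + 1)))"
      by (intro mult_left_mono fast) simp
    also have "\<dots> = ennreal (K * (1/2) ^ j)"
      using K by (subst ennreal_mult[symmetric]) (auto simp: power_add field_simps)
    finally show ?thesis .
  qed
  have "(\<integral>\<^sup>+x. ZZ x \<partial>M) = (\<Sum>j. \<integral>\<^sup>+x. ennreal (z j x) \<partial>M)"
    unfolding ZZ_def by (rule nn_integral_suminf) simp
  also have "\<dots> \<le> (\<Sum>j. ennreal (K * (1/2) ^ j))"
    by (intro suminf_le zi) auto
  also have "\<dots> = ennreal (\<Sum>j. K * (1/2) ^ j)"
    using K by (intro suminf_ennreal2 summable_mult summable_geometric) auto
  finally have ZZi: "(\<integral>\<^sup>+x. ZZ x \<partial>M) < \<infinity>" by (auto intro: le_less_trans)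
  then have ZZfin: "AE x in M. ZZ x \<noteq> \<infinity>"
    by (intro nn_integral_PInf_AE) auto
  define Z where "Z x = 2 ^ p * enn2real (ZZ x)" for x
  have Zi: "integrable M Z"
  proof -
    have "(\<integral>\<^sup>+x. ennreal (enn2real (ZZ x)) \<partial>M) = (\<integral>\<^sup>+x. ZZ x \<partial>M)"
      by (rule nn_integral_cong_AE) (use ZZfin in \<open>eventually_elim, auto simp: less_top\<close>)
    then have "integrable M (\<lambda>x. enn2real (ZZ x))"
      using ZZi by (auto simp: integrable_iff_bounded)
    then show ?thesis unfolding Z_def[abs_def] by (rule integrable_mult_right)
  qed
  have key: "summable (\<lambda>j. norm (f (Suc j) x - f j x)) \<and> (\<forall>j. norm (f j x) ^ p \<le> Z x)" if fin: "ZZ x \<noteq> \<infinity>" for x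
  proof -
    define t where "t = root p (enn2real (ZZ x))"
    have t0: "0 \<le> t" using p by (simp add: t_def)
    have le: "norm (f (Suc j) x - f j x) \<le> t * (1/2) ^ j" for j
    proof -
      have "ennreal (z j x) \<le> ZZ x"
        unfolding ZZ_def using sum_le_suminf[of "\<lambda>j. ennreal (z j x)" "{j}"] by simp
      then have "z j x \<le> enn2real (ZZ x)"
        using fin z0[of j x] by (cases "ZZ x") auto
      then have "root p (z j x) \<le> t" unfolding t_def using p by simp
      moreover have "root p (z j x) = 2 ^ j * norm (f (Suc j) x - f j x)"
        unfolding z_def by (rule real_root_power_cancel[OF p]) simp
      ultimately show ?thesis by (simp add: power_one_over field_simps)
    qed
    have sm: "summable (\<lambda>j. t * (1/2) ^ j)" by (intro summable_mult summable_geometric) auto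
    have 1: "summable (\<lambda>j. norm (f (Suc j) x - f j x))"
      by (rule summable_comparison_test[OF _ sm]) (auto intro!: exI[of _ 0] le)
    have 2: "norm (f j x) \<le> 2 * t" for j
    proof -
      have "f j x = (\<Sum>i<j. f (Suc i) x - f i x)"
        using sum_lessThan_telescope[of "\<lambda>i. f i x" j] f0 by simp
      then have "norm (f j x) \<le> (\<Sum>i<j. norm (f (Suc i) x - f i x))"
        by (metis norm_sum)
      also have "\<dots> \<le> (\<Sum>i<j. t * (1/2) ^ i)" by (intro sum_mono le)
      also have "\<dots> \<le> (\<Sum>i. t * (1/2) ^ i)" by (rule sum_le_suminf[OF sm]) (use t0 in auto)
      also have "\<dots> = 2 * t" by (subst suminf_mult) (auto simp: suminf_geometric)
      finally show ?thesis .
    qed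
    have "norm (f j x) ^ p \<le> Z x" for j
    proof -
      have "norm (f j x) ^ p \<le> (2 * t) ^ p" by (intro power_mono 2) simp
      also have "\<dots> = Z x" using p by (simp add: Z_def t_def power_mult_distrib real_root_pow_pos2)
      finally show ?thesis .
    qed
    with 1 show ?thesis by auto
  qed
  define u where "u x = lim (\<lambda>j. f j x)" for x
  show thesis
  proof
    show "u \<in> borel_measurable M" unfolding u_def by (rule borel_measurable_lim_metric) simp
    show "integrable M Z" by (rule Zi)
    show "0 \<le> Z x" for x by (simp add: Z_def)
    show "AE x in M. (\<lambda>j. f j x) \<longlonglongrightarrow> u x"
      using ZZfin
    proof eventually_elim
      case (elim x)
      then have "summable (\<lambda>j. norm (f (Suc j) x - f j x))"
        using key by blast
      then have "(\<lambda>m. \<Sum>i<m. f (Suc i) x - f i x) \<longlonglongrightarrow> (\<Sum>i. f (Suc i) x - f i x)"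
        by (rule summable_LIMSEQ[OF summable_norm_cancel])
      moreover have "(\<Sum>i<m. f (Suc i) x - f i x) = f m x" for m
        using sum_lessThan_telescope[of "\<lambda>i. f i x" m] f0 by simp
      ultimately have "convergent (\<lambda>j. f j x)"
        unfolding convergent_def by auto
      then show ?case unfolding u_def by (simp add: convergent_LIMSEQ_iff)
    qed
    show "AE x in M. \<forall>j. norm (f j x) ^ p \<le> Z x"
      using ZZfin by eventually_elim (use key in auto)
  qed
qed

section \<open>Pairing with the transforms of bounded integrable functions\<close>

lemma powr_Suc_over:
  assumes "0 \<le> a" "n > 0"
  shows "a powr (real (Suc n) / real n) = a * a powr (1 / real n)"
proof (cases "a = 0")
  case False
  have "real (Suc n) / real n = 1 + 1 / real n" using assms by (simp add: field_simps)
  then have "a powr (real (Suc n) / real n) = a powr (1 + 1 / real n)" by (simp only:)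
  also have "\<dots> = a * a powr (1 / real n)" using assms False by (simp add: powr_add)
  finally show ?thesis .
qed simp

text \<open>One of the two terms alone suffices: the first if \<open>b \<le> a powr (1 / n)\<close>,
  the second otherwise, since then \<open>a \<le> b ^ n\<close>.\<close>

lemma Young_product_bound:
  fixes a b :: real
  assumes "0 \<le> a" "0 \<le> b" and n: "n > 0"
  shows "a * b \<le> a powr (real (Suc n) / real n) + b ^ Suc n"
proof (cases "b \<le> a powr (1 / real n)")
  case True
  then have "a * b \<le> a powr (real (Suc n) / real n)"
    using assms by (simp add: powr_Suc_over mult_left_mono del: of_nat_Suc)
  then show ?thesis using assms by (simp add: add_increasing2 del: of_nat_Suc)
next
  case False
  then have "(a powr (1 / real n)) ^ n \<le> b ^ n" by (intro power_mono) auto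
  moreover have "(a powr (1 / real n)) ^ n = a"
    using assms powr_power[of a "1 / real n" n] by (cases "a = 0") auto
  ultimately have "a * b \<le> b ^ n * b" using assms by (intro mult_right_mono) auto
  then have "a * b \<le> b ^ Suc n" by (simp only: power_Suc2)
  then show ?thesis using assms by (simp add: add_increasing del: of_nat_Suc power_Suc)
qed

lemma bounded_integrable_powr:
  fixes \<phi> :: "'a::euclidean_space \<Rightarrow> complex"
  assumes \<phi>: "integrable lborel \<phi>" and B: "\<And>x. norm (\<phi> x) \<le> B" and n: "n > 0"
  shows "(\<integral>\<^sup>+x. ennreal (norm (\<phi> x) powr (real (Suc n) / real n)) \<partial>lborel) < \<infinity>"
proof -
  have "(\<integral>\<^sup>+x. ennreal (norm (\<phi> x) powr (real (Suc n) / real n)) \<partial>lborel) \<le> (\<integral>\<^sup>+x. ennreal (B powr (1 / real n) * norm (\<phi> x)) \<partial>lborel)"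
    using n by (intro nn_integral_mono ennreal_leI)
      (auto simp: powr_Suc_over mult.commute[of "norm _"] simp del: of_nat_Suc intro!: mult_right_mono powr_mono2 B)
  also have "\<dots> = ennreal (\<integral>x. B powr (1 / real n) * norm (\<phi> x) \<partial>lborel)"
    using \<phi> by (intro nn_integral_eq_integral) auto
  also have "\<dots> < \<infinity>" by simp
  finally show ?thesis .
qed

text \<open>A bounded integrable \<open>\<phi>\<close> lies in L^q with q = (n + 1) / n, so its
  transform lies in L^(n + 1), the dual space of the one containing \<open>h\<close>.\<close>

lemma integrable_mult_fourier:
  fixes h \<phi> :: "'a::euclidean_space \<Rightarrow> complex"
  assumes [measurable]: "h \<in> borel_measurable borel"
    and n: "odd n" and fin: "(\<integral>\<^sup>+x. ennreal (norm (h x) powr (real (Suc n) / real n)) \<partial>lborel) < \<infinity>"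
    and \<phi>: "integrable lborel \<phi>" and B: "\<And>x. norm (\<phi> x) \<le> B"
  shows "integrable lborel (\<lambda>x. h x * fourier \<phi> x)"
proof -
  have n0: "n > 0" using n by (auto intro: Nat.gr0I)
  have [measurable]: "\<phi> \<in> borel_measurable borel" using \<phi> by auto
  have f2: "(\<integral>\<^sup>+x. ennreal (norm (fourier \<phi> x) ^ Suc n) \<partial>lborel) < \<infinity>"
    using nn_integral_norm_fourier_power_le[OF \<phi> n] bounded_integrable_powr[OF \<phi> B n0]
    by (auto intro: le_less_trans simp: power_less_top_ennreal)
  have "(\<integral>\<^sup>+x. ennreal (norm (h x * fourier \<phi> x)) \<partial>lborel) \<le>
    (\<integral>\<^sup>+x. ennreal (norm (h x) powr (real (Suc n) / real n)) + ennreal (norm (fourier \<phi> x) ^ Suc n) \<partial>lborel)"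
    by (intro nn_integral_mono) (auto simp: norm_mult ennreal_plus[symmetric] simp del: ennreal_plus of_nat_Suc power_Suc
        intro!: ennreal_leI Young_product_bound n0)
  also have "\<dots> = (\<integral>\<^sup>+x. ennreal (norm (h x) powr (real (Suc n) / real n)) \<partial>lborel) + (\<integral>\<^sup>+x. ennreal (norm (fourier \<phi> x) ^ Suc n) \<partial>lborel)"
    by (rule nn_integral_add) auto
  also have "\<dots> < \<infinity>" using fin f2 by (simp del: of_nat_Suc power_Suc)
  finally show ?thesis by (simp add: integrable_iff_bounded)
qed

section \<open>Truncation in space and in height\<close>

definition trunc :: "nat \<Rightarrow> ('a::euclidean_space \<Rightarrow> complex) \<Rightarrow> 'a \<Rightarrow> complex" where
  "trunc R h x = (if norm x \<le> real R \<and> norm (h x) \<le> real R then h x else 0)"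

lemma trunc_measurable [measurable]:
  assumes [measurable]: "h \<in> borel_measurable borel"
  shows "trunc R h \<in> borel_measurable borel"
  unfolding trunc_def[abs_def] by measurable

lemma norm_trunc_le: "norm (trunc R h x) \<le> norm (h x)" "norm (trunc R h x) \<le> real R"
  by (auto simp: trunc_def)

lemma integrable_trunc:
  assumes [measurable]: "h \<in> borel_measurable borel"
  shows "integrable lborel (trunc R h)"
proof (rule Bochner_Integration.integrable_bound)
  show "integrable lborel (\<lambda>x::'a. real R * indicator (cball 0 (real R)) x)"
    by (intro integrable_mult_right integrable_real_indicator emeasure_bounded_finite) auto
qed (auto simp: trunc_def indicator_def)

lemma trunc_eventually_eq: "eventually (\<lambda>R. trunc R h x = h x) sequentially"
proof -
  have "eventually (\<lambda>R. real R > norm x + norm (h x)) sequentially"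
    using filterlim_real_sequentially by (simp add: filterlim_at_top_dense)
  then show ?thesis
  proof eventually_elim
    case (elim R)
    then have "norm x \<le> real R" "norm (h x) \<le> real R"
      using norm_ge_zero[of x] norm_ge_zero[of "h x"] by linarith+
    then show ?case by (simp add: trunc_def)
  qed
qed

lemma tail_powr_tendsto_0:
  fixes h :: "'a::euclidean_space \<Rightarrow> complex"
  assumes [measurable]: "h \<in> borel_measurable borel" and q: "q > 0"
    and fin: "(\<integral>\<^sup>+x. ennreal (norm (h x) powr q) \<partial>lborel) < \<infinity>"
  shows "(\<lambda>R. \<integral>\<^sup>+x. ennreal (norm (h x - trunc R h x) powr q) \<partial>lborel) \<longlonglongrightarrow> 0"
proof -
  have "(\<lambda>R. \<integral>\<^sup>+x. ennreal (norm (h x - trunc R h x) powr q) \<partial>lborel) \<longlonglongrightarrow> (\<integral>\<^sup>+x. 0 \<partial>(lborel :: 'a measure))"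
  proof (rule nn_integral_dominated_convergence[where w="\<lambda>x. ennreal (norm (h x) powr q)"])
    show "AE x in lborel. (\<lambda>R. ennreal (norm (h x - trunc R h x) powr q)) \<longlonglongrightarrow> 0"
    proof (rule AE_I2)
      fix x
      have "eventually (\<lambda>R. ennreal (norm (h x - trunc R h x) powr q) = 0) sequentially"
        using trunc_eventually_eq[of h x] by eventually_elim simp
      then show "(\<lambda>R. ennreal (norm (h x - trunc R h x) powr q)) \<longlonglongrightarrow> 0" by (rule tendsto_eventually)
    qed
    show "AE x in lborel. ennreal (norm (h x - trunc R h x) powr q) \<le> ennreal (norm (h x) powr q)" for R
      by (auto intro!: AE_I2 ennreal_leI powr_mono2 simp: trunc_def less_imp_le[OF q])
  qed (use fin in auto)
  then show ?thesis by simp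
qed

text \<open>The truncations of \<open>h\<close> are bounded and integrable, so the exact formula for
  the norm holds for them. Taking them along a rapidly growing sequence makes their transforms
  converge almost everywhere under a majorant; the limit \<open>u\<close> inherits both identities.
  The convolution integrands of the truncations are dominated by that of \<open>h\<close>, which is
  integrable by the estimate in L^q.\<close>

lemma Hausdorff_Young_even:
  fixes h :: "'a::euclidean_space \<Rightarrow> complex"
  assumes h[measurable]: "h \<in> borel_measurable borel" and n: "odd n"
    and fin: "(\<integral>\<^sup>+x. ennreal (norm (h x) powr (real (Suc n) / real n)) \<partial>lborel) < \<infinity>"
  obtains u where "u \<in> borel_measurable borel"
    "(\<integral>\<^sup>+x. ennreal (norm (u x) ^ Suc n) \<partial>lborel) = ennreal (Re (conv_form n (alt_reflect h) 0))"
    "\<And>\<phi> B. integrable lborel \<phi> \<Longrightarrow> (\<And>x. norm (\<phi> x) \<le> B) \<Longrightarrow> (\<integral>x. u x * \<phi> x \<partial>lborel) = (\<integral>x. h x * fourier \<phi> x \<partial>lborel)"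
proof -
  define q where "q = real (Suc n) / real n"
  define p where "p = Suc n"
  have n0: "n > 0" using n by (auto intro: Nat.gr0I)
  have q0: "q > 0" unfolding q_def using n0 by simp
  have p0: "p > 0" by (simp add: p_def)
  define E where "E R = (\<integral>\<^sup>+x. ennreal (norm (h x - trunc R h x) powr q) \<partial>lborel)" for R
  have Elim: "E \<longlonglongrightarrow> 0" unfolding E_def
    by (rule tail_powr_tendsto_0) (use q0 fin in \<open>auto simp: q_def\<close>)
  \<comment> \<open>The exponent has \<open>Suc j\<close> because, for \<open>j = Suc i\<close>, the
    increment from \<open>g j\<close> to \<open>g (Suc j)\<close> is controlled by the tail beyond
    \<open>N i\<close>, one index lower.\<close>
  have "\<exists>r. \<forall>R\<ge>r. E R < ennreal ((1/2) ^ (Suc j * (p + 1)))" for j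
    using order_tendstoD(2)[OF Elim, of "ennreal ((1/2) ^ (Suc j * (p + 1)))"] by (auto simp: eventually_sequentially)
  then obtain r where r: "\<And>j R. R \<ge> r j \<Longrightarrow> E R < ennreal ((1/2) ^ (Suc j * (p + 1)))" by metis
  \<comment> \<open>Partial sums of \<open>Suc (r i)\<close> dominate \<open>r j\<close>, increase
    with \<open>j\<close> and are at least \<open>j\<close>, so the truncations grow monotonically
    and exhaust \<open>h\<close>.\<close>
  define N where "N j = (\<Sum>i\<le>j. Suc (r i))" for j
  have Nr: "r j \<le> N j" for j unfolding N_def using member_le_sum[of j "{..j}" "\<lambda>i. Suc (r i)"] by simp
  have NSuc: "N j \<le> N (Suc j)" for j by (simp add: N_def)
  have Nge: "j \<le> N j" for j unfolding N_def using sum_mono[of "{..j}" "\<lambda>_. 1" "\<lambda>i. Suc (r i)"] by simp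
  have Nlim: "filterlim N at_top sequentially"
    by (rule filterlim_at_top_mono[OF filterlim_ident]) (simp add: Nge)
  \<comment> \<open>The sequence starts with the zero function, as the telescoping sums in
    \<open>fast_Cauchy_limit\<close> require.\<close>
  define g where "g j = (case j of 0 \<Rightarrow> (\<lambda>_. 0) | Suc i \<Rightarrow> trunc (N i) h)" for j
  have gm[measurable]: "g j \<in> borel_measurable borel" for j by (cases j) (auto simp: g_def)
  have gi: "integrable lborel (g j)" for j by (cases j) (auto simp: g_def intro: integrable_trunc)
  have gle: "norm (g j x) \<le> norm (h x)" for j x by (cases j) (auto simp: g_def norm_trunc_le)
  have gb: "\<exists>C. \<forall>x. norm (g j x) \<le> C" for j by (cases j) (auto simp: g_def intro: norm_trunc_le)
  have glim: "eventually (\<lambda>j. g j x = h x) sequentially" for x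
  proof -
    have "eventually (\<lambda>j. trunc (N j) h x = h x) sequentially"
      using filterlim_iff[THEN iffD1, OF Nlim] trunc_eventually_eq[of h x] by blast
    then have "eventually (\<lambda>j. g (Suc j) x = h x) sequentially" by (simp add: g_def)
    then show ?thesis by (rule eventually_sequentially_Suc[THEN iffD1])
  qed
  define f where "f j = fourier (g j)" for j
  have [measurable]: "f j \<in> borel_measurable borel" for j unfolding f_def by measurable
  obtain s where s: "(\<integral>\<^sup>+x. ennreal (norm (h x) powr q) \<partial>lborel) = ennreal s" "0 \<le> s"
    using fin unfolding q_def by (cases "\<integral>\<^sup>+x. ennreal (norm (h x) powr (real (Suc n) / real n)) \<partial>lborel") auto
  \<comment> \<open>In the constant \<open>s ^ n + 1\<close>, the term \<open>s ^ n\<close> pays for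
    the increment at \<open>j = 0\<close>, which is a whole truncation and not small; the 1 is
    enough for all later increments.\<close>
  have fast: "(\<integral>\<^sup>+x. ennreal (norm (f (Suc j) x - f j x) ^ p) \<partial>lborel) \<le> ennreal ((s ^ n + 1) * (1/2) ^ (j * (p + 1)))" for j
  proof -
    have "f (Suc j) x - f j x = fourier (\<lambda>y. g (Suc j) y - g j y) x" for x
      unfolding f_def fourier_def
      by (subst Bochner_Integration.integral_diff[symmetric]) (auto intro!: integrable_cis_mult gi simp: right_diff_distrib)
    then have 1: "(\<integral>\<^sup>+x. ennreal (norm (f (Suc j) x - f j x) ^ p) \<partial>lborel) \<le>
        (\<integral>\<^sup>+x. ennreal (norm (g (Suc j) x - g j x) powr q) \<partial>lborel) ^ n"
      using nn_integral_norm_fourier_power_le[OF Bochner_Integration.integrable_diff[OF gi gi] n]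
      by (simp only: p_def q_def)
    show ?thesis
    proof (cases j)
      case 0
      have "(\<integral>\<^sup>+x. ennreal (norm (g (Suc j) x - g j x) powr q) \<partial>lborel) \<le> ennreal s"
        unfolding s(1)[symmetric]
        by (intro nn_integral_mono ennreal_leI powr_mono2) (auto simp: 0 g_def norm_trunc_le less_imp_le[OF q0])
      then have "(\<integral>\<^sup>+x. ennreal (norm (g (Suc j) x - g j x) powr q) \<partial>lborel) ^ n \<le> ennreal s ^ n"
        by (rule power_mono) simp
      also have "\<dots> = ennreal (s ^ n)" using s by (simp add: ennreal_power)
      also have "\<dots> \<le> ennreal ((s ^ n + 1) * (1/2) ^ (j * (p + 1)))" by (intro ennreal_leI) (simp add: 0)
      finally show ?thesis using 1 by (rule order_trans[rotated])
    next
      case (Suc i)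
      have "(\<integral>\<^sup>+x. ennreal (norm (g (Suc j) x - g j x) powr q) \<partial>lborel) \<le> E (N i)"
        unfolding E_def
      proof (intro nn_integral_mono ennreal_leI powr_mono2)
        fix x
        have "real (N i) \<le> real (N (Suc i))" using NSuc[of i] by simp
        then show "norm (g (Suc j) x - g j x) \<le> norm (h x - trunc (N i) h x)"
          by (auto simp: Suc g_def trunc_def)
      qed (use q0 in auto)
      also have "E (N i) \<le> ennreal ((1/2) ^ (j * (p + 1)))"
        using r[OF Nr[of i]] by (simp add: Suc)
      finally have "(\<integral>\<^sup>+x. ennreal (norm (g (Suc j) x - g j x) powr q) \<partial>lborel) ^ n \<le> ennreal ((1/2) ^ (j * (p + 1))) ^ n"
        by (rule power_mono) simp
      also have "\<dots> = ennreal (((1/2) ^ (j * (p + 1))) ^ n)" by (simp add: ennreal_power)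
      also have "\<dots> \<le> ennreal ((s ^ n + 1) * (1/2) ^ (j * (p + 1)))"
      proof (rule ennreal_leI)
        let ?t = "(1/2::real) ^ (j * (p + 1))"
        have "?t ^ n \<le> ?t ^ 1" using n0 by (intro power_decreasing) (auto intro: power_le_one)
        also have "\<dots> \<le> (s ^ n + 1) * ?t" using s by (simp add: algebra_simps)
        finally show "?t ^ n \<le> (s ^ n + 1) * ?t" .
      qed
      finally show ?thesis using 1 by (rule order_trans[rotated])
    qed
  qed
  have f00: "f 0 x = 0" for x by (simp add: f_def g_def fourier_def)
  obtain u Z where u: "u \<in> borel_measurable lborel" and Z: "integrable lborel Z" "\<And>x. 0 \<le> Z x"
    and lim: "AE x in lborel. (\<lambda>j. f j x) \<longlonglongrightarrow> u x" and dom: "AE x in lborel. \<forall>j. norm (f j x) ^ p \<le> Z x"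
    by (rule fast_Cauchy_limit[of f lborel p "s ^ n + 1", OF _ f00 p0 _ fast]) (use s in simp_all)
  have [measurable]: "u \<in> borel_measurable borel" using u by simp
  have Zm[measurable]: "Z \<in> borel_measurable borel" using Z by auto
  show thesis
  proof
    show "u \<in> borel_measurable borel" by simp
    have "(\<lambda>j. \<integral>\<^sup>+x. ennreal (norm (f j x) ^ p) \<partial>lborel) \<longlonglongrightarrow> (\<integral>\<^sup>+x. ennreal (norm (u x) ^ p) \<partial>lborel)"
    proof (rule nn_integral_dominated_convergence[where w="\<lambda>x. ennreal (Z x)"])
      show "AE x in lborel. (\<lambda>j. ennreal (norm (f j x) ^ p)) \<longlonglongrightarrow> ennreal (norm (u x) ^ p)"
        using lim by eventually_elim (intro tendsto_intros)
      show "AE x in lborel. ennreal (norm (f j x) ^ p) \<le> ennreal (Z x)" for j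
        using dom by eventually_elim (auto intro: ennreal_leI)
      show "(\<integral>\<^sup>+x. ennreal (Z x) \<partial>lborel) < \<infinity>"
        using Z by (simp add: nn_integral_eq_integral)
    qed auto
    moreover have "(\<integral>\<^sup>+x. ennreal (norm (f j x) ^ p) \<partial>lborel) = ennreal (Re (conv_form n (alt_reflect (g j)) 0))" for j
    proof -
      obtain C where "\<And>x. norm (g j x) \<le> C" using gb by blast
      from nn_integral_norm_fourier_power_eq[OF gi n this] show ?thesis by (simp only: f_def p_def)
    qed
    moreover have "(\<lambda>j. conv_form n (alt_reflect (g j)) 0) \<longlonglongrightarrow> conv_form n (alt_reflect h) 0"
      unfolding conv_form_def
    proof (rule integral_dominated_convergence[where w="\<lambda>x. norm (conv_integrand n (alt_reflect h) 0 x)"])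
      have "(\<integral>\<^sup>+x. ennreal (norm (conv_integrand n (alt_reflect h) 0 x)) \<partial>lborel_pow {..<n}) \<le> ennreal s ^ n"
        by (rule nn_integral_conv_integrand_le[OF _ n0])
           (use s in \<open>auto simp: nn_integral_alt_reflect q_def simp del: of_nat_Suc\<close>)
      then have "integrable (lborel_pow {..<n}) (conv_integrand n (alt_reflect h) 0)"
        using s by (auto simp: integrable_iff_bounded ennreal_power intro: le_less_trans)
      then show "integrable (lborel_pow {..<n}) (\<lambda>x. norm (conv_integrand n (alt_reflect h) 0 x))"
        by simp
      have alt: "(\<lambda>j. alt_reflect (g j) i y) \<longlonglongrightarrow> alt_reflect h i y" for i y
        unfolding alt_reflect_def by (auto intro!: tendsto_cnj tendsto_eventually glim)
      show "AE x in lborel_pow {..<n}. (\<lambda>j. conv_integrand n (alt_reflect (g j)) 0 x) \<longlonglongrightarrow> conv_integrand n (alt_reflect h) 0 x"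
        unfolding conv_integrand_def by (intro AE_I2 tendsto_intros alt)
      have altle: "norm (alt_reflect (g j) i y) \<le> norm (alt_reflect h i y)" for j i y
        using gle by (auto simp: alt_reflect_def)
      show "AE x in lborel_pow {..<n}. norm (conv_integrand n (alt_reflect (g j)) 0 x) \<le> norm (conv_integrand n (alt_reflect h) 0 x)" for j
        unfolding conv_integrand_def norm_mult prod_norm[symmetric]
        by (intro AE_I2 mult_mono prod_mono altle conjI prod_nonneg norm_ge_zero)
    qed auto
    then have "(\<lambda>j. ennreal (Re (conv_form n (alt_reflect (g j)) 0))) \<longlonglongrightarrow> ennreal (Re (conv_form n (alt_reflect h) 0))"
      by (intro tendsto_intros)
    ultimately show "(\<integral>\<^sup>+x. ennreal (norm (u x) ^ Suc n) \<partial>lborel) = ennreal (Re (conv_form n (alt_reflect h) 0))"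
      unfolding p_def by (metis (no_types, lifting) LIMSEQ_unique ext)
  next
    fix \<phi> :: "'a \<Rightarrow> complex" and B
    assume \<phi>: "integrable lborel \<phi>" and B: "\<And>x. norm (\<phi> x) \<le> B"
    have [measurable]: "\<phi> \<in> borel_measurable borel" using \<phi> by auto
    have B0: "0 \<le> B" using order_trans[OF norm_ge_zero B] .
    have "(\<lambda>j. \<integral>x. f j x * \<phi> x \<partial>lborel) \<longlonglongrightarrow> (\<integral>x. u x * \<phi> x \<partial>lborel)"
    proof (rule integral_dominated_convergence[where w="\<lambda>x. norm (\<phi> x) + Z x * B"])
      show "integrable lborel (\<lambda>x. norm (\<phi> x) + Z x * B)" using \<phi> Z by auto
      show "AE x in lborel. (\<lambda>j. f j x * \<phi> x) \<longlonglongrightarrow> u x * \<phi> x"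
        using lim by eventually_elim (intro tendsto_intros)
      show "AE x in lborel. norm (f j x * \<phi> x) \<le> norm (\<phi> x) + Z x * B" for j
        using dom
      proof eventually_elim
        case (elim x)
        \<comment> \<open>The majorant \<open>Z\<close> controls p-th powers only. This inequality
          makes it control \<open>f j x\<close> linearly, at the price of a constant that is
          integrable against \<open>\<phi>\<close>.\<close>
        have "norm (f j x) \<le> 1 + norm (f j x) ^ p"
        proof (cases "norm (f j x) \<le> 1")
          case False
          then have "norm (f j x) ^ 1 \<le> norm (f j x) ^ p" using p0 by (intro power_increasing) auto
          then show ?thesis by simp
        qed (simp add: add_increasing2)
        then have "norm (f j x) \<le> 1 + Z x" using elim by (meson add_left_mono order_trans)
        then have "norm (f j x * \<phi> x) \<le> (1 + Z x) * norm (\<phi> x)"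
          unfolding norm_mult by (rule mult_right_mono) simp
        also have "\<dots> \<le> norm (\<phi> x) + Z x * B"
          using mult_left_mono[OF B[of x] Z(2)[of x]] by (simp add: algebra_simps)
        finally show ?case .
      qed
    qed auto
    moreover have "(\<lambda>j. \<integral>x. g j x * fourier \<phi> x \<partial>lborel) \<longlonglongrightarrow> (\<integral>x. h x * fourier \<phi> x \<partial>lborel)"
    proof (rule integral_dominated_convergence[where w="\<lambda>x. norm (h x * fourier \<phi> x)"])
      show "integrable lborel (\<lambda>x. norm (h x * fourier \<phi> x))"
        using integrable_mult_fourier[OF h n fin \<phi> B] by (rule integrable_norm)
      show "AE x in lborel. (\<lambda>j. g j x * fourier \<phi> x) \<longlonglongrightarrow> h x * fourier \<phi> x"
        by (intro AE_I2 tendsto_intros tendsto_eventually glim)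
      show "AE x in lborel. norm (g j x * fourier \<phi> x) \<le> norm (h x * fourier \<phi> x)" for j
        unfolding norm_mult by (intro AE_I2 mult_right_mono gle) simp
    qed auto
    moreover have "(\<integral>x. f j x * \<phi> x \<partial>lborel) = (\<integral>x. g j x * fourier \<phi> x \<partial>lborel)" for j
      unfolding f_def by (rule fourier_multiplication_formula[OF gi \<phi>])
    ultimately show "(\<integral>x. u x * \<phi> x \<partial>lborel) = (\<integral>x. h x * fourier \<phi> x \<partial>lborel)"
      by (simp add: LIMSEQ_unique)
  qed
qed

subsection \<open>The equality case\<close>

text \<open>A rectangle whose sides have positive measure has positive product measure, so it is not
  contained in the exceptional null set. This turns statements holding almost everywhere into points
  placed as desired.\<close>

lemma AE_lborel_pow_rectangle:
  fixes A :: "nat \<Rightarrow> 'a::euclidean_space set"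
  assumes P: "AE x in lborel_pow I. P x" and I: "finite I"
    and A[measurable]: "\<And>i. i \<in> I \<Longrightarrow> A i \<in> sets borel" and pos: "\<And>i. i \<in> I \<Longrightarrow> emeasure lborel (A i) \<noteq> 0"
  obtains x where "x \<in> Pi\<^sub>E I A" "P x"
proof (cases "\<exists>x\<in>Pi\<^sub>E I A. P x")
  case False
  have sets: "Pi\<^sub>E I A \<in> sets (lborel_pow I)"
    using I A by (intro sets_PiM_I_finite) auto
  have "AE x in lborel_pow I. x \<notin> Pi\<^sub>E I A"
    using P by eventually_elim (use False in auto)
  then have "emeasure (lborel_pow I) (Pi\<^sub>E I A) = 0"
    using sets by (simp add: AE_iff_null_sets[symmetric] null_setsD1)
  moreover have "emeasure (lborel_pow I) (Pi\<^sub>E I A) = (\<Prod>i\<in>I. emeasure lborel (A i))"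
    using I A by (intro lborel_prod.emeasure_PiM) auto
  ultimately show thesis using pos I by simp
qed (use that in auto)

lemma emeasure_lborel_open_pos:
  fixes S :: "'a::euclidean_space set"
  assumes "open S" "S \<noteq> {}"
  shows "emeasure lborel S \<noteq> 0"
proof -
  obtain x where "x \<in> S" using assms by auto
  then obtain a b where ab: "x \<in> box a b" "box a b \<subseteq> S" using assms open_contains_box by metis
  then have "a \<bullet> i < b \<bullet> i" if "i \<in> Basis" for i using that by (auto simp: mem_box intro: less_trans)
  then have "emeasure lborel (box a b) = ennreal (\<Prod>i\<in>Basis. (b - a) \<bullet> i)"
    by (subst emeasure_lborel_box) (auto intro: less_imp_le)
  moreover have "0 < (\<Prod>i\<in>Basis. (b - a) \<bullet> i)"
    using \<open>\<And>i. i \<in> Basis \<Longrightarrow> a \<bullet> i < b \<bullet> i\<close> by (intro prod_pos) (auto simp: inner_diff_left)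
  ultimately have "emeasure lborel (box a b) > 0" by simp
  also have "emeasure lborel (box a b) \<le> emeasure lborel S"
    using ab assms by (intro emeasure_mono) auto
  finally show ?thesis by simp
qed

lemma AE_eq_continuous:
  fixes f g :: "'a::euclidean_space \<Rightarrow> complex"
  assumes "AE x in lborel. f x = g x" and f: "continuous_on UNIV f" and g: "continuous_on UNIV g"
  shows "f = g"
proof (rule ccontr)
  assume "f \<noteq> g"
  then have ne: "{x. f x \<noteq> g x} \<noteq> {}" by auto
  have op: "open {x. f x \<noteq> g x}" using f g by (rule open_Collect_neq)
  then have "emeasure lborel {x. f x \<noteq> g x} = 0"
    using assms(1) by (simp add: AE_iff_measurable[OF _ refl])
  then show False using emeasure_lborel_open_pos[OF op ne] by simp
qed

lemma integrable_conv_integrand_alt: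
  fixes h :: "'a::euclidean_space \<Rightarrow> complex"
  assumes [measurable]: "h \<in> borel_measurable borel" and n: "odd n"
    and fin: "(\<integral>\<^sup>+x. ennreal (norm (h x) powr (real (Suc n) / real n)) \<partial>lborel) < \<infinity>"
  shows "integrable (lborel_pow {..<n}) (conv_integrand n (alt_reflect h) y)"
proof -
  have n0: "n > 0" using n by (auto intro: Nat.gr0I)
  have "(\<integral>\<^sup>+x. ennreal (norm (conv_integrand n (alt_reflect h) y x)) \<partial>lborel_pow {..<n}) \<le>
     (\<integral>\<^sup>+x. ennreal (norm (h x) powr (real (Suc n) / real n)) \<partial>lborel) ^ n"
    by (rule nn_integral_conv_integrand_le[OF _ n0]) (auto simp: nn_integral_alt_reflect simp del: of_nat_Suc)
  also have "\<dots> < \<infinity>" using fin by (simp add: power_less_top_ennreal)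
  finally show ?thesis by (simp add: integrable_iff_bounded)
qed

lemma norm_alt_reflect: "norm (alt_reflect h i x) = norm (h (if even i then x else - x))"
  by (simp add: alt_reflect_def)

lemma alt_reflect_of_real: "alt_reflect (\<lambda>x. of_real (B x)) i x = of_real (B (if even i then x else - x))"
  by (simp add: alt_reflect_def)

lemma conv_integrand_alt_of_real:
  "conv_integrand n (alt_reflect (\<lambda>x. complex_of_real (B x))) y x =
    of_real (conv_integrand n (\<lambda>i t. B (if even i then t else - t)) y x)"
  by (simp add: conv_integrand_def alt_reflect_of_real)

text \<open>The integrand for \<open>a\<close> is dominated in norm by the nonnegative one for
  \<open>B\<close>. If the integrals agree in real part, then \<open>Re (?b x) - Re (?a x)\<close>
  is nonnegative with integral 0. Thus \<open>Re (?a x) = norm (?a x)\<close> almost everywhere,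
  which leaves no room for an imaginary part.\<close>

lemma
  fixes a :: "'a::euclidean_space \<Rightarrow> complex" and B :: "'a \<Rightarrow> real"
  assumes [measurable]: "a \<in> borel_measurable borel" "B \<in> borel_measurable borel" and n: "odd n"
    and le: "\<And>x. norm (a x) \<le> B x"
    and fin: "(\<integral>\<^sup>+x. ennreal (B x powr (real (Suc n) / real n)) \<partial>lborel) < \<infinity>"
  shows norm_conv_form_alt_le:
      "norm (conv_form n (alt_reflect a) 0) \<le> Re (conv_form n (alt_reflect (\<lambda>x. of_real (B x))) 0)"
    and conv_form_equality_imp_AE_integrand:
      "Re (conv_form n (alt_reflect a) 0) = Re (conv_form n (alt_reflect (\<lambda>x. of_real (B x))) 0) \<Longrightarrow>
       AE x in lborel_pow {..<n}. conv_integrand n (alt_reflect a) 0 x = conv_integrand n (alt_reflect (\<lambda>x. of_real (B x))) 0 x"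
proof -
  let ?a = "conv_integrand n (alt_reflect a) 0" and ?b = "conv_integrand n (alt_reflect (\<lambda>x. complex_of_real (B x))) 0"
  have B0: "0 \<le> B x" for x using order_trans[OF norm_ge_zero le] .
  have "(\<integral>\<^sup>+x. ennreal (norm (a x) powr (real (Suc n) / real n)) \<partial>lborel) \<le> (\<integral>\<^sup>+x. ennreal (B x powr (real (Suc n) / real n)) \<partial>lborel)"
    by (intro nn_integral_mono ennreal_leI powr_mono2 le) auto
  then have ai: "integrable (lborel_pow {..<n}) ?a"
    using fin by (intro integrable_conv_integrand_alt n) (auto intro: le_less_trans)
  have bi: "integrable (lborel_pow {..<n}) ?b"
    using fin by (intro integrable_conv_integrand_alt n) (auto simp: B0)
  have nle: "norm (?a x) \<le> Re (?b x)" for x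
    unfolding conv_integrand_alt_of_real Re_complex_of_real
    unfolding conv_integrand_def norm_mult prod_norm[symmetric] norm_alt_reflect
    by (intro mult_mono prod_mono le conjI prod_nonneg norm_ge_zero B0)
  have "norm (conv_form n (alt_reflect a) 0) \<le> (\<integral>x. norm (?a x) \<partial>lborel_pow {..<n})"
    unfolding conv_form_def by (rule integral_norm_bound)
  also have "\<dots> \<le> (\<integral>x. Re (?b x) \<partial>lborel_pow {..<n})"
    by (intro integral_mono integrable_norm ai integrable_Re bi nle)
  also have "\<dots> = Re (conv_form n (alt_reflect (\<lambda>x. of_real (B x))) 0)"
    unfolding conv_form_def by (rule integral_Re[OF bi])
  finally show "norm (conv_form n (alt_reflect a) 0) \<le> Re (conv_form n (alt_reflect (\<lambda>x. of_real (B x))) 0)" .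
  assume eq: "Re (conv_form n (alt_reflect a) 0) = Re (conv_form n (alt_reflect (\<lambda>x. of_real (B x))) 0)"
  have "AE x in lborel_pow {..<n}. Re (?b x) - Re (?a x) = 0"
  proof (subst integral_nonneg_eq_0_iff_AE[symmetric])
    show "(\<integral>x. Re (?b x) - Re (?a x) \<partial>lborel_pow {..<n}) = 0"
      using eq ai bi by (simp add: conv_form_def integral_Re)
    show "AE x in lborel_pow {..<n}. 0 \<le> Re (?b x) - Re (?a x)"
      using nle complex_Re_le_cmod by (intro AE_I2) (meson diff_ge_0_iff_ge order_trans)
  qed (use ai bi in auto)
  then show "AE x in lborel_pow {..<n}. ?a x = ?b x"
  proof eventually_elim
    case (elim x)
    then have "Re (?a x) = norm (?a x)" using nle[of x] complex_Re_le_cmod[of "?a x"] by linarith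
    then have "?a x = of_real (Re (?a x))"
      using cmod_power2[of "?a x"] by (simp add: complex_eq_iff)
    also have "\<dots> = ?b x"
      using elim by (simp add: conv_integrand_alt_of_real)
    finally show ?case .
  qed
qed

text \<open>Countably many balls, centred at the points of a dense set, cover the space; if all of
  them met \<open>A\<close> in null sets, \<open>A\<close> would be null.\<close>

lemma positive_measure_local:
  fixes A :: "'a::euclidean_space set"
  assumes [measurable]: "A \<in> sets borel" and pos: "emeasure lborel A \<noteq> 0" and r: "r > 0"
  obtains z where "emeasure lborel (A \<inter> ball z r) \<noteq> 0"
proof (rule ccontr)
  assume neg: "\<not> thesis"
  obtain D :: "'a set" where D: "countable D" "\<And>X. open X \<Longrightarrow> X \<noteq> {} \<Longrightarrow> \<exists>d\<in>D. d \<in> X"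
    using countable_dense_setE by blast
  have "(\<Union>z\<in>D. A \<inter> ball z r) \<in> null_sets lborel"
    using neg that by (intro null_sets_UN' D) (auto simp: null_sets_def)
  moreover have "(\<Union>z\<in>D. A \<inter> ball z r) = A"
  proof -
    have "\<exists>d\<in>D. x \<in> ball d r" for x
      using D(2)[of "ball x r"] r by (auto simp: dist_commute)
    then show ?thesis by blast
  qed
  ultimately show False using pos by auto
qed

text \<open>
  If \<open>norm a < B\<close> on a set of positive measure, put two variables of opposite sign into a small
  piece of that set, so that their contributions to the sum nearly cancel, and the others near
  a point where \<open>a\<close> is nonzero.
\<close>
lemma AE_integrand_eq_imp_AE_norm_eq:
  fixes a :: "'a::euclidean_space \<Rightarrow> complex" and B :: "'a \<Rightarrow> real"
  assumes [measurable]: "a \<in> borel_measurable borel" "B \<in> borel_measurable borel" and n: "odd n" "n \<ge> 3"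
    and le: "\<And>x. norm (a x) \<le> B x"
    and eq: "AE x in lborel_pow {..<n}. conv_integrand n (alt_reflect a) 0 x = conv_integrand n (alt_reflect (\<lambda>x. of_real (B x))) 0 x"
    and r: "r > 0" "\<And>x. x \<in> ball c r \<Longrightarrow> a x \<noteq> 0"
  shows "AE x in lborel. norm (a x) = B x"
proof (rule ccontr)
  assume neg: "\<not> ?thesis"
  have B0: "0 \<le> B x" for x using order_trans[OF norm_ge_zero le] .
  define A where "A = {x. norm (a x) < B x}"
  have [measurable]: "A \<in> sets borel" unfolding A_def by measurable
  have "emeasure lborel A \<noteq> 0"
  proof
    assume "emeasure lborel A = 0"
    then have "AE x in lborel. x \<notin> A" by (intro AE_not_in) (auto simp: null_sets_def)
    then have "AE x in lborel. norm (a x) = B x"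
      by eventually_elim (use le in \<open>auto simp: A_def less_le\<close>)
    with neg show False by simp
  qed
  \<comment> \<open>The \<open>n\<close> deviations add up to less than \<open>r\<close>.\<close>
  define \<rho> where "\<rho> = r / real n"
  have \<rho>: "\<rho> > 0" using r n by (simp add: \<rho>_def)
  obtain z where z: "emeasure lborel (A \<inter> ball z \<rho>) \<noteq> 0"
    using positive_measure_local[OF _ \<open>emeasure lborel A \<noteq> 0\<close> \<rho>] by auto
  \<comment> \<open>Target points z, -z, c, -c, c, ...: the signs undo the reflections at odd
    indices, and for odd \<open>n \<ge> 3\<close> the first \<open>n\<close> targets sum to
    \<open>c\<close>.\<close>
  define t where "t i = (if even i then (if i < 2 then z else c) else - (if i < 2 then z else c))" for i :: nat
  define Q where "Q i = (if i < 2 then A \<inter> ball z \<rho> else ball c \<rho>)" for i :: nat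
  define X where "X i = {x. (if even i then x else - x) \<in> Q i}" for i
  have Qs[measurable]: "Q i \<in> sets borel" for i unfolding Q_def by auto
  have Qpos: "emeasure lborel (Q i) \<noteq> 0" for i
    using z emeasure_lborel_open_pos[of "ball c \<rho>"] \<rho> by (auto simp: Q_def)
  have [measurable]: "X i \<in> sets borel" for i unfolding X_def by (cases "even i") simp_all
  have Xpos: "emeasure lborel (X i) \<noteq> 0" for i
  proof -
    have "emeasure lborel (X i) = (\<integral>\<^sup>+x. indicator (X i) x \<partial>lborel)" by simp
    also have "\<dots> = (\<integral>\<^sup>+x. indicator (Q i) (if even i then 0 + x else 0 - x) \<partial>lborel)"
      by (intro nn_integral_cong) (auto simp: X_def indicator_def)
    also have "\<dots> = (\<integral>\<^sup>+x. indicator (Q i) x \<partial>lborel)"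
      using nn_integral_shift_reflect[of "indicator (Q i)" 0] by (cases "even i") simp_all
    also have "\<dots> = emeasure lborel (Q i)" by simp
    finally show ?thesis using Qpos by simp
  qed
  obtain x where x: "x \<in> Pi\<^sub>E {..<n} X"
    and xeq: "conv_integrand n (alt_reflect a) 0 x = conv_integrand n (alt_reflect (\<lambda>x. of_real (B x))) 0 x"
    by (rule AE_lborel_pow_rectangle[OF eq, of X]) (use Xpos in auto)
  define \<eta> where "\<eta> i = (if even i then x i else - x i)" for i
  have \<eta>: "\<eta> i \<in> Q i" if "i < n" for i using x that by (auto simp: PiE_iff X_def \<eta>_def)
  have t_sum: "(\<Sum>i<2 * m + 3. t i) = c" for m
  proof (induction m)
    case 0
    have "{..<3} = {0, 1, 2::nat}" by auto
    then show ?case by (simp add: t_def)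
  next
    case (Suc m)
    have "2 * Suc m + 3 = Suc (Suc (2 * m + 3))" by simp
    moreover have "t (2 * m + 3) + t (Suc (2 * m + 3)) = 0" by (simp add: t_def)
    ultimately show ?case using Suc by (simp only: sum.lessThan_Suc add.assoc) simp
  qed
  have "n = 2 * ((n - 3) div 2) + 3" using n by (auto elim!: oddE)
  then have t_sum_n: "(\<Sum>i<n. t i) = c" using t_sum[of "(n - 3) div 2"] by simp
  have xt: "norm (x i - t i) < \<rho>" if "i < n" for i
  proof -
    have "norm (\<eta> i - (if i < 2 then z else c)) < \<rho>"
      using \<eta>[OF that] by (auto simp: Q_def dist_norm norm_minus_commute split: if_splits)
    then show ?thesis by (auto simp: \<eta>_def t_def norm_minus_commute add.commute split: if_splits)
  qed
  \<comment> \<open>Since \<open>n\<close> is odd, the last factor is the conjugate of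
    \<open>a (- (0 - ?s)) = a ?s\<close>; staying close to the target sum keeps it nonzero.\<close>
  let ?s = "\<Sum>i<n. x i"
  have n0: "0 < n" using n by simp
  have "norm (?s - c) = norm (\<Sum>i<n. x i - t i)" by (simp add: sum_subtractf t_sum_n)
  also have "\<dots> \<le> (\<Sum>i<n. norm (x i - t i))" by (rule norm_sum)
  also have "\<dots> < (\<Sum>i<n. \<rho>)" using n0 xt by (intro sum_strict_mono) (auto simp: lessThan_empty_iff)
  also have "\<dots> = r" using n by (simp add: \<rho>_def)
  finally have sc: "?s \<in> ball c r" by (simp add: dist_norm norm_minus_commute)
  have Bpos: "0 < B (\<eta> i)" if "i < n" for i
  proof (cases "i < 2")
    case True
    then have "norm (a (\<eta> i)) < B (\<eta> i)" using \<eta>[OF that] by (auto simp: Q_def A_def)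
    then show ?thesis using norm_ge_zero[of "a (\<eta> i)"] by linarith
  next
    case False
    have "\<rho> \<le> r" using r n by (simp add: \<rho>_def field_simps)
    then have "a (\<eta> i) \<noteq> 0" using \<eta>[OF that] False by (intro r(2)) (auto simp: Q_def)
    then have "0 < norm (a (\<eta> i))" by simp
    then show ?thesis using le[of "\<eta> i"] by linarith
  qed
  have "0 < norm (a ?s)" using r(2)[OF sc] by simp
  then have Bs: "0 < B ?s" using le[of ?s] by linarith
  have "norm (conv_integrand n (alt_reflect a) 0 x) = (\<Prod>i<n. norm (a (\<eta> i))) * norm (a ?s)"
    using n by (simp add: conv_integrand_def norm_mult prod_norm[symmetric] norm_alt_reflect \<eta>_def)
  also have "\<dots> = norm (a (\<eta> 0)) * ((\<Prod>i\<in>{..<n} - {0}. norm (a (\<eta> i))) * norm (a ?s))"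
    using n0 by (simp add: prod.remove[of "{..<n}" 0] mult.assoc)
  also have "\<dots> \<le> norm (a (\<eta> 0)) * ((\<Prod>i\<in>{..<n} - {0}. B (\<eta> i)) * B ?s)"
    by (intro mult_left_mono mult_mono prod_mono le conjI prod_nonneg norm_ge_zero B0)
  also have "\<dots> < B (\<eta> 0) * ((\<Prod>i\<in>{..<n} - {0}. B (\<eta> i)) * B ?s)"
    using \<eta>[OF n0] Bpos Bs by (intro mult_strict_right_mono mult_pos_pos prod_pos) (auto simp: Q_def A_def)
  also have "\<dots> = (\<Prod>i<n. B (\<eta> i)) * B ?s"
    using n0 by (simp add: prod.remove[of "{..<n}" 0] mult.assoc)
  also have "\<dots> = norm (conv_integrand n (alt_reflect (\<lambda>x. complex_of_real (B x))) 0 x)"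
    using n B0 by (simp add: conv_integrand_def norm_mult prod_norm[symmetric] norm_alt_reflect \<eta>_def)
  finally show False using xeq by simp
qed

text \<open>Both sides depend continuously on the coordinates below \<open>n\<close>, and the
  identity holds somewhere in every small cube around \<open>x\<close>.\<close>

lemma AE_integrand_nonneg_imp_all:
  fixes a :: "'a::euclidean_space \<Rightarrow> complex"
  assumes a: "continuous_on UNIV a"
    and eq: "AE x in lborel_pow {..<n}. conv_integrand n (alt_reflect a) 0 x = of_real (norm (conv_integrand n (alt_reflect a) 0 x))"
  shows "conv_integrand n (alt_reflect a) 0 x = of_real (norm (conv_integrand n (alt_reflect a) 0 x))"
proof -
  define e where "e j = 1 / real (Suc j)" for j
  have e: "e j > 0" for j by (simp add: e_def)
  have elim: "e \<longlonglongrightarrow> 0" unfolding e_def by (rule lim_1_over_n[THEN filterlim_sequentially_Suc[THEN iffD2]])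
  have bp: "emeasure lborel (ball (x i) (e j)) \<noteq> 0" for i j
    using e[of j] by (intro emeasure_lborel_open_pos) auto
  have "\<exists>y. y \<in> Pi\<^sub>E {..<n} (\<lambda>i. ball (x i) (e j)) \<and>
      conv_integrand n (alt_reflect a) 0 y = of_real (norm (conv_integrand n (alt_reflect a) 0 y))" for j
    by (rule AE_lborel_pow_rectangle[OF eq, of "\<lambda>i. ball (x i) (e j)"]) (use bp in auto)
  then have "\<forall>j. \<exists>y. y \<in> Pi\<^sub>E {..<n} (\<lambda>i. ball (x i) (e j)) \<and>
      conv_integrand n (alt_reflect a) 0 y = of_real (norm (conv_integrand n (alt_reflect a) 0 y))" ..
  from choice[OF this] obtain y where y: "\<And>j. y j \<in> Pi\<^sub>E {..<n} (\<lambda>i. ball (x i) (e j))"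
    and yeq: "\<And>j. conv_integrand n (alt_reflect a) 0 (y j) = of_real (norm (conv_integrand n (alt_reflect a) 0 (y j)))"
    by blast
  have lim: "(\<lambda>j. y j i) \<longlonglongrightarrow> x i" if "i < n" for i
  proof (rule tendsto_dist_iff[THEN iffD2], rule tendsto_sandwich[OF _ _ tendsto_const elim])
    have "dist (y j i) (x i) < e j" for j
      using PiE_mem[OF y[of j], of i] that by (simp add: dist_commute[of "y j i"])
    then show "\<forall>\<^sub>F j in sequentially. dist (y j i) (x i) \<le> e j"
      by (intro always_eventually allI less_imp_le)
  qed simp
  have alt: "continuous_on UNIV (alt_reflect a i)" for i
    unfolding alt_reflect_def by (cases "even i") (auto intro!: continuous_intros continuous_on_compose2[OF a] a)
  have altlim: "(\<lambda>j. alt_reflect a i (w j)) \<longlonglongrightarrow> alt_reflect a i v" if "w \<longlonglongrightarrow> v" for i w v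
    using continuous_on_tendsto_compose[OF alt that] by simp
  have L: "(\<lambda>j. conv_integrand n (alt_reflect a) 0 (y j)) \<longlonglongrightarrow> conv_integrand n (alt_reflect a) 0 x"
    unfolding conv_integrand_def by (intro tendsto_intros altlim lim) auto
  then have "(\<lambda>j. complex_of_real (norm (conv_integrand n (alt_reflect a) 0 (y j)))) \<longlonglongrightarrow> of_real (norm (conv_integrand n (alt_reflect a) 0 x))"
    by (intro tendsto_intros)
  then have "(\<lambda>j. conv_integrand n (alt_reflect a) 0 (y j)) \<longlonglongrightarrow> of_real (norm (conv_integrand n (alt_reflect a) 0 x))"
    by (simp only: yeq[symmetric])
  with L show ?thesis by (rule LIMSEQ_unique)
qed

text \<open>The point evaluated is y, -y', z followed by -z', z', ...: it sums to \<open>z'\<close>,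
  which becomes the last argument. The surplus factors at \<open>z'\<close> come in conjugate pairs
  and have phase 1, so positivity of the integrand says that \<open>?R\<close>, the phase product of
  y and z against the conjugate one of y' and z', equals 1.\<close>

lemma integrand_nonneg_imp_sgn_mult:
  fixes a :: "'a::euclidean_space \<Rightarrow> complex"
  assumes n: "odd n" "n \<ge> 3"
    and eq: "\<And>x. conv_integrand n (alt_reflect a) 0 x = of_real (norm (conv_integrand n (alt_reflect a) 0 x))"
    and nz: "a y \<noteq> 0" "a z \<noteq> 0" "a y' \<noteq> 0" "a z' \<noteq> 0" and sum: "y + z = y' + z'"
  shows "sgn (a y) * sgn (a z) = sgn (a y') * sgn (a z')"
proof -
  define \<eta> where "\<eta> i = (if i = 0 then y else if i = 1 then y' else if i = 2 then z else z')" for i :: nat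
  define x where "x i = (if even i then \<eta> i else - \<eta> i)" for i
  have n_eq: "n = 2 * ((n - 3) div 2) + 3" using n by (auto elim!: oddE)
  have two: "2 * Suc m + 3 = Suc (Suc (2 * m + 3))" for m by simp
  have "(\<Sum>i<2 * m + 3. x i) = z'" for m
  proof (induction m)
    case 0
    have "{..<3} = {0, 1, 2::nat}" by auto
    then show ?case using sum by (simp add: x_def \<eta>_def algebra_simps)
  next
    case (Suc m)
    have "x (2 * m + 3) + x (Suc (2 * m + 3)) = 0" by (simp add: x_def \<eta>_def)
    then show ?case using Suc unfolding two sum.lessThan_Suc by (simp add: add.assoc)
  qed
  from this[of "(n - 3) div 2"] have xs: "(\<Sum>i<n. x i) = z'" unfolding n_eq[symmetric] .
  define w where "w i = (if even i then a (\<eta> i) else cnj (a (\<eta> i)))" for i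
  have wi: "alt_reflect a i (x i) = w i" for i by (simp add: alt_reflect_def w_def x_def)
  have wn: "alt_reflect a n (0 - z') = w n" using n by (simp add: alt_reflect_def w_def \<eta>_def)
  have int: "conv_integrand n (alt_reflect a) 0 x = (\<Prod>i<n. w i) * w n"
    unfolding conv_integrand_def xs wi wn ..
  have wnz: "w i \<noteq> 0" for i using nz by (auto simp: w_def \<eta>_def)
  have sgnw: "sgn (w i) = (if even i then sgn (a (\<eta> i)) else cnj (sgn (a (\<eta> i))))" for i
    by (simp add: w_def sgn_eq)
  have unit: "sgn (a v) * cnj (sgn (a v)) = 1" if "a v \<noteq> 0" for v
    using that by (simp add: complex_norm_square[symmetric] norm_sgn)
  let ?R = "sgn (a y) * cnj (sgn (a y')) * sgn (a z) * cnj (sgn (a z'))"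
  have "(\<Prod>i<2 * m + 3. sgn (w i)) * sgn (w (2 * m + 3)) = ?R" for m
  proof (induction m)
    case 0
    have "{..<3} = {0, 1, 2::nat}" by auto
    then show ?case by (simp add: sgnw \<eta>_def mult.assoc)
  next
    case (Suc m)
    have "sgn (w (Suc (2 * m + 3))) * sgn (w (Suc (Suc (2 * m + 3)))) = 1"
      using unit[OF nz(4)] by (simp add: sgnw \<eta>_def mult.commute)
    then show ?case using Suc unfolding two prod.lessThan_Suc by (simp add: mult.assoc)
  qed
  from this[of "(n - 3) div 2"] have "(\<Prod>i<n. sgn (w i)) * sgn (w n) = ?R"
    unfolding n_eq[symmetric] .
  moreover have "sgn (\<Prod>i<n. w i) = (\<Prod>i<n. sgn (w i))"
    by (induction n) (simp_all add: sgn_mult)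
  ultimately have R: "?R = sgn (conv_integrand n (alt_reflect a) 0 x)"
    by (simp add: int sgn_mult)
  have "conv_integrand n (alt_reflect a) 0 x \<noteq> 0" using wnz by (simp add: int)
  then have "sgn (conv_integrand n (alt_reflect a) 0 x) = 1"
    by (subst eq) (simp add: sgn_of_real)
  then have "?R * (sgn (a y') * sgn (a z')) = sgn (a y') * sgn (a z')" by (simp add: R)
  moreover have "?R * (sgn (a y') * sgn (a z')) = sgn (a y) * sgn (a z) * (sgn (a y') * cnj (sgn (a y'))) * (sgn (a z') * cnj (sgn (a z')))"
    by (simp add: mult_ac)
  ultimately show ?thesis using unit nz by simp
qed

subsection \<open>Continuous local characters\<close>

text \<open>Cauchy's functional equation on a ball: additivity gives rational multiples in [0, 1],
  continuity gives real ones, and a vector is then assembled from its coordinates. Every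
  intermediate point has to remain inside the ball.\<close>

lemma local_additive_imp_inner:
  fixes \<theta> :: "'a::euclidean_space \<Rightarrow> real"
  assumes d: "\<delta> > 0" and cont: "continuous_on (ball 0 \<delta>) \<theta>"
    and add: "\<And>x y. norm x < \<delta> \<Longrightarrow> norm y < \<delta> \<Longrightarrow> norm (x + y) < \<delta> \<Longrightarrow> \<theta> (x + y) = \<theta> x + \<theta> y"
  obtains \<beta> \<rho> where "\<rho> > 0" "\<rho> \<le> \<delta>" "\<And>x. norm x < \<rho> \<Longrightarrow> \<theta> x = \<beta> \<bullet> x"
proof -
  have z: "\<theta> 0 = 0" using add[of 0 0] d by simp
  have neg: "\<theta> (- x) = - \<theta> x" if "norm x < \<delta>" for x
    using add[of x "- x"] that z d by simp
  have nat: "\<theta> (real n *\<^sub>R x) = real n * \<theta> x" if "norm (real n *\<^sub>R x) < \<delta>" for n x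
    using that
  proof (induction n)
    case (Suc n)
    have eq: "real (Suc n) *\<^sub>R x = real n *\<^sub>R x + x" by (simp add: algebra_simps)
    have "norm (real n *\<^sub>R x) \<le> norm (real (Suc n) *\<^sub>R x)" "norm x \<le> norm (real (Suc n) *\<^sub>R x)"
      by (auto intro: mult_right_mono) (simp add: algebra_simps)
    then have *: "norm (real n *\<^sub>R x) < \<delta>" "norm x < \<delta>" using Suc.prems by linarith+
    have "\<theta> (real (Suc n) *\<^sub>R x) = \<theta> (real n *\<^sub>R x) + \<theta> x"
      unfolding eq by (rule add[OF * Suc.prems[unfolded eq]])
    also have "\<dots> = real (Suc n) * \<theta> x" using Suc.IH * by (simp add: algebra_simps)
    finally show ?case .
  qed (simp add: z)
  have rat: "\<theta> ((real m / real n) *\<^sub>R x) = (real m / real n) * \<theta> x" if x: "norm x < \<delta>" and mn: "m \<le> n" "n > 0" for m n x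
  proof -
    have 1: "\<theta> (real n *\<^sub>R ((1 / real n) *\<^sub>R x)) = real n * \<theta> ((1 / real n) *\<^sub>R x)"
      using x mn by (intro nat) simp
    have "norm (real m *\<^sub>R ((1 / real n) *\<^sub>R x)) \<le> norm x"
      using mn mult_right_mono[of "real m / real n" 1 "norm x"] by simp
    then have 2: "\<theta> (real m *\<^sub>R ((1 / real n) *\<^sub>R x)) = real m * \<theta> ((1 / real n) *\<^sub>R x)"
      using x by (intro nat) linarith
    show ?thesis using 1 2 mn by (simp add: field_simps)
  qed
  have real: "\<theta> (t *\<^sub>R x) = t * \<theta> x" if x: "norm x < \<delta>" and t: "0 \<le> t" "t \<le> 1" for t x
  proof -
    \<comment> \<open>Rational approximations of \<open>t\<close> from below, so that they stay in
      [0, 1] and the points \<open>q n *\<^sub>R x\<close> stay in the ball.\<close>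
    define q where "q n = real (nat \<lfloor>t * real (Suc n)\<rfloor>) / real (Suc n)" for n
    have fl: "real (nat \<lfloor>t * real (Suc n)\<rfloor>) = of_int \<lfloor>t * real (Suc n)\<rfloor>" for n using t by simp
    have q1: "q n \<le> t" for n unfolding q_def fl
      using of_int_floor_le[of "t * real (Suc n)"] by (simp only: pos_divide_le_eq of_nat_0_less_iff zero_less_Suc)
    have q2: "t - 1 / real (Suc n) \<le> q n" for n
    proof -
      have "t * real (Suc n) - 1 \<le> of_int \<lfloor>t * real (Suc n)\<rfloor>" by linarith
      then have "(t * real (Suc n) - 1) / real (Suc n) \<le> q n" unfolding q_def fl by (intro divide_right_mono) auto
      then show ?thesis by (simp add: diff_divide_distrib del: of_nat_Suc)
    qed
    have q0: "0 \<le> q n" for n by (simp add: q_def)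
    have lim1: "(\<lambda>n. 1 / real (Suc n)) \<longlonglongrightarrow> 0" by (rule lim_1_over_n[THEN filterlim_sequentially_Suc[THEN iffD2]])
    have "(\<lambda>n. t - 1 / real (Suc n)) \<longlonglongrightarrow> t - 0" by (intro tendsto_diff tendsto_const lim1)
    then have lim2: "(\<lambda>n. t - 1 / real (Suc n)) \<longlonglongrightarrow> t" by simp
    have qlim: "q \<longlonglongrightarrow> t"
      by (rule tendsto_sandwich[OF _ _ lim2 tendsto_const]) (auto intro!: always_eventually q1 q2 simp del: of_nat_Suc)
    have inb: "norm (s *\<^sub>R x) < \<delta>" if "0 \<le> s" "s \<le> 1" for s
      using that x mult_right_mono[of s 1 "norm x"] by simp
    have "(\<lambda>n. \<theta> (q n *\<^sub>R x)) \<longlonglongrightarrow> \<theta> (t *\<^sub>R x)"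
      by (rule continuous_on_tendsto_compose[OF cont])
         (use inb t q0 q1 in \<open>auto intro!: tendsto_intros qlim always_eventually intro: order_trans\<close>)
    moreover have "\<theta> (q n *\<^sub>R x) = q n * \<theta> x" for n
    proof -
      have "\<lfloor>t * real (Suc n)\<rfloor> \<le> int (Suc n)"
      proof -
        have "t * real (Suc n) \<le> 1 * real (Suc n)" by (rule mult_right_mono[OF t(2)]) simp
        then show ?thesis unfolding floor_le_iff by (simp only: mult_1 of_int_of_nat_eq)
      qed
      then show ?thesis unfolding q_def by (intro rat x) (auto simp: nat_le_iff simp del: of_nat_Suc)
    qed
    moreover have "(\<lambda>n. q n * \<theta> x) \<longlonglongrightarrow> t * \<theta> x" by (intro tendsto_intros qlim)
    ultimately show ?thesis by (simp add: LIMSEQ_unique)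
  qed
  \<comment> \<open>The basis vectors may lie outside the ball, so the coefficients are read off at
    distance \<open>\<delta> / 2\<close>.\<close>
  define \<beta> where "\<beta> = (\<Sum>b\<in>Basis. (2 / \<delta> * \<theta> ((\<delta> / 2) *\<^sub>R b)) *\<^sub>R b)"
  have \<beta>b: "\<beta> \<bullet> b = 2 / \<delta> * \<theta> ((\<delta> / 2) *\<^sub>R b)" if "b \<in> Basis" for b
    using that by (simp add: \<beta>_def inner_sum_left inner_Basis if_distrib cong: if_cong)
  have axis: "\<theta> (s *\<^sub>R b) = s * (\<beta> \<bullet> b)" if b: "b \<in> Basis" and s: "\<bar>s\<bar> \<le> \<delta> / 2" for s b
  proof -
    have pos: "\<theta> (s *\<^sub>R b) = s * (\<beta> \<bullet> b)" if s: "0 \<le> s" "s \<le> \<delta> / 2" for s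
      using real[of "(\<delta> / 2) *\<^sub>R b" "s / (\<delta> / 2)"] s d b by (simp add: \<beta>b mult_ac)
    show ?thesis
    proof (cases "0 \<le> s")
      case True
      then show ?thesis using pos s by simp
    next
      case False
      have "norm ((- s) *\<^sub>R b) < \<delta>" using b s d by simp
      then have "\<theta> (- ((- s) *\<^sub>R b)) = - \<theta> ((- s) *\<^sub>R b)" by (rule neg)
      then show ?thesis using pos[of "- s"] False s by simp
    qed
  qed
  \<comment> \<open>At most DIM('a) coordinates, each below \<open>\<rho>\<close> in absolute value,
    give partial sums of norm at most \<open>\<delta> / 2\<close>.\<close>
  define \<rho> where "\<rho> = \<delta> / (2 * real DIM('a))"
  have dim: "1 \<le> real DIM('a)" using DIM_positive[where 'a='a] by linarith
  have \<rho>: "\<rho> > 0" using d dim by (simp add: \<rho>_def)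
  have \<rho>le: "\<rho> \<le> \<delta> / 2" unfolding \<rho>_def using d dim by (simp add: field_simps)
  have main: "\<theta> x = \<beta> \<bullet> x" if x: "norm x < \<rho>" for x
  proof -
    have coord: "\<bar>x \<bullet> b\<bar> < \<rho>" if "b \<in> Basis" for b using Basis_le_norm[OF that, of x] x by linarith
    have nb: "norm (\<Sum>b\<in>F. (x \<bullet> b) *\<^sub>R b) < \<delta>" if F: "F \<subseteq> Basis" for F
    proof -
      have "norm (\<Sum>b\<in>F. (x \<bullet> b) *\<^sub>R b) \<le> (\<Sum>b\<in>F. norm ((x \<bullet> b) *\<^sub>R b))" by (rule norm_sum)
      also have "\<dots> \<le> (\<Sum>b\<in>F. \<rho>)" using F coord by (intro sum_mono) (auto simp: less_imp_le subset_iff)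
      also have "\<dots> \<le> real DIM('a) * \<rho>" using F \<rho> by (auto intro!: mult_right_mono card_mono)
      also have "\<dots> < \<delta>" using d dim by (simp add: \<rho>_def)
      finally show ?thesis .
    qed
    have "\<theta> (\<Sum>b\<in>F. (x \<bullet> b) *\<^sub>R b) = (\<Sum>b\<in>F. (x \<bullet> b) * (\<beta> \<bullet> b))" if "F \<subseteq> Basis" for F
      using finite_subset[OF that finite_Basis] that
    proof (induction F rule: finite_induct)
      case (insert b F)
      have b: "b \<in> Basis" using insert by auto
      have "\<theta> (\<Sum>b\<in>insert b F. (x \<bullet> b) *\<^sub>R b) = \<theta> ((x \<bullet> b) *\<^sub>R b + (\<Sum>b\<in>F. (x \<bullet> b) *\<^sub>R b))"
        using insert by simp
      also have "\<dots> = \<theta> ((x \<bullet> b) *\<^sub>R b) + \<theta> (\<Sum>b\<in>F. (x \<bullet> b) *\<^sub>R b)"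
      proof (rule add)
        show "norm ((x \<bullet> b) *\<^sub>R b) < \<delta>" using b coord[OF b] \<rho>le d by simp
        show "norm (\<Sum>b\<in>F. (x \<bullet> b) *\<^sub>R b) < \<delta>" using insert by (intro nb) auto
        show "norm ((x \<bullet> b) *\<^sub>R b + (\<Sum>b\<in>F. (x \<bullet> b) *\<^sub>R b)) < \<delta>" using nb[of "insert b F"] insert by simp
      qed
      also have "\<dots> = (\<Sum>b\<in>insert b F. (x \<bullet> b) * (\<beta> \<bullet> b))"
        using insert axis[OF b, of "x \<bullet> b"] coord[OF b] \<rho>le by simp
      finally show ?case .
    qed (simp add: z)
    from this[of Basis] show ?thesis
      by (simp add: euclidean_representation euclidean_inner[of \<beta> x] mult.commute)
  qed
  show thesis by (rule that[OF \<rho> _ main]) (use \<rho>le d in auto)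
qed

text \<open>Near a fixed point \<open>a\<close> the quotient \<open>u (a + h) / u a\<close> is
  multiplicative in \<open>h\<close>, so its argument is linear with some slope
  \<open>\<beta>\<close>. The relation links distant points as well: it transports the increment at
  \<open>a\<close> to every other point with the same \<open>\<beta>\<close> and the same radius.
  Hence \<open>u x * cis (- (\<beta> \<bullet> x))\<close> is locally constant, and connectedness
  makes it constant.\<close>

lemma unimodular_additive_imp_cis:
  fixes u :: "'a::euclidean_space \<Rightarrow> complex"
  assumes op: "open \<Omega>" and conn: "connected \<Omega>" and ne: "\<Omega> \<noteq> {}" and cont: "continuous_on \<Omega> u"
    and unit: "\<And>x. x \<in> \<Omega> \<Longrightarrow> norm (u x) = 1"
    and mult: "\<And>x y x' y'. x \<in> \<Omega> \<Longrightarrow> y \<in> \<Omega> \<Longrightarrow> x' \<in> \<Omega> \<Longrightarrow> y' \<in> \<Omega> \<Longrightarrow> x + y = x' + y' \<Longrightarrow> u x * u y = u x' * u y'"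
  obtains \<alpha> \<beta> where "\<And>x. x \<in> \<Omega> \<Longrightarrow> u x = cis (\<alpha> + \<beta> \<bullet> x)"
proof -
  obtain a where a: "a \<in> \<Omega>" using ne by auto
  obtain r where r: "r > 0" "ball a r \<subseteq> \<Omega>" using op a open_contains_ball by blast
  have inb: "a + h \<in> \<Omega>" if "norm h < r" for h
    using r(2) that by (auto simp: subset_iff dist_norm)
  have ua: "u a \<noteq> 0" using unit[OF a] by auto
  define l where "l h = u (a + h) / u a" for h
  have lnorm: "norm (l h) = 1" if "norm h < r" for h
    using unit[OF a] unit[OF inb[OF that]] by (simp add: l_def norm_divide)
  have lcont: "continuous_on (ball 0 r) l"
    unfolding l_def using ua r(2)
    by (intro continuous_intros continuous_on_compose2[OF cont]) auto
  have lmult: "l (x + y) = l x * l y" if "norm x < r" "norm y < r" "norm (x + y) < r" for x y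
    using mult[OF inb[OF that(1)] inb[OF that(2)] inb[OF that(3)] a] ua by (simp add: l_def field_simps)
  \<comment> \<open>Within distance 1 of \<open>l 0 = 1\<close> the real part is positive.\<close>
  have "\<exists>s>0. \<forall>h\<in>ball 0 r. dist h 0 < s \<longrightarrow> dist (l h) (l 0) < 1"
    using lcont r unfolding continuous_on_iff by (metis centre_in_ball zero_less_one)
  then obtain s where s: "s > 0" "\<And>h. norm h < r \<Longrightarrow> norm h < s \<Longrightarrow> norm (l h - 1) < 1"
    using ua by (auto simp: l_def dist_norm)
  define \<delta> where "\<delta> = min r s"
  have \<delta>: "\<delta> > 0" "\<delta> \<le> r" using r s by (auto simp: \<delta>_def)
  have Rel: "Re (l h) > 0" if "norm h < \<delta>" for h
    using s(2)[of h] that abs_Re_le_cmod[of "l h - 1"] by (auto simp: \<delta>_def)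
  \<comment> \<open>With positive real parts both arguments lie strictly between -pi/2 and pi/2.
    Their sum stays in the principal range, so \<open>Ln\<close> is additive here without correction
    by multiples of 2 pi.\<close>
  define \<theta> where "\<theta> h = Im (Ln (l h))" for h
  have \<theta>: "l h = cis (\<theta> h)" if "norm h < \<delta>" for h
  proof -
    have nz: "l h \<noteq> 0" using Rel[OF that] by auto
    then have "Re (Ln (l h)) = 0" using lnorm[of h] that \<delta> by simp
    then have "Ln (l h) = \<i> * of_real (\<theta> h)" by (simp add: \<theta>_def complex_eq_iff)
    then have "exp (Ln (l h)) = exp (\<i> * of_real (\<theta> h))" by simp
    then show ?thesis using nz by (simp add: cis_conv_exp)
  qed
  obtain \<beta> \<rho> where \<rho>: "\<rho> > 0" "\<rho> \<le> \<delta>" and \<beta>: "\<And>h. norm h < \<rho> \<Longrightarrow> \<theta> h = \<beta> \<bullet> h"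
  proof (rule local_additive_imp_inner[OF \<delta>(1)])
    have "l h \<notin> \<real>\<^sub>\<le>\<^sub>0" if "norm h < \<delta>" for h
      using Rel[OF that] by (auto simp: complex_nonpos_Reals_iff)
    then show "continuous_on (ball 0 \<delta>) \<theta>"
      unfolding \<theta>_def using \<delta>(2)
      by (intro continuous_intros continuous_on_subset[OF lcont]) auto
    fix x y :: 'a
    assume xy: "norm x < \<delta>" "norm y < \<delta>" "norm (x + y) < \<delta>"
    have "\<bar>\<theta> x\<bar> < pi / 2" "\<bar>\<theta> y\<bar> < pi / 2"
      unfolding \<theta>_def using Rel[OF xy(1)] Rel[OF xy(2)] Re_Ln_pos_lt[of "l x"] Re_Ln_pos_lt[of "l y"]
      by force+
    moreover have "l x \<noteq> 0" "l y \<noteq> 0" using Rel[OF xy(1)] Rel[OF xy(2)] by auto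
    ultimately have "Ln (l x * l y) = Ln (l x) + Ln (l y)"
      by (intro Ln_times_simple) (auto simp: \<theta>_def)
    then show "\<theta> (x + y) = \<theta> x + \<theta> y"
      using lmult[of x y] xy \<delta> by (simp add: \<theta>_def)
  qed (rule that)
  define w where "w x = u x * cis (- (\<beta> \<bullet> x))" for x
  have loc: "\<forall>x\<in>\<Omega>. eventually (\<lambda>y. w x = w y) (at x within \<Omega>)"
  proof
    fix x assume x: "x \<in> \<Omega>"
    have "w x = w y" if y: "y \<in> \<Omega>" "dist y x < \<rho>" for y
    proof -
      have h: "norm (y - x) < \<rho>" using y by (simp add: dist_norm)
      \<comment> \<open>Both pairs sum to \<open>y + a\<close>; only the displacement
        \<open>y - x\<close> has to be small, and \<open>x\<close> may be far from
        \<open>a\<close>.\<close>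
      have "u x * u (a + (y - x)) = u y * u a"
        using h \<rho> \<delta> by (intro mult[OF x inb y(1) a]) auto
      then have "u y = u x * l (y - x)" using ua by (simp add: l_def field_simps)
      also have "l (y - x) = cis (\<beta> \<bullet> (y - x))" using \<theta>[of "y - x"] \<beta>[OF h] h \<rho> by simp
      finally have "w y = u x * (cis (\<beta> \<bullet> (y - x)) * cis (- (\<beta> \<bullet> y)))" by (simp add: w_def)
      also have "cis (\<beta> \<bullet> (y - x)) * cis (- (\<beta> \<bullet> y)) = cis (- (\<beta> \<bullet> x))" by (simp add: cis_mult inner_diff_right)
      finally show ?thesis by (simp add: w_def)
    qed
    then show "eventually (\<lambda>y. w x = w y) (at x within \<Omega>)"
      unfolding eventually_at using \<rho>(1) by blast
  qed
  have const: "w x = w a" if "x \<in> \<Omega>" for x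
    by (rule connected_local_const[OF conn that a loc])
  have wa: "norm (w a) = 1" using unit[OF a] by (simp add: w_def norm_mult)
  have "u x = cis (Arg (w a) + \<beta> \<bullet> x)" if x: "x \<in> \<Omega>" for x
  proof -
    have "w a \<noteq> 0" using wa by auto
    then have "cis (Arg (w a)) = w a" using wa by (simp add: cis_Arg sgn_eq)
    then have "cis (Arg (w a) + \<beta> \<bullet> x) = w x * cis (\<beta> \<bullet> x)" using const[OF x] by (simp flip: cis_mult)
    also have "\<dots> = u x" by (simp add: w_def mult.assoc cis_mult)
    finally show ?thesis by simp
  qed
  then show thesis by (rule that)
qed

subsection \<open>The exponent infinity\<close>

lemma continuous_fourier:
  fixes h :: "'a::euclidean_space \<Rightarrow> complex"
  assumes h: "integrable lborel h"
  shows "continuous_on UNIV (fourier h)"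
proof (rule continuous_at_imp_continuous_on, rule ballI)
  fix \<xi> :: 'a
  have [measurable]: "h \<in> borel_measurable borel" using h by auto
  show "isCont (fourier h) \<xi>"
    unfolding isCont_def tendsto_at_iff_sequentially comp_def
  proof (intro allI impI)
    fix X :: "nat \<Rightarrow> 'a" assume X: "X \<longlonglongrightarrow> \<xi>"
    show "(\<lambda>i. fourier h (X i)) \<longlonglongrightarrow> fourier h \<xi>"
      unfolding fourier_def
    proof (rule integral_dominated_convergence[where w="\<lambda>x. norm (h x)"])
      have "isCont cis t" for t unfolding cis_conv_exp[abs_def] by (intro continuous_intros)
      then have "(\<lambda>i. cis (- 2 * pi * (x \<bullet> X i)) * h x) \<longlonglongrightarrow> cis (- 2 * pi * (x \<bullet> \<xi>)) * h x" for x
        by (intro tendsto_mult tendsto_const isCont_tendsto_compose[where g=cis] tendsto_inner X)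
      then show "AE x in lborel. (\<lambda>i. cis (- 2 * pi * (x \<bullet> X i)) * h x) \<longlonglongrightarrow> cis (- 2 * pi * (x \<bullet> \<xi>)) * h x"
        by (rule AE_I2)
    qed (use h in \<open>auto simp: norm_mult\<close>)
  qed
qed

text \<open>
  Shifting by \<open>x / (2 |x|\<^sup>2)\<close> changes the sign of the character, so \<open>2 |fourier h x|\<close> is at
  most a modulus of continuity in the mean.
\<close>
lemma Riemann_Lebesgue:
  fixes h :: "'a::euclidean_space \<Rightarrow> complex"
  assumes h: "integrable lborel h" and e: "e > 0"
  obtains R where "\<And>x. norm x > R \<Longrightarrow> norm (fourier h x) < e" "R > 0"
proof -
  have [measurable]: "h \<in> borel_measurable borel" using h by auto
  define \<omega> where "\<omega> y = (\<integral>x. norm (h (x + y) - h x) \<partial>lborel)" for y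
  have le: "2 * norm (fourier h x) \<le> \<omega> ((1 / (2 * (norm x)\<^sup>2)) *\<^sub>R x)" if x: "x \<noteq> 0" for x
  proof -
    define s where "s = (1 / (2 * (norm x)\<^sup>2)) *\<^sub>R x"
    have sx: "s \<bullet> x = 1 / 2" using x by (simp add: s_def power2_norm_eq_inner)
    have hs: "integrable lborel (\<lambda>y. h (y + s))"
      using integrable_shift_reflect(1)[OF h, of s] by (simp add: add.commute)
    have cs: "cis (- 2 * pi * ((s + y) \<bullet> x)) = - cis (- 2 * pi * (y \<bullet> x))" for y
    proof -
      have "cis (- 2 * pi * ((s + y) \<bullet> x)) = cis (- pi) * cis (- 2 * pi * (y \<bullet> x))"
        by (simp add: cis_mult inner_add_left sx algebra_simps)
      also have "cis (- pi) = -1" by (simp add: complex_eq_iff)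
      finally show ?thesis by simp
    qed
    have "fourier h x = (\<integral>y. cis (- 2 * pi * ((s + y) \<bullet> x)) * h (s + y) \<partial>lborel)"
      unfolding fourier_def by (rule integral_shift_reflect(1)[symmetric]) simp
    also have "\<dots> = (\<integral>y. - (cis (- 2 * pi * (y \<bullet> x)) * h (y + s)) \<partial>lborel)"
      unfolding cs by (simp add: add.commute)
    also have "\<dots> = - (\<integral>y. cis (- 2 * pi * (y \<bullet> x)) * h (y + s) \<partial>lborel)" by (rule Bochner_Integration.integral_minus)
    finally have "2 * fourier h x = fourier h x - (\<integral>y. cis (- 2 * pi * (y \<bullet> x)) * h (y + s) \<partial>lborel)" by simp
    also have "\<dots> = (\<integral>y. cis (- 2 * pi * (y \<bullet> x)) * h y - cis (- 2 * pi * (y \<bullet> x)) * h (y + s) \<partial>lborel)"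
      unfolding fourier_def by (rule Bochner_Integration.integral_diff[symmetric]) (auto intro!: integrable_cis_mult h hs)
    finally have "norm (2 * fourier h x) \<le> (\<integral>y. norm (cis (- 2 * pi * (y \<bullet> x)) * h y - cis (- 2 * pi * (y \<bullet> x)) * h (y + s)) \<partial>lborel)"
      by (simp only: integral_norm_bound)
    also have "\<dots> = \<omega> s"
      unfolding \<omega>_def right_diff_distrib[symmetric] norm_mult by (simp add: norm_minus_commute)
    finally show ?thesis by (simp add: s_def norm_mult)
  qed
  have "(\<omega> \<longlongrightarrow> 0) (at 0)" using mean_translation_continuous[OF h] by (simp add: \<omega>_def[abs_def])
  then have "eventually (\<lambda>y. dist (\<omega> y) 0 < e) (at 0)" using e by (rule tendstoD)
  then obtain d where d: "d > 0" "\<And>y. y \<noteq> 0 \<Longrightarrow> norm y < d \<Longrightarrow> \<omega> y < e"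
    unfolding eventually_at by (auto simp: dist_norm) (metis abs_less_iff)
  show thesis
  proof
    show "1 / d > 0" using d by simp
    fix x :: 'a assume x: "norm x > 1 / d"
    then have nx: "norm x > 0" using d by (meson less_trans zero_less_divide_1_iff)
    define s where "s = (1 / (2 * (norm x)\<^sup>2)) *\<^sub>R x"
    have "norm s = 1 / (2 * norm x)" using nx by (simp add: s_def power2_eq_square)
    also have "\<dots> < d" using x nx d by (simp add: field_simps)
    finally have "\<omega> s < e" using d(2)[of s] nx by (auto simp: s_def)
    then have "2 * norm (fourier h x) < e" using le[of x] nx by (auto simp: s_def)
    then show "norm (fourier h x) < e" using norm_ge_zero[of "fourier h x"] by linarith
  qed
qed

text \<open>A strict superlevel set of a continuous function is open, so it is null only when it is
  empty.\<close>

lemma esssup_ge_continuous: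
  fixes f :: "'a::euclidean_space \<Rightarrow> real"
  assumes f: "continuous_on UNIV f"
  shows "ennreal (f x) \<le> esssup lborel (\<lambda>x. ennreal (f x))"
proof (rule ccontr)
  let ?E = "esssup lborel (\<lambda>x. ennreal (f x))"
  assume "\<not> ?thesis"
  then have lt: "?E < ennreal (f x)" by simp
  then obtain e where e: "?E = ennreal e" "0 \<le> e" by (cases ?E) auto
  have op: "open {y. e < f y}" using f by (intro open_Collect_less continuous_intros)
  have "x \<in> {y. e < f y}" using lt e by (auto simp: ennreal_less_iff)
  then have "emeasure lborel {y. e < f y} \<noteq> 0" using op by (intro emeasure_lborel_open_pos) auto
  moreover have "AE y in lborel. \<not> e < f y"
    using esssup_AE[of "\<lambda>x. ennreal (f x)" lborel]
  proof eventually_elim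
    case (elim y)
    then show ?case using e by (auto simp: not_less)
  qed
  then have "emeasure lborel {y. e < f y} = 0"
    using op by (subst (asm) AE_iff_measurable[OF _ refl]) auto
  ultimately show False by simp
qed

lemma esssup_fourier_equality:
  fixes a :: "'a::euclidean_space \<Rightarrow> complex" and B :: "'a \<Rightarrow> real"
  assumes a: "integrable lborel a" and B: "integrable lborel B" and le: "\<And>x. norm (a x) \<le> B x"
    and eq: "esssup lborel (\<lambda>x. ennreal (norm (fourier a x))) = esssup lborel (\<lambda>x. ennreal (norm (fourier (\<lambda>x. of_real (B x)) x)))"
  obtains c v where "norm c = 1" "AE x in lborel. of_real (B x) = c * cis (v \<bullet> x) * a x"
proof -
  have [measurable]: "a \<in> borel_measurable borel" "B \<in> borel_measurable borel" using a B by auto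
  have B0: "0 \<le> B x" for x using order_trans[OF norm_ge_zero le] .
  define G where "G = (\<integral>x. B x \<partial>lborel)"
  have G0: "0 \<le> G" unfolding G_def by (simp add: B0)
  have Bc: "integrable lborel (\<lambda>x. complex_of_real (B x))" using B by (simp add: complex_of_real_integrable_eq)
  have "fourier (\<lambda>x. complex_of_real (B x)) 0 = of_real G"
    by (simp add: fourier_def G_def integral_complex_of_real)
  then have "ennreal G \<le> esssup lborel (\<lambda>x. ennreal (norm (fourier (\<lambda>x. of_real (B x)) x)))"
    using esssup_ge_continuous[OF continuous_on_norm[OF continuous_fourier[OF Bc]], of 0] G0 by simp
  then have sup: "ennreal G \<le> esssup lborel (\<lambda>x. ennreal (norm (fourier a x)))" by (simp only: eq)
  show thesis
  \<comment> \<open>The threshold \<open>G / 2\<close> in the Riemann-Lebesgue lemma requires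
    \<open>G > 0\<close>. For \<open>G = 0\<close> both functions vanish almost everywhere and any
    phase will do.\<close>
  proof (cases "G = 0")
    case True
    then have "AE x in lborel. B x = 0"
      using integral_nonneg_eq_0_iff_AE[OF B] by (simp add: G_def B0)
    then have "AE x in lborel. complex_of_real (B x) = 1 * cis (0 \<bullet> x) * a x"
      by eventually_elim (metis (no_types, lifting) le mult_zero_right norm_le_zero_iff of_real_0)
    then show thesis by (rule that[rotated]) simp
  next
    case False
    then have Gp: "G > 0" using G0 by simp
    obtain R where R: "\<And>x. norm x > R \<Longrightarrow> norm (fourier a x) < G / 2" "R > 0"
      using Riemann_Lebesgue[OF a, of "G / 2"] Gp by auto
    have "continuous_on (cball 0 R) (\<lambda>x. norm (fourier a x))"
      by (intro continuous_on_norm continuous_on_subset[OF continuous_fourier[OF a]]) auto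
    then have "\<exists>x\<in>cball 0 R. \<forall>y\<in>cball 0 R. norm (fourier a y) \<le> norm (fourier a x)"
      by (intro continuous_attains_sup) (use R(2) in auto)
    then obtain x0 where x0: "\<And>x. x \<in> cball 0 R \<Longrightarrow> norm (fourier a x) \<le> norm (fourier a x0)"
      by blast
    have ge: "G \<le> norm (fourier a x0)"
    proof (rule ccontr)
      assume "\<not> G \<le> norm (fourier a x0)"
      then have lt: "max (norm (fourier a x0)) (G / 2) < G" using Gp by simp
      have "norm (fourier a x) \<le> max (norm (fourier a x0)) (G / 2)" for x
      proof (cases "norm x \<le> R")
        case True
        then show ?thesis using x0[of x] by simp
      next
        case False
        then show ?thesis using R(1)[of x] by simp
      qed
      then have "esssup lborel (\<lambda>x. ennreal (norm (fourier a x))) \<le> ennreal (max (norm (fourier a x0)) (G / 2))"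
        by (intro esssup_I AE_I2 ennreal_leI) auto
      with sup have "ennreal G \<le> ennreal (max (norm (fourier a x0)) (G / 2))" by (rule order_trans)
      then show False using lt by (simp add: ennreal_le_iff2)
    qed
    \<comment> \<open>This rotation makes the integral of \<open>k\<close> equal to
      \<open>norm (fourier a x0) \<ge> G\<close>. Since \<open>norm (k x) \<le> B x\<close>, the
      nonnegative difference \<open>B x - Re (k x)\<close> has integral at most 0.\<close>
    define c where "c = cnj (sgn (fourier a x0))"
    have nz: "fourier a x0 \<noteq> 0" using ge Gp by auto
    have c: "norm c = 1" using nz by (simp add: c_def norm_sgn)
    have cF: "c * fourier a x0 = of_real (norm (fourier a x0))"
      using nz by (simp add: c_def sgn_eq complex_norm_square[symmetric] power2_eq_square mult.commute)
    define k where "k x = c * (cis (- 2 * pi * (x \<bullet> x0)) * a x)" for x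
    have ki: "integrable lborel k" unfolding k_def[abs_def]
      by (intro integrable_mult_right integrable_cis_mult a) simp
    have kle: "norm (k x) \<le> B x" for x using le[of x] c by (simp add: k_def norm_mult)
    have "(\<integral>x. k x \<partial>lborel) = c * fourier a x0"
      unfolding k_def fourier_def by (rule integral_mult_right_zero)
    also note cF
    finally have "(\<integral>x. k x \<partial>lborel) = of_real (norm (fourier a x0))" .
    then have kint: "(\<integral>x. Re (k x) \<partial>lborel) = norm (fourier a x0)"
      using ki by (simp add: integral_Re)
    have nonneg: "0 \<le> B x - Re (k x)" for x using kle[of x] complex_Re_le_cmod[of "k x"] by linarith
    have di: "integrable lborel (\<lambda>x. B x - Re (k x))" by (intro Bochner_Integration.integrable_diff B integrable_Re ki)
    have "(\<integral>x. B x - Re (k x) \<partial>lborel) \<le> 0"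
      using ge kint B ki by (simp add: G_def)
    moreover have "0 \<le> (\<integral>x. B x - Re (k x) \<partial>lborel)" using nonneg by (intro integral_nonneg_AE AE_I2)
    ultimately have "(\<integral>x. B x - Re (k x) \<partial>lborel) = 0" by simp
    then have "AE x in lborel. B x - Re (k x) = 0"
      using integral_nonneg_eq_0_iff_AE[OF di] nonneg by simp
    then have "AE x in lborel. of_real (B x) = c * cis ((- (2 * pi) *\<^sub>R x0) \<bullet> x) * a x"
    proof eventually_elim
      case (elim x)
      then have "Re (k x) = norm (k x)" using kle[of x] complex_Re_le_cmod[of "k x"] by linarith
      then have "k x = of_real (Re (k x))" using cmod_power2[of "k x"] by (simp add: complex_eq_iff)
      then have "of_real (B x) = k x" using elim by simp
      then show ?case by (simp add: k_def mult.assoc inner_commute)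
    qed
    with c show thesis by (rule that)
  qed
qed

subsection \<open>Norms of tempered distributions\<close>

lemma gwave_modulated_schwartz: "gwave a 0 \<in> schwartz"
  using gwave_scaled_schwartz[of 1 a 0] by simp

lemma fourier_gwave_modulated_schwartz: "fourier (gwave ((2 * pi) *\<^sub>R a) 0) \<in> schwartz"
  unfolding fourier_gwave_modulated gauss_shift_eq_gwave by (rule gwave_scaled_schwartz)

lemma gwave_modulated_eq: "gwave ((2 * pi) *\<^sub>R a) 0 x = of_real (gauss x) * cis (2 * pi * (a \<bullet> x))"
  by (simp add: gwave_def gauss_def)

text \<open>The integrals against the waves are the values of the Fourier transform of
  \<open>v * gauss\<close> and \<open>w * gauss\<close>. Uniqueness for integrable functions
  applies, and the positive factor \<open>gauss\<close> cancels.\<close>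

lemma AE_eq_by_modulated_gaussians:
  fixes v w :: "'a::euclidean_space \<Rightarrow> complex"
  assumes v: "integrable lborel (\<lambda>x. v x * of_real (gauss x))" and w: "integrable lborel (\<lambda>x. w x * of_real (gauss x))"
    and eq: "\<And>a. (\<integral>x. v x * gwave ((2 * pi) *\<^sub>R a) 0 x \<partial>lborel) = (\<integral>x. w x * gwave ((2 * pi) *\<^sub>R a) 0 x \<partial>lborel)"
  shows "AE x in lborel. v x = w x"
proof -
  have F: "fourier (\<lambda>x. h x * of_real (gauss x)) \<xi> = (\<integral>x. h x * gwave ((2 * pi) *\<^sub>R (- \<xi>)) 0 x \<partial>lborel)" for h :: "'a \<Rightarrow> complex" and \<xi>
    unfolding fourier_def gwave_modulated_eq
    by (intro Bochner_Integration.integral_cong refl) (simp add: inner_commute mult_ac)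
  have "fourier (\<lambda>x. v x * of_real (gauss x) - w x * of_real (gauss x)) \<xi> = 0" for \<xi>
  proof -
    have "fourier (\<lambda>x. v x * of_real (gauss x) - w x * of_real (gauss x)) \<xi> =
        fourier (\<lambda>x. v x * of_real (gauss x)) \<xi> - fourier (\<lambda>x. w x * of_real (gauss x)) \<xi>"
      unfolding fourier_def right_diff_distrib
      by (intro Bochner_Integration.integral_diff integrable_cis_mult v w) simp_all
    then show ?thesis unfolding F eq by simp
  qed
  from fourier_eq_0_imp_AE_0[OF Bochner_Integration.integrable_diff[OF v w] this]
  show ?thesis
  proof eventually_elim
    case (elim x)
    then have "(v x - w x) * of_real (gauss x) = 0" by (simp add: left_diff_distrib)
    moreover have "complex_of_real (gauss x) \<noteq> 0" by (simp add: gauss_def)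
    ultimately show ?case by simp
  qed
qed

lemma lnorm_finite_eq:
  assumes "q \<noteq> \<infinity>"
  shows "lnorm q u = (if (\<integral>\<^sup>+x. ennreal (norm (u x) powr enn2real q) \<partial>lborel) = \<infinity> then \<infinity>
     else ennreal (enn2real (\<integral>\<^sup>+x. ennreal (norm (u x) powr enn2real q) \<partial>lborel) powr (1 / enn2real q)))"
  using assms by (simp add: lnorm_def Let_def)

lemma Lspace_finite_iff:
  assumes "q \<noteq> \<infinity>"
  shows "u \<in> Lspace q \<longleftrightarrow> u \<in> borel_measurable borel \<and> (\<integral>\<^sup>+x. ennreal (norm (u x) powr enn2real q) \<partial>lborel) < \<infinity>"
  using assms by (auto simp: Lspace_def lnorm_finite_eq less_top)

lemma lnorm_cong_AE:
  assumes [measurable]: "u \<in> borel_measurable borel" "v \<in> borel_measurable borel" and ae: "AE x in lborel. u x = v x"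
  shows "lnorm q u = lnorm q v"
proof (cases "q = \<infinity>")
  case True
  have "esssup lborel (\<lambda>x. ennreal (norm (u x))) = esssup lborel (\<lambda>x. ennreal (norm (v x)))"
    by (rule esssup_AE_cong) (use ae in \<open>auto\<close>)
  then show ?thesis by (simp add: lnorm_def True)
next
  case False
  have "(\<integral>\<^sup>+x. ennreal (norm (u x) powr enn2real q) \<partial>lborel) = (\<integral>\<^sup>+x. ennreal (norm (v x) powr enn2real q) \<partial>lborel)"
    by (rule nn_integral_cong_AE) (use ae in \<open>eventually_elim, simp\<close>)
  then show ?thesis using False by (simp add: lnorm_finite_eq)
qed

lemma Lspace_cong_AE:
  assumes "u \<in> Lspace q" "v \<in> borel_measurable borel" "AE x in lborel. u x = v x"
  shows "v \<in> Lspace q"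
  using assms lnorm_cong_AE[of u v q] by (auto simp: Lspace_def)

lemma esssup_shift:
  fixes F :: "'a::euclidean_space \<Rightarrow> ennreal"
  assumes [measurable]: "F \<in> borel_measurable borel"
  shows "esssup lborel (\<lambda>x. F (s + x)) = esssup lborel F"
proof -
  have le: "esssup lborel (\<lambda>x. H (t + x)) \<le> esssup lborel H" if [measurable]: "H \<in> borel_measurable borel" for H and t :: 'a
    by (rule esssup_I) (auto intro!: AE_shift_reflect(1)[OF esssup_AE])
  show ?thesis
    using le[of F s] le[of "\<lambda>x. F (s + x)" "- s"] by (intro antisym) simp_all
qed

lemma lnorm_shift:
  fixes u :: "'a::euclidean_space \<Rightarrow> complex"
  assumes [measurable]: "u \<in> borel_measurable borel" and c: "norm c = 1"
  shows "lnorm q (\<lambda>x. c * u (s + x)) = lnorm q u"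
  using esssup_shift[of "\<lambda>x. ennreal (norm (u x))" s]
    nn_integral_shift_reflect(1)[of "\<lambda>x. ennreal (norm (u x) powr enn2real q)" s] c
  by (simp add: lnorm_def norm_mult)

text \<open>For finite exponent r, \<open>|u| * gauss\<close> is at most \<open>gauss\<close> where
  \<open>|u| \<le> 1\<close> and at most \<open>|u| powr r\<close> elsewhere.\<close>

lemma integrable_Lspace_gauss:
  fixes u :: "'a::euclidean_space \<Rightarrow> complex"
  assumes u: "u \<in> Lspace q" and q: "1 \<le> q"
  shows "integrable lborel (\<lambda>x. u x * of_real (gauss x))"
proof (cases "q = \<infinity>")
  case True
  have [measurable]: "u \<in> borel_measurable borel" using u by (simp add: Lspace_def)
  have "esssup lborel (\<lambda>x. ennreal (norm (u x))) < \<infinity>" using u True by (simp add: Lspace_def lnorm_def)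
  then obtain C where C: "esssup lborel (\<lambda>x. ennreal (norm (u x))) = ennreal C" "0 \<le> C"
    by (cases "esssup lborel (\<lambda>x. ennreal (norm (u x)))") auto
  show ?thesis
  proof (rule Bochner_Integration.integrable_bound)
    show "integrable lborel (\<lambda>x::'a. C * gauss x)" by (intro integrable_mult_right integrable_gauss)
    show "AE x in lborel. norm (u x * complex_of_real (gauss x)) \<le> norm (C * gauss x)"
      using esssup_AE[of "\<lambda>x. ennreal (norm (u x))" lborel]
    proof eventually_elim
      case (elim x)
      then show ?case using C by (simp add: norm_mult abs_mult mult_right_mono)
    qed
  qed simp
next
  case False
  have [measurable]: "u \<in> borel_measurable borel" using u by (simp add: Lspace_def)
  define r where "r = enn2real q"
  have r: "1 \<le> r" using q False by (cases q) (auto simp: r_def)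
  have fin: "(\<integral>\<^sup>+x. ennreal (norm (u x) powr r) \<partial>lborel) < \<infinity>"
    using u False by (simp add: Lspace_finite_iff r_def)
  then have "integrable lborel (\<lambda>x. norm (u x) powr r)" by (simp add: integrable_iff_bounded)
  then have i: "integrable lborel (\<lambda>x. gauss x + norm (u x) powr r)"
    by (intro Bochner_Integration.integrable_add integrable_gauss)
  show ?thesis
  proof (rule Bochner_Integration.integrable_bound[OF i])
    show "AE x in lborel. norm (u x * complex_of_real (gauss x)) \<le> norm (gauss x + norm (u x) powr r)"
    proof (rule AE_I2)
      fix x
      have "norm (u x) * gauss x \<le> gauss x + norm (u x) powr r"
      proof (cases "norm (u x) \<le> 1")
        case True
        then have "norm (u x) * gauss x \<le> 1 * gauss x" by (intro mult_right_mono) auto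
        moreover have "0 \<le> norm (u x) powr r" by simp
        ultimately show ?thesis by linarith
      next
        case False
        have "norm (u x) * gauss x \<le> norm (u x) * 1" by (intro mult_left_mono gauss_le_1) auto
        also have "\<dots> = norm (u x) powr 1" using False by simp
        also have "\<dots> \<le> norm (u x) powr r" using False r by (intro powr_mono) auto
        finally show ?thesis using gauss_pos(2)[of x] by linarith
      qed
      then show "norm (u x * complex_of_real (gauss x)) \<le> norm (gauss x + norm (u x) powr r)"
        by (simp add: norm_mult)
    qed
  qed simp
qed

lemma td_lnorm_eq:
  fixes u :: "'a::euclidean_space \<Rightarrow> complex"
  assumes u: "u \<in> Lspace p" and p: "1 \<le> p" and T: "\<And>\<phi>. \<phi> \<in> schwartz \<Longrightarrow> T \<phi> = (\<integral>x. u x * \<phi> x \<partial>lborel)"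
  shows "td_lnorm p T = lnorm p u"
  unfolding td_lnorm_def
proof (rule INF_eq_const)
  show "{u \<in> Lspace p. td_eq T (td_of_fun u)} \<noteq> {}"
    using u T by (auto simp: td_eq_def td_of_fun_def)
  fix v assume v: "v \<in> {u \<in> Lspace p. td_eq T (td_of_fun u)}"
  have "AE x in lborel. v x = u x"
  proof (rule AE_eq_by_modulated_gaussians)
    show "integrable lborel (\<lambda>x. v x * of_real (gauss x))" "integrable lborel (\<lambda>x. u x * of_real (gauss x))"
      using integrable_Lspace_gauss p u v by auto
    fix a
    show "(\<integral>x. v x * gwave ((2 * pi) *\<^sub>R a) 0 x \<partial>lborel) = (\<integral>x. u x * gwave ((2 * pi) *\<^sub>R a) 0 x \<partial>lborel)"
    proof -
      have "td_eq T (td_of_fun v)" using v by simp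
      then have "T (gwave ((2 * pi) *\<^sub>R a) 0) = td_of_fun v (gwave ((2 * pi) *\<^sub>R a) 0)"
        unfolding td_eq_def using gwave_modulated_schwartz by (rule bspec)
      then show ?thesis by (simp add: td_of_fun_def T[OF gwave_modulated_schwartz])
    qed
  qed
  then show "lnorm p v = lnorm p u"
    using u v by (intro lnorm_cong_AE) (auto simp: Lspace_def)
qed

text \<open>Evaluating the transform of \<open>f\<close> on a modulated Gaussian applies the Fourier
  transform twice, which is reflection. So the function \<open>h\<close> that represents
  \<open>f\<close> is the reflection of \<open>fhat\<close> almost everywhere.\<close>

lemma FL_representation:
  fixes fhat :: "'a::euclidean_space \<Rightarrow> complex"
  assumes f: "f \<in> FL q" and fhat: "fhat \<in> Lspace q" and eq: "td_eq (td_fourier f) (td_of_fun fhat)" and q: "1 \<le> q"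
    and \<phi>: "\<phi> \<in> schwartz"
  shows "f \<phi> = (\<integral>x. fhat (- x) * fourier \<phi> x \<partial>lborel)"
proof -
  obtain h where h: "h \<in> Lspace q" "\<And>\<phi>. \<phi> \<in> schwartz \<Longrightarrow> f \<phi> = (\<integral>x. h x * fourier \<phi> x \<partial>lborel)"
    using f by (auto simp: FL_def td_eq_def td_fourier_def td_of_fun_def)
  have [measurable]: "h \<in> borel_measurable borel" "fhat \<in> borel_measurable borel" using h fhat by (auto simp: Lspace_def)
  have [measurable]: "fourier \<phi> \<in> borel_measurable borel"
    using schwartz_integrable[OF \<phi>] by (intro fourier_measurable) auto
  have "AE x in lborel. fhat x = h (0 - x)"
  proof (rule AE_eq_by_modulated_gaussians)
    show "integrable lborel (\<lambda>x. fhat x * of_real (gauss x))"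
      using integrable_Lspace_gauss fhat q by auto
    show "integrable lborel (\<lambda>x. h (0 - x) * of_real (gauss x))"
      using integrable_shift_reflect(2)[OF integrable_Lspace_gauss[OF h(1) q], of 0] by simp
    fix a :: 'a
    let ?\<phi> = "gwave ((2 * pi) *\<^sub>R a) 0"
    have [measurable]: "?\<phi> \<in> borel_measurable borel"
      using schwartz_continuous[OF gwave_modulated_schwartz] by (rule borel_measurable_continuous_onI)
    have "td_fourier f ?\<phi> = td_of_fun fhat ?\<phi>"
      using eq gwave_modulated_schwartz unfolding td_eq_def by (rule bspec)
    then have "(\<integral>x. fhat x * ?\<phi> x \<partial>lborel) = f (fourier ?\<phi>)"
      by (simp add: td_fourier_def td_of_fun_def)
    also have "\<dots> = (\<integral>x. h x * ?\<phi> (- x) \<partial>lborel)"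
      by (simp add: h(2)[OF fourier_gwave_modulated_schwartz] fourier_fourier_gwave_modulated)
    also have "\<dots> = (\<integral>x. h (0 - x) * ?\<phi> x \<partial>lborel)"
      using integral_shift_reflect(2)[of "\<lambda>x. h x * ?\<phi> (- x)" 0] by simp
    finally show "(\<integral>x. fhat x * ?\<phi> x \<partial>lborel) = (\<integral>x. h (0 - x) * ?\<phi> x \<partial>lborel)" .
  qed
  from AE_shift_reflect(2)[OF this, of 0] have "AE x in lborel. fhat (- x) = h x" by simp
  then have "(\<integral>x. h x * fourier \<phi> x \<partial>lborel) = (\<integral>x. fhat (- x) * fourier \<phi> x \<partial>lborel)"
    by (intro integral_cong_AE) (auto elim!: eventually_mono)
  then show ?thesis using h(2)[OF \<phi>] by simp
qed

section \<open>Dual exponents and representatives in L^p\<close>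

lemma dual_exponent_infinity:
  fixes p' :: ennreal
  assumes "1 / \<infinity> + 1 / p' = (1::ennreal)"
  shows "p' = 1"
proof -
  have one: "1 / p' = 1" using assms by simp
  show ?thesis
  proof (cases p')
    case (real r)
    have "r \<noteq> 0" using one real by auto
    then have "r > 0" using real by simp
    then have "ennreal (1 / r) = ennreal 1" using one real by (simp add: divide_ennreal[symmetric])
    then have "1 / r = 1" using \<open>r > 0\<close> by (subst (asm) ennreal_inj) auto
    then show ?thesis using real by simp
  qed (use one in simp)
qed

lemma dual_exponent_finite:
  fixes p' :: ennreal
  assumes "1 / of_nat (Suc n) + 1 / p' = 1" and n: "n > 0"
  shows "p' = ennreal (real (Suc n) / real n)"
proof -
  have m: "1 / of_nat (Suc n) = ennreal (1 / real (Suc n))"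
    by (simp add: divide_ennreal[symmetric] ennreal_of_nat_eq_real_of_nat del: of_nat_Suc)
  show ?thesis
  proof (cases p')
    case (real r)
    show ?thesis
    proof (cases "r = 0")
      case True
      then show ?thesis using assms real by (simp add: m)
    next
      case False
      then have "r > 0" using real by simp
      then have "1 / p' = ennreal (1 / r)" using real by (simp add: divide_ennreal[symmetric])
      then have "ennreal (1 / real (Suc n) + 1 / r) = ennreal 1"
        using assms \<open>r > 0\<close> by (simp add: m ennreal_plus[symmetric] del: ennreal_plus of_nat_Suc)
      then have "1 / real (Suc n) + 1 / r = 1"
        using \<open>r > 0\<close> by (subst (asm) ennreal_inj) (auto simp del: of_nat_Suc)
      then have "r = real (Suc n) / real n" using \<open>r > 0\<close> n by (simp add: field_simps)
      then show ?thesis using real by simp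
    qed
  next
    case top
    then have "ennreal (1 / real (Suc n)) = ennreal 1" using assms by (simp add: m del: of_nat_Suc)
    then have "1 / real (Suc n) = 1" by (subst (asm) ennreal_inj) (auto simp del: of_nat_Suc)
    then show ?thesis using n by simp
  qed
qed

text \<open>\<open>ennreal\<close> sends negative reals to 0, so \<open>max 0 I\<close> is what the
  hypothesis determines. The sign of the convolution form can thus be left open here.\<close>

lemma lnorm_even:
  fixes u :: "'a::euclidean_space \<Rightarrow> complex"
  assumes "(\<integral>\<^sup>+x. ennreal (norm (u x) ^ Suc n) \<partial>lborel) = ennreal I"
  shows "lnorm (of_nat (Suc n)) u = ennreal (max 0 I powr (1 / real (Suc n)))"
proof -
  have p: "(of_nat (Suc n) :: ennreal) \<noteq> \<infinity>" "enn2real (of_nat (Suc n)) = real (Suc n)"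
    by (simp_all add: ennreal_of_nat_eq_real_of_nat del: of_nat_Suc)
  have "(\<integral>\<^sup>+x. ennreal (norm (u x) powr real (Suc n)) \<partial>lborel) = ennreal I"
    unfolding assms[symmetric] by (intro nn_integral_cong) (simp add: powr_realpow' del: of_nat_Suc power_Suc)
  then show ?thesis
    by (simp add: lnorm_finite_eq[OF p(1)] p(2) max_def ennreal_neg enn2real_ennreal not_le del: of_nat_Suc)
qed

lemma Lspace_1_integrable:
  assumes "h \<in> Lspace 1"
  shows "integrable lborel h"
  using assms by (auto simp: Lspace_finite_iff integrable_iff_bounded)

text \<open>One interface for both kinds of exponent. For \<open>p = \<infinity>\<close> the dual
  exponent is 1 and the transform is an absolutely convergent integral; for even \<open>p\<close> it
  is the limit of the transforms of truncations, known through its pairings and its norm.\<close>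

lemma Lspace_representative_exists:
  fixes h :: "'a::euclidean_space \<Rightarrow> complex"
  assumes p: "p = \<infinity> \<or> (\<exists>n. odd n \<and> p = of_nat (Suc n))" and dual: "1 / p + 1 / p' = 1" and h: "h \<in> Lspace p'"
  obtains u where "u \<in> Lspace p"
    "\<And>\<phi> B. integrable lborel \<phi> \<Longrightarrow> (\<And>x. norm (\<phi> x) \<le> B) \<Longrightarrow> (\<integral>x. u x * \<phi> x \<partial>lborel) = (\<integral>x. h x * fourier \<phi> x \<partial>lborel)"
    "p = \<infinity> \<Longrightarrow> u = fourier h"
    "\<And>n. p = of_nat (Suc n) \<Longrightarrow> lnorm p u = ennreal (max 0 (Re (conv_form n (alt_reflect h) 0)) powr (1 / real (Suc n)))"
proof (cases "p = \<infinity>")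
  case True
  have "p' = 1" by (rule dual_exponent_infinity[OF dual[unfolded True]])
  then have hi: "integrable lborel h" using h by (simp add: Lspace_1_integrable)
  show thesis
  proof (rule that)
    have "esssup lborel (\<lambda>x. ennreal (norm (fourier h x))) \<le> ennreal (\<integral>x. norm (h x) \<partial>lborel)"
      using hi by (intro esssup_I AE_I2 ennreal_leI norm_fourier_le) auto
    then show "fourier h \<in> Lspace p"
      using hi True by (auto simp: Lspace_def lnorm_def intro: le_less_trans)
    show "(\<integral>x. fourier h x * \<phi> x \<partial>lborel) = (\<integral>x. h x * fourier \<phi> x \<partial>lborel)" if "integrable lborel \<phi>" for \<phi>
      by (rule fourier_multiplication_formula[OF hi that])
    show "lnorm p (fourier h) = ennreal (max 0 (Re (conv_form n (alt_reflect h) 0)) powr (1 / real (Suc n)))"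
      if "p = of_nat (Suc n)" for n
      using that True by (simp add: ennreal_of_nat_eq_real_of_nat del: of_nat_Suc)
  qed simp
next
  case False
  then obtain n where n: "odd n" "p = of_nat (Suc n)" using p by auto
  have n0: "n > 0" using n by (auto intro: Nat.gr0I)
  have p': "p' = ennreal (real (Suc n) / real n)"
    using dual n0 unfolding n(2) by (rule dual_exponent_finite)
  have hm: "h \<in> borel_measurable borel" and fin: "(\<integral>\<^sup>+x. ennreal (norm (h x) powr (real (Suc n) / real n)) \<partial>lborel) < \<infinity>"
    using h by (simp_all add: p' Lspace_finite_iff enn2real_ennreal del: of_nat_Suc)
  obtain u where um: "u \<in> borel_measurable borel"
    and I: "(\<integral>\<^sup>+x. ennreal (norm (u x) ^ Suc n) \<partial>lborel) = ennreal (Re (conv_form n (alt_reflect h) 0))"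
    and u: "\<And>\<phi> B. integrable lborel \<phi> \<Longrightarrow> (\<And>x. norm (\<phi> x) \<le> B) \<Longrightarrow> (\<integral>x. u x * \<phi> x \<partial>lborel) = (\<integral>x. h x * fourier \<phi> x \<partial>lborel)"
    using Hausdorff_Young_even[OF hm n(1) fin] by blast
  have ln: "lnorm p u = ennreal (max 0 (Re (conv_form n (alt_reflect h) 0)) powr (1 / real (Suc n)))"
    unfolding n(2) by (rule lnorm_even[OF I])
  show thesis
  proof (rule that[OF _ u])
    show "u \<in> Lspace p" using um ln by (simp add: Lspace_def)
    fix m assume "p = of_nat (Suc m)"
    then have "m = n" using n by simp
    then show "lnorm p u = ennreal (max 0 (Re (conv_form m (alt_reflect h) 0)) powr (1 / real (Suc m)))"
      using ln by simp
  qed (use False in auto)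
qed

lemma lnorm_eq_0_imp_AE:
  assumes u: "u \<in> Lspace p" and p: "p \<noteq> \<infinity>" and z: "lnorm p u = 0"
  shows "AE x in lborel. u x = 0"
proof -
  have [measurable]: "u \<in> borel_measurable borel" using u by (simp add: Lspace_def)
  let ?I = "\<integral>\<^sup>+x. ennreal (norm (u x) powr enn2real p) \<partial>lborel"
  have "?I \<noteq> \<infinity>" using u p by (auto simp: Lspace_finite_iff)
  then have "enn2real ?I powr (1 / enn2real p) \<le> 0"
    using z by (simp add: lnorm_finite_eq[OF p] ennreal_eq_0_iff)
  then have "enn2real ?I = 0" by simp
  then have "?I = 0" using \<open>?I \<noteq> \<infinity>\<close> by (simp add: enn2real_eq_0_iff)
  then have "AE x in lborel. ennreal (norm (u x) powr enn2real p) = 0"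
    by (subst (asm) nn_integral_0_iff_AE) auto
  then show ?thesis by eventually_elim (simp add: ennreal_eq_0_iff)
qed

text \<open>Every modulated Gaussian is the transform of a Schwartz function, namely of the
  transform of the wave with opposite frequency.\<close>

lemma AE_0_by_fourier_gaussians:
  fixes h :: "'a::euclidean_space \<Rightarrow> complex"
  assumes h: "h \<in> Lspace q" "1 \<le> q" and z: "\<And>\<phi>. \<phi> \<in> schwartz \<Longrightarrow> (\<integral>x. h x * fourier \<phi> x \<partial>lborel) = 0"
  shows "AE x in lborel. h x = 0"
proof (rule AE_eq_by_modulated_gaussians)
  show "integrable lborel (\<lambda>x. h x * of_real (gauss x))" by (rule integrable_Lspace_gauss[OF h])
  fix a :: 'a
  have "fourier (fourier (gwave ((2 * pi) *\<^sub>R (- a)) 0)) x = gwave ((2 * pi) *\<^sub>R a) 0 x" for x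
    unfolding fourier_fourier_gwave_modulated by (simp add: gwave_def)
  then show "(\<integral>x. h x * gwave ((2 * pi) *\<^sub>R a) 0 x \<partial>lborel) = (\<integral>x. 0 * gwave ((2 * pi) *\<^sub>R a) 0 x \<partial>lborel)"
    using z[OF fourier_gwave_modulated_schwartz[of "- a"]] by simp
qed simp

text \<open>Translating the Fourier transform of \<open>h\<close> corresponds to multiplying
  \<open>h\<close> by a character. As \<open>u\<close> is known only through its pairings, the shift
  is moved onto \<open>\<phi>\<close>, where the transform is an honest integral.\<close>

lemma translated_representative:
  fixes h u :: "'a::euclidean_space \<Rightarrow> complex"
  assumes um: "u \<in> borel_measurable borel"
    and u: "\<And>\<phi> B. integrable lborel \<phi> \<Longrightarrow> (\<And>x. norm (\<phi> x) \<le> B) \<Longrightarrow> (\<integral>x. u x * \<phi> x \<partial>lborel) = (\<integral>x. h x * fourier \<phi> x \<partial>lborel)"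
    and \<phi>: "integrable lborel \<phi>" "\<And>x. norm (\<phi> x) \<le> B"
  shows "(\<integral>x. c * u (s + x) * \<phi> x \<partial>lborel) = (\<integral>x. c * cis (- 2 * pi * (s \<bullet> x)) * h x * fourier \<phi> x \<partial>lborel)"
proof -
  have [measurable]: "u \<in> borel_measurable borel" "\<phi> \<in> borel_measurable borel" using um \<phi> by auto
  let ?\<psi> = "\<lambda>x. \<phi> (- s + x)"
  have \<psi>: "integrable lborel ?\<psi>" by (rule integrable_shift_reflect(1)[OF \<phi>(1)])
  have F: "fourier ?\<psi> x = cis (- 2 * pi * (s \<bullet> x)) * fourier \<phi> x" for x
  proof -
    have "fourier ?\<psi> x = (\<integral>y. cis (- 2 * pi * ((s + y) \<bullet> x)) * \<phi> (- s + (s + y)) \<partial>lborel)"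
      unfolding fourier_def
      using integral_shift_reflect(1)[of "\<lambda>y. cis (- 2 * pi * (y \<bullet> x)) * \<phi> (- s + y)" s] by simp
    also have "\<dots> = (\<integral>y. cis (- 2 * pi * (s \<bullet> x)) * (cis (- 2 * pi * (y \<bullet> x)) * \<phi> y) \<partial>lborel)"
      by (intro Bochner_Integration.integral_cong refl) (simp add: cis_mult inner_add_left algebra_simps)
    also have "\<dots> = cis (- 2 * pi * (s \<bullet> x)) * fourier \<phi> x"
      unfolding fourier_def by (rule integral_mult_right_zero)
    finally show ?thesis .
  qed
  have "(\<integral>x. c * u (s + x) * \<phi> x \<partial>lborel) = (\<integral>x. c * (u (s + x) * ?\<psi> (s + x)) \<partial>lborel)"
    by (simp add: mult.assoc)
  also have "\<dots> = c * (\<integral>x. u (s + x) * ?\<psi> (s + x) \<partial>lborel)"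
    by (rule integral_mult_right_zero)
  also have "(\<integral>x. u (s + x) * ?\<psi> (s + x) \<partial>lborel) = (\<integral>x. u x * ?\<psi> x \<partial>lborel)"
    using integral_shift_reflect(1)[of "\<lambda>x. u x * ?\<psi> x" s] by simp
  also have "\<dots> = (\<integral>x. h x * fourier ?\<psi> x \<partial>lborel)" by (rule u[OF \<psi>]) (rule \<phi>(2))
  also have "c * \<dots> = (\<integral>x. c * (h x * fourier ?\<psi> x) \<partial>lborel)" by (rule integral_mult_right_zero[symmetric])
  finally show ?thesis unfolding F by (simp add: mult_ac)
qed

theorem lemma5p2:
  fixes p p' :: ennreal
    and f g :: "'a::euclidean_space functional"
    and fhat ghat :: "'a \<Rightarrow> complex"
  assumes p: "p = \<infinity> \<or> (\<exists>n::nat. even n \<and> 2 < n \<and> p = of_nat n)"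
    and dual: "1 / p + 1 / p' = 1"
    and f: "f \<in> FL p'" and g: "g \<in> FL p'"
    and fhat: "fhat \<in> Lspace p'" "td_eq (td_fourier f) (td_of_fun fhat)"
    and ghat: "ghat \<in> Lspace p'" "td_eq (td_fourier g) (td_of_fun ghat)"
    and majorant: "AE \<xi> in lborel. ghat \<xi> \<in> \<real> \<and> norm (fhat \<xi>) \<le> Re (ghat \<xi>)"
    and cont: "continuous_on UNIV fhat"
    and conn: "connected {\<xi>. norm (fhat \<xi>) > 0}"
  shows "td_lnorm p f = td_lnorm p g \<longleftrightarrow>
    (\<exists>(\<alpha>::real) (\<beta>::'a) ghat'. continuous_on UNIV ghat' \<and> (AE \<xi> in lborel. ghat' \<xi> = ghat \<xi>) \<and>
       (\<forall>\<xi>. fhat \<xi> = cis (\<alpha> + \<beta> \<bullet> \<xi>) * ghat' \<xi>))"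
proof -
  \<comment> \<open>In the even case \<open>p = n + 1\<close>, where the odd number
    \<open>n \<ge> 3\<close> counts the free variables of the convolution integrand.\<close>
  have p2: "p = \<infinity> \<or> (\<exists>n. odd n \<and> n \<ge> 3 \<and> p = of_nat (Suc n))"
  proof (cases "p = \<infinity>")
    case False
    then obtain m where m: "even m" "2 < m" "p = of_nat m" using p by auto
    then have "odd (m - 1)" "m - 1 \<ge> 3" "m = Suc (m - 1)" by (auto elim!: evenE)
    then show ?thesis using m(3) by metis
  qed simp
  then have p3: "p = \<infinity> \<or> (\<exists>n. odd n \<and> p = of_nat (Suc n))" by blast
  have p1: "1 \<le> p" using p by (auto simp: ennreal_of_nat_eq_real_of_nat ennreal_1[symmetric] simp del: ennreal_1)
  have q1: "1 \<le> p'"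
  proof (cases "p = \<infinity>")
    case True
    have "p' = 1" by (rule dual_exponent_infinity[OF dual[unfolded True]])
    then show ?thesis by simp
  next
    case False
    then obtain n where n: "n \<ge> 3" "p = of_nat (Suc n)" using p2 by blast
    have "p' = ennreal (real (Suc n) / real n)"
      by (rule dual_exponent_finite[OF dual[unfolded n(2)]]) (use n(1) in simp)
    moreover have "1 \<le> real (Suc n) / real n" using n(1) by simp
    ultimately show ?thesis by (simp only: ennreal_1[symmetric] ennreal_leI)
  qed
  have [measurable]: "fhat \<in> borel_measurable borel" "ghat \<in> borel_measurable borel"
    using fhat ghat by (auto simp: Lspace_def)
  \<comment> \<open>A real Borel version of \<open>ghat\<close> that dominates
    \<open>norm (fhat \<xi>)\<close> at every point: on the exceptional null set it is redefined as
    that norm.\<close>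
  define G where "G \<xi> = (if Im (ghat \<xi>) = 0 \<and> norm (fhat \<xi>) \<le> Re (ghat \<xi>) then Re (ghat \<xi>) else norm (fhat \<xi>))" for \<xi>
  have [measurable]: "G \<in> borel_measurable borel" unfolding G_def[abs_def] by measurable
  have fG: "norm (fhat \<xi>) \<le> G \<xi>" for \<xi> by (simp add: G_def)
  have GAE: "AE \<xi> in lborel. ghat \<xi> = of_real (G \<xi>)"
    using majorant by eventually_elim (auto simp: G_def complex_eq_iff complex_is_Real_iff)
  define a where "a x = fhat (- x)" for x
  define B where "B x = G (- x)" for x
  have [measurable]: "a \<in> borel_measurable borel" "B \<in> borel_measurable borel" unfolding a_def[abs_def] B_def[abs_def] by measurable
  have aB: "norm (a x) \<le> B x" for x by (simp add: a_def B_def fG)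
  have ac: "continuous_on UNIV a" unfolding a_def[abs_def] by (intro continuous_intros continuous_on_compose2[OF cont]) auto
  have reflect: "(\<lambda>x. h (- x)) \<in> Lspace q" if "h \<in> Lspace q" for h :: "'a \<Rightarrow> complex" and q
  proof -
    have [measurable]: "h \<in> borel_measurable borel" using that by (simp add: Lspace_def)
    have "esssup lborel (\<lambda>x. ennreal (norm (h (- x)))) \<le> esssup lborel (\<lambda>x. ennreal (norm (h x)))"
      using AE_shift_reflect(2)[OF esssup_AE[of "\<lambda>x. ennreal (norm (h x))" lborel], of 0] by (intro esssup_I) simp_all
    moreover have "(\<integral>\<^sup>+x. ennreal (norm (h (- x)) powr enn2real q) \<partial>lborel) = (\<integral>\<^sup>+x. ennreal (norm (h x) powr enn2real q) \<partial>lborel)"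
      using nn_integral_shift_reflect(2)[of "\<lambda>x. ennreal (norm (h x) powr enn2real q)" 0] by simp
    ultimately show ?thesis using that by (auto simp: Lspace_def lnorm_def intro: le_less_trans)
  qed
  have aL: "a \<in> Lspace p'" unfolding a_def[abs_def] by (rule reflect[OF fhat(1)])
  have GL: "(\<lambda>\<xi>. complex_of_real (G \<xi>)) \<in> Lspace p'" by (rule Lspace_cong_AE[OF ghat(1) _ GAE]) simp
  have BL: "(\<lambda>x. complex_of_real (B x)) \<in> Lspace p'" unfolding B_def by (rule reflect[OF GL])
  have frep: "f \<phi> = (\<integral>x. a x * fourier \<phi> x \<partial>lborel)" if "\<phi> \<in> schwartz" for \<phi>
    unfolding a_def by (rule FL_representation[OF f fhat q1 that])
  have grep: "g \<phi> = (\<integral>x. of_real (B x) * fourier \<phi> x \<partial>lborel)" if "\<phi> \<in> schwartz" for \<phi>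
  proof -
    have [measurable]: "fourier \<phi> \<in> borel_measurable borel"
      using schwartz_integrable[OF that] by (intro fourier_measurable) auto
    have "(\<integral>x. ghat (- x) * fourier \<phi> x \<partial>lborel) = (\<integral>x. of_real (B x) * fourier \<phi> x \<partial>lborel)"
      using AE_shift_reflect(2)[OF GAE, of 0] by (intro integral_cong_AE) (auto simp: B_def elim!: eventually_mono)
    then show ?thesis using FL_representation[OF g ghat q1 that] by simp
  qed
  obtain u where u: "u \<in> Lspace p"
    "\<And>\<phi> B. integrable lborel \<phi> \<Longrightarrow> (\<And>x. norm (\<phi> x) \<le> B) \<Longrightarrow> (\<integral>x. u x * \<phi> x \<partial>lborel) = (\<integral>x. a x * fourier \<phi> x \<partial>lborel)"
    "p = \<infinity> \<Longrightarrow> u = fourier a"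
    "\<And>n. p = of_nat (Suc n) \<Longrightarrow> lnorm p u = ennreal (max 0 (Re (conv_form n (alt_reflect a) 0)) powr (1 / real (Suc n)))"
    using Lspace_representative_exists[OF p3 dual aL] by blast
  obtain v where v: "v \<in> Lspace p"
    "\<And>\<phi> C. integrable lborel \<phi> \<Longrightarrow> (\<And>x. norm (\<phi> x) \<le> C) \<Longrightarrow> (\<integral>x. v x * \<phi> x \<partial>lborel) = (\<integral>x. of_real (B x) * fourier \<phi> x \<partial>lborel)"
    "p = \<infinity> \<Longrightarrow> v = fourier (\<lambda>x. of_real (B x))"
    "\<And>n. p = of_nat (Suc n) \<Longrightarrow> lnorm p v = ennreal (max 0 (Re (conv_form n (alt_reflect (\<lambda>x. of_real (B x))) 0)) powr (1 / real (Suc n)))"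
    using Lspace_representative_exists[OF p3 dual BL] by blast
  have fnorm: "td_lnorm p f = lnorm p u"
  proof (rule td_lnorm_eq[OF u(1) p1])
    fix \<phi> :: "'a \<Rightarrow> complex" assume \<phi>: "\<phi> \<in> schwartz"
    obtain C where C: "\<And>x. norm (\<phi> x) \<le> C" using schwartz_bounded[OF \<phi>] by blast
    show "f \<phi> = (\<integral>x. u x * \<phi> x \<partial>lborel)"
      unfolding u(2)[OF schwartz_integrable[OF \<phi>] C] by (rule frep[OF \<phi>])
  qed
  have gnorm: "td_lnorm p g = lnorm p v"
  proof (rule td_lnorm_eq[OF v(1) p1])
    fix \<phi> :: "'a \<Rightarrow> complex" assume \<phi>: "\<phi> \<in> schwartz"
    obtain C where C: "\<And>x. norm (\<phi> x) \<le> C" using schwartz_bounded[OF \<phi>] by blast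
    show "g \<phi> = (\<integral>x. v x * \<phi> x \<partial>lborel)"
      unfolding v(2)[OF schwartz_integrable[OF \<phi>] C] by (rule grep[OF \<phi>])
  qed
  show ?thesis
  proof
    assume "\<exists>(\<alpha>::real) (\<beta>::'a) ghat'. continuous_on UNIV ghat' \<and> (AE \<xi> in lborel. ghat' \<xi> = ghat \<xi>) \<and>
       (\<forall>\<xi>. fhat \<xi> = cis (\<alpha> + \<beta> \<bullet> \<xi>) * ghat' \<xi>)"
    then obtain \<alpha> \<beta> ghat' where gh: "AE \<xi> in lborel. ghat' \<xi> = ghat \<xi>" "\<And>\<xi>. fhat \<xi> = cis (\<alpha> + \<beta> \<bullet> \<xi>) * ghat' \<xi>" by auto
    \<comment> \<open>Chosen so that \<open>cis (- 2 * pi * (s \<bullet> x))\<close> is the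
      character \<open>cis (\<beta> \<bullet> \<xi>)\<close> at \<open>\<xi> = - x\<close>; it makes
      \<open>f\<close> the translate of \<open>g\<close> by \<open>s\<close>, times
      \<open>cis \<alpha>\<close>.\<close>
    define s where "s = (1 / (2 * pi)) *\<^sub>R \<beta>"
    have "AE \<xi> in lborel. fhat \<xi> = cis (\<alpha> + \<beta> \<bullet> \<xi>) * of_real (G \<xi>)"
      using GAE gh(1) by eventually_elim (use gh(2) in metis)
    from AE_shift_reflect(2)[OF this, of 0]
    have aAE: "AE x in lborel. a x = cis \<alpha> * cis (- 2 * pi * (s \<bullet> x)) * of_real (B x)"
      by (auto simp: a_def B_def s_def cis_mult elim!: eventually_mono)
    have vm: "v \<in> borel_measurable borel" using v(1) by (simp add: Lspace_def)
    have "td_lnorm p f = lnorm p (\<lambda>x. cis \<alpha> * v (s + x))"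
    proof (rule td_lnorm_eq[OF _ p1])
      show "(\<lambda>x. cis \<alpha> * v (s + x)) \<in> Lspace p"
        using v(1) vm lnorm_shift[OF vm, of "cis \<alpha>" p s] by (simp add: Lspace_def)
      fix \<phi> :: "'a \<Rightarrow> complex" assume \<phi>: "\<phi> \<in> schwartz"
      obtain C where C: "\<And>x. norm (\<phi> x) \<le> C" using schwartz_bounded[OF \<phi>] by blast
      have [measurable]: "fourier \<phi> \<in> borel_measurable borel"
        using schwartz_integrable[OF \<phi>] by (intro fourier_measurable) auto
      have "f \<phi> = (\<integral>x. cis \<alpha> * cis (- 2 * pi * (s \<bullet> x)) * of_real (B x) * fourier \<phi> x \<partial>lborel)"
        unfolding frep[OF \<phi>] using aAE by (intro integral_cong_AE) (auto elim!: eventually_mono)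
      also have "\<dots> = (\<integral>x. cis \<alpha> * v (s + x) * \<phi> x \<partial>lborel)"
        by (rule translated_representative[OF vm v(2) schwartz_integrable[OF \<phi>] C, symmetric])
      finally show "f \<phi> = (\<integral>x. cis \<alpha> * v (s + x) * \<phi> x \<partial>lborel)" .
    qed
    also have "\<dots> = td_lnorm p g" using lnorm_shift[OF vm, of "cis \<alpha>" p s] gnorm by simp
    finally show "td_lnorm p f = td_lnorm p g" .
  next
    assume "td_lnorm p f = td_lnorm p g"
    then have eq: "lnorm p u = lnorm p v" using fnorm gnorm by simp
    \<comment> \<open>Once this holds, \<open>norm (fhat \<xi>)\<close> serves as the continuous
      representative of \<open>ghat\<close>.\<close>
    have "\<exists>(\<alpha>::real) (\<beta>::'a). (AE \<xi> in lborel. norm (fhat \<xi>) = G \<xi>) \<and> (\<forall>\<xi>. fhat \<xi> = cis (\<alpha> + \<beta> \<bullet> \<xi>) * of_real (norm (fhat \<xi>)))"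
    proof (cases "p = \<infinity>")
      case True
      have "p' = 1" by (rule dual_exponent_infinity[OF dual[unfolded True]])
      then have ai: "integrable lborel a" and "integrable lborel (\<lambda>x. complex_of_real (B x))"
        using aL BL by (simp_all only: Lspace_1_integrable)
      then have Bi: "integrable lborel B" by (simp add: complex_of_real_integrable_eq)
      obtain c w where c: "norm c = 1" and cw: "AE x in lborel. of_real (B x) = c * cis (w \<bullet> x) * a x"
        by (rule esssup_fourier_equality[OF ai Bi aB]) (use eq True u(3) v(3) in \<open>auto simp: lnorm_def\<close>)
      from AE_shift_reflect(2)[OF cw, of 0] have cw': "AE \<xi> in lborel. of_real (G \<xi>) = c * cis (- (w \<bullet> \<xi>)) * fhat \<xi>"
        by (simp add: a_def B_def)
      have nG: "AE \<xi> in lborel. norm (fhat \<xi>) = G \<xi>"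
        using cw'
      proof eventually_elim
        case (elim \<xi>)
        have "norm (complex_of_real (G \<xi>)) = norm (c * cis (- (w \<bullet> \<xi>)) * fhat \<xi>)" by (simp only: elim)
        then show ?case using c order_trans[OF norm_ge_zero fG[of \<xi>]] by (simp add: norm_mult)
      qed
      \<comment> \<open>With \<open>G\<close> replaced by \<open>norm (fhat \<xi>)\<close> both
        sides are continuous, so the identity passes from almost every point to all points.\<close>
      have "(\<lambda>\<xi>. complex_of_real (norm (fhat \<xi>))) = (\<lambda>\<xi>. c * cis (- (w \<bullet> \<xi>)) * fhat \<xi>)"
      proof (rule AE_eq_continuous)
        show "AE \<xi> in lborel. complex_of_real (norm (fhat \<xi>)) = c * cis (- (w \<bullet> \<xi>)) * fhat \<xi>"
          using cw' nG by eventually_elim simp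
        show "continuous_on UNIV (\<lambda>\<xi>. complex_of_real (norm (fhat \<xi>)))" by (intro continuous_intros cont)
        show "continuous_on UNIV (\<lambda>\<xi>. c * cis (- (w \<bullet> \<xi>)) * fhat \<xi>)"
          unfolding cis_conv_exp by (intro continuous_intros cont)
      qed
      then have nf: "of_real (norm (fhat \<xi>)) = c * cis (- (w \<bullet> \<xi>)) * fhat \<xi>" for \<xi> by meson
      have cc: "cis (Arg (cnj c)) = cnj c" using c by (subst cis_Arg) (auto simp: sgn_eq)
      have "fhat \<xi> = cis (Arg (cnj c) + w \<bullet> \<xi>) * of_real (norm (fhat \<xi>))" for \<xi>
      proof -
        have "cis (Arg (cnj c) + w \<bullet> \<xi>) * of_real (norm (fhat \<xi>)) = (cnj c * c) * (cis (w \<bullet> \<xi>) * cis (- (w \<bullet> \<xi>))) * fhat \<xi>"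
          unfolding nf by (simp add: cis_mult[symmetric] cc mult_ac)
        also have "cnj c * c = 1" using c complex_norm_square[of c] by (simp add: mult.commute)
        also have "cis (w \<bullet> \<xi>) * cis (- (w \<bullet> \<xi>)) = 1" by (simp add: cis_mult)
        finally show ?thesis by simp
      qed
      with nG show ?thesis by blast
    next
      case False
      then obtain n where n: "odd n" "n \<ge> 3" "p = of_nat (Suc n)" using p2 by blast
      have n0: "n > 0" using n by simp
      have p'eq: "p' = ennreal (real (Suc n) / real n)"
        using dual n0 unfolding n(3) by (rule dual_exponent_finite)
      have B0: "0 \<le> B x" for x using order_trans[OF norm_ge_zero aB] .
      have Bfin: "(\<integral>\<^sup>+x. ennreal (B x powr (real (Suc n) / real n)) \<partial>lborel) < \<infinity>"
        using BL B0 by (simp add: p'eq Lspace_finite_iff enn2real_ennreal del: of_nat_Suc)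
      let ?Da = "conv_form n (alt_reflect a) 0" and ?Db = "conv_form n (alt_reflect (\<lambda>x. complex_of_real (B x))) 0"
      have Dle: "norm ?Da \<le> Re ?Db" by (rule norm_conv_form_alt_le) (use n aB Bfin in auto)
      have "max 0 (Re ?Da) powr (1 / real (Suc n)) = max 0 (Re ?Db) powr (1 / real (Suc n))"
        using eq u(4)[OF n(3)] v(4)[OF n(3)] by (simp add: ennreal_inj del: of_nat_Suc)
      then have "(max 0 (Re ?Da) powr (1 / real (Suc n))) powr real (Suc n) = (max 0 (Re ?Db) powr (1 / real (Suc n))) powr real (Suc n)"
        by (simp only:)
      then have "max 0 (Re ?Da) = max 0 (Re ?Db)" by (simp add: powr_powr del: of_nat_Suc)
      then have Deq: "Re ?Da = Re ?Db"
        using Dle abs_Re_le_cmod[of ?Da] by (auto simp: max_def split: if_splits)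
      have inteq: "AE x in lborel_pow {..<n}. conv_integrand n (alt_reflect a) 0 x = conv_integrand n (alt_reflect (\<lambda>x. of_real (B x))) 0 x"
        by (rule conv_form_equality_imp_AE_integrand) (use n aB Bfin Deq in auto)
      show ?thesis
      \<comment> \<open>If \<open>fhat\<close> vanishes identically there is no ball on which to
        place the variables. Then the norm of \<open>g\<close> is 0, its representative
        \<open>v\<close> vanishes almost everywhere, and injectivity of the Fourier transform gives
        \<open>B = 0\<close> almost everywhere.\<close>
      proof (cases "\<exists>c. a c \<noteq> 0")
        case False
        then have a0: "a x = 0" for x by auto
        have f0: "fhat \<xi> = 0" for \<xi> using a0[of "- \<xi>"] by (simp add: a_def)
        have "alt_reflect a i y = 0" for i y by (simp add: alt_reflect_def a0)
        then have "?Da = 0" by (simp add: conv_form_def conv_integrand_def)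
        then have "lnorm p v = 0" using eq u(4)[OF n(3)] by simp
        then have "AE x in lborel. v x = 0" using v(1) \<open>p \<noteq> \<infinity>\<close> by (intro lnorm_eq_0_imp_AE) auto
        then have "(\<integral>x. of_real (B x) * fourier \<phi> x \<partial>lborel) = 0" if \<phi>: "\<phi> \<in> schwartz" for \<phi>
        proof -
          assume v0: "AE x in lborel. v x = 0"
          obtain C where C: "\<And>x. norm (\<phi> x) \<le> C" using schwartz_bounded[OF \<phi>] by blast
          have "(\<integral>x. v x * \<phi> x \<partial>lborel) = 0"
            using v0 by (intro integral_eq_zero_AE) (auto elim!: eventually_mono)
          then show ?thesis using v(2)[OF schwartz_integrable[OF \<phi>] C] by simp
        qed
        then have "AE x in lborel. complex_of_real (B x) = 0" by (rule AE_0_by_fourier_gaussians[OF BL q1])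
        from AE_shift_reflect(2)[OF this, of 0] have "AE \<xi> in lborel. G \<xi> = 0"
          by (simp add: B_def)
        then have "AE \<xi> in lborel. norm (fhat \<xi>) = G \<xi>"
          by eventually_elim (simp add: f0)
        then show ?thesis by (simp add: f0)
      next
        case True
        then obtain c where c: "a c \<noteq> 0" by auto
        have "open {x. a x \<noteq> 0}" using ac by (intro open_Collect_neq continuous_intros)
        then obtain r where r: "r > 0" "ball c r \<subseteq> {x. a x \<noteq> 0}" using c open_contains_ball by blast
        have "AE x in lborel. norm (a x) = B x"
          by (rule AE_integrand_eq_imp_AE_norm_eq[where c=c and r=r and n=n]) (use n aB inteq r in auto)
        from AE_shift_reflect(2)[OF this, of 0] have nG: "AE \<xi> in lborel. norm (fhat \<xi>) = G \<xi>"
          by (simp add: a_def B_def)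
        \<comment> \<open>The integrand built from \<open>B\<close> is nonnegative, so the one built
          from \<open>a\<close> agrees with its own norm. In this form both sides are continuous and
          \<open>B\<close> has disappeared.\<close>
        have "AE x in lborel_pow {..<n}. conv_integrand n (alt_reflect a) 0 x = of_real (norm (conv_integrand n (alt_reflect a) 0 x))"
          using inteq
        proof eventually_elim
          case (elim x)
          have "0 \<le> conv_integrand n (\<lambda>i t. B (if even i then t else - t)) 0 x"
            unfolding conv_integrand_def by (intro mult_nonneg_nonneg prod_nonneg B0)
          then show ?case unfolding elim conv_integrand_alt_of_real by simp
        qed
        then have nonneg: "conv_integrand n (alt_reflect a) 0 x = of_real (norm (conv_integrand n (alt_reflect a) 0 x))" for x
          by (rule AE_integrand_nonneg_imp_all[OF ac])
        let ?\<Omega> = "{\<xi>. norm (fhat \<xi>) > 0}"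
        obtain \<alpha> \<beta> where ab: "\<And>\<xi>. \<xi> \<in> ?\<Omega> \<Longrightarrow> sgn (fhat \<xi>) = cis (\<alpha> + \<beta> \<bullet> \<xi>)"
        proof (rule unimodular_additive_imp_cis[of ?\<Omega> "\<lambda>\<xi>. sgn (fhat \<xi>)"])
          show "open ?\<Omega>" using cont by (intro open_Collect_less continuous_intros)
          show "connected ?\<Omega>" by (rule conn)
          show "?\<Omega> \<noteq> {}" using c by (auto simp: a_def)
          show "continuous_on ?\<Omega> (\<lambda>\<xi>. sgn (fhat \<xi>))"
            unfolding sgn_eq by (intro continuous_intros continuous_on_subset[OF cont]) auto
          show "norm (sgn (fhat x)) = 1" if "x \<in> ?\<Omega>" for x using that by (simp add: norm_sgn)
          show "sgn (fhat x) * sgn (fhat y) = sgn (fhat x') * sgn (fhat y')"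
            if "x \<in> ?\<Omega>" "y \<in> ?\<Omega>" "x' \<in> ?\<Omega>" "y' \<in> ?\<Omega>" "x + y = x' + y'" for x y x' y'
          proof -
            have "- x + - y = - x' + - y'" using that(5) by (metis minus_add_distrib)
            then have "sgn (a (- x)) * sgn (a (- y)) = sgn (a (- x')) * sgn (a (- y'))"
              using that(1-4) by (intro integrand_nonneg_imp_sgn_mult[OF n(1,2) nonneg]) (auto simp: a_def)
            then show ?thesis by (simp add: a_def)
          qed
        qed (rule that)
        have "fhat \<xi> = cis (\<alpha> + \<beta> \<bullet> \<xi>) * of_real (norm (fhat \<xi>))" for \<xi>
        proof (cases "fhat \<xi> = 0")
          case False
          then have "cis (\<alpha> + \<beta> \<bullet> \<xi>) = sgn (fhat \<xi>)" using ab[of \<xi>] by simp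
          then show ?thesis using False by (simp add: sgn_eq)
        qed simp
        with nG show ?thesis by blast
      qed
    qed
    then obtain \<alpha> \<beta> where nG: "AE \<xi> in lborel. norm (fhat \<xi>) = G \<xi>"
      and ph: "\<And>\<xi>. fhat \<xi> = cis (\<alpha> + \<beta> \<bullet> \<xi>) * of_real (norm (fhat \<xi>))" by blast
    have "AE \<xi> in lborel. complex_of_real (norm (fhat \<xi>)) = ghat \<xi>"
      using nG GAE by eventually_elim simp
    moreover have "continuous_on UNIV (\<lambda>\<xi>. complex_of_real (norm (fhat \<xi>)))" by (intro continuous_intros cont)
    ultimately show "\<exists>(\<alpha>::real) (\<beta>::'a) ghat'. continuous_on UNIV ghat' \<and> (AE \<xi> in lborel. ghat' \<xi> = ghat \<xi>) \<and>
       (\<forall>\<xi>. fhat \<xi> = cis (\<alpha> + \<beta> \<bullet> \<xi>) * ghat' \<xi>)"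
      using ph by (intro exI[of _ \<alpha>] exI[of _ \<beta>] exI[of _ "\<lambda>\<xi>. complex_of_real (norm (fhat \<xi>))"]) auto
  qed
qed

end
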